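(* Let $k\ge1$ and $m\ge1$ be integers, and let $$\mathcal{W}_m^k(q)=\prod_{i=1}^{k}\frac{1-q^{mi}}{1-q^{i}}.$$ Each of the sets $\mathcal{X}_m^k\simeq\mathcal{Y}_m^k\simeq\mathcal{Z}_m^k$, with its action of the cyclic group $C_{k+1}$ of order $k+1$ (generated by $\phi$ on $\mathcal{X}_m^k$, by the geometric rotation $\rho$ on $\mathcal{Z}_m^k$, and by the action on $\mathcal{Y}_m^k$ transported from $\mathcal{Z}_m^k$), exhibits the cyclic sieving phenomenon together with the polynomial $\mathcal{W}_m^k(q)$. That is, the triples $(\mathcal{X}_m^k,\mathcal{W}_m^k(q),C_{k+1})$, $(\mathcal{Y}_m^k,\mathcal{W}_m^k(q),C_{k+1})$ and $(\mathcal{Z}_m^k,\mathcal{W}_m^k(q),C_{k+1})$ exhibit the cyclic sieving phenomenon.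
   Context: Cyclic sieving phenomenon: for a finite set $X$, a polynomial $X(q)$ and a cyclic group $C$ of order $n$ acting on $X$, the triple $(X,X(q),C)$ exhibits the cyclic sieving phenomenon if for every $c\in C$, $X(\omega(c))=|\{x\in X: c(x)=x\}|$, where $\omega$ is an isomorphism of $C$ with the group of $n$th roots of unity in $\mathbb{C}$. The set $\mathcal{X}_m^k$ and $\phi$: $\mathcal{X}_m^k$ is the set of words $\mathbf{x}$ of length $k$ on $\mathbb{Z}/m\mathbb{Z}=\{0,\dots,m-1\}$. For such a word, $\mathbf{x}-i$ denotes the word obtained by subtracting $i$ from each letter mod $m$. The extended word of $\mathbf{x}$ is the word of length $(k+1)m$ $$\overline{\mathbf{x}}=(\mathbf{x})(m-1)(\mathbf{x}-1)(m-2)\cdots(\mathbf{x}-m+1)(0).$$ Rotate $\overline{\mathbf{x}}$ cyclically to the left so that its leftmost $0$ becomes its rightmost character; $\phi(\mathbf{x})$ is the word formed by the first $k$ letters of the result. One has $\phi^{k+1}=\mathrm{id}$. The set $\mathcal{Z}_m^k$ and $\rho$: let $\alpha_1,\dots,\alpha_k$ be simple roots of the root system $\Phi$ of type $A_k$ in a $k$-dimensional real vector space $V$ with form $\langle\cdot,\cdot\rangle$ normalized by $\langle\alpha,\alpha\rangle=2$ for roots $\alpha$, let $\alpha_0=-\sum_{i=1}^k\alpha_i$, and let $H_{v,p}=\{x:\langle v,x\rangle=p\}$. Alcoves are the connected components of $V\setminus\bigcup_{\alpha\in\Phi,p\in\mathbb{Z}}H_{\alpha,p}$. $\mathcal{Z}_m^k$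 is the set of alcoves contained in the simplex $\{x:\langle\alpha_i,x\rangle\ge0\ (1\le i\le k),\ \langle-\alpha_0,x\rangle\le m\}$. With vertices $v_0=0$ and $v_i$ defined by $\langle\alpha_j,v_i\rangle=m\delta_{ij}$, $\rho$ is the affine map with $\rho(v_i)=v_{i+1}$ (indices mod $k+1$); it permutes $\mathcal{Z}_m^k$. The set $\mathcal{Y}_m^k$: a $(k+1)$-core is a partition none of whose boxes has hook length $k+1$. For $1\le i\le k$ let $R_{k,i}=(i^{k-i+1})$, the rectangle with $k-i+1$ parts of size $i$. For $k\ge i_1\ge\dots\ge i_{m-1}\ge1$ let $R_{k,\{i_1,\dots,i_{m-1}\}}$ be the partition consisting of, for $j=1,\dots,m-1$ in order, $k+1-i_j$ parts of size $i_j+i_{j+1}+\cdots+i_{m-1}$. $\mathcal{Y}_m^k$ is the set of $(k+1)$-cores whose Ferrers diagram is contained in some $R_{k,\{i_1,\dots,i_{m-1}\}}$. Identification of $\mathcal{Y}_m^k$ and $\mathcal{Z}_m^k$: the affine symmetric group is generated by the reflections $s_i$ in $H_{\alpha_i,0}$ ($1\le i\le k$) and $s_0$ in $H_{-\alpha_0,1}$. It acts on $(k+1)$-cores: with the box in row $a$, column $b$ having content $(b-a)\bmod(k+1)$, $s_i\lambda$ is obtained from $\lambda$ by adding all addable boxes of content $i$, or removing all removable boxes of content $i$ (a core never has both kinds; if it has neither, $s_i\lambda=\lambda$). The alcove $u(A_0)$ lying in the dominant chamber, where $A_0$ is the fundamental alcove, corresponds to the core $u^{-1}\emptyset$; this restricts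 to a bijection between $\mathcal{Z}_m^k$ and $\mathcal{Y}_m^k$, through which the action of $\rho$ is transported to $\mathcal{Y}_m^k$. *)

theory Defs
  imports
    "HOL-Analysis.Analysis"
    "HOL-Computational_Algebra.Polynomial"
    "HOL-Algebra.Group_Action"
    "HOL-Algebra.Elementary_Groups"
begin

section \<open>Cyclic sieving\<close>

definition unity_roots_group :: "nat \<Rightarrow> complex monoid" where
  "unity_roots_group n = \<lparr>carrier = {z. z ^ n = 1}, mult = (*), one = 1\<rparr>"

text \<open>
  The identity is required for every isomorphism \<open>\<omega>\<close>. At least one exists for a finite cyclic
  group, see \<open>unity_roots_iso\<close> below. \<^const>\<open>group_action\<close> takes values in \<^const>\<open>BijGroup\<close>, so
  each \<open>act c\<close> is a permutation of \<open>X\<close>, undefined outside \<open>X\<close>.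
\<close>
definition cyclic_sieving ::
    "'x set \<Rightarrow> int poly \<Rightarrow> ('g, 'b) monoid_scheme \<Rightarrow> ('g \<Rightarrow> 'x \<Rightarrow> 'x) \<Rightarrow> bool" where
  "cyclic_sieving X P C act \<longleftrightarrow>
     finite X \<and> cyclic_group C \<and> finite (carrier C) \<and> group_action C X act \<and>
     (\<forall>\<omega> \<in> iso C (unity_roots_group (order C)). \<forall>c \<in> carrier C.
        poly (map_poly of_int P) (\<omega> c) = of_nat (card {x \<in> X. act c x = x}))"

definition cyclic_action :: "'x set \<Rightarrow> ('x \<Rightarrow> 'x) \<Rightarrow> int \<Rightarrow> 'x \<Rightarrow> 'x" where
  "cyclic_action X f j = restrict (f ^^ nat j) X"

text \<open>\<open>cyclic_sieving_by n X P f\<close>: cyclic sieving for the group of order \<open>n\<close> whose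
  generator \<open>1\<close> acts on \<open>X\<close> by \<open>f\<close>.\<close>
definition cyclic_sieving_by :: "nat \<Rightarrow> 'x set \<Rightarrow> int poly \<Rightarrow> ('x \<Rightarrow> 'x) \<Rightarrow> bool" where
  "cyclic_sieving_by n X P f \<longleftrightarrow>
     cyclic_sieving X P (integer_mod_group n) (cyclic_action X f)"

lemma unity_roots_iso:
  assumes "n > 0"
  shows "(\<lambda>j. cis (2 * pi * real_of_int j / real n)) \<in> iso (integer_mod_group n) (unity_roots_group n)"
proof -
  let ?f = "\<lambda>j::int. cis (2 * pi * real_of_int j / real n)"
  have c: "carrier (integer_mod_group n) = {0..<int n}"
    using assms by (simp add: carrier_integer_mod_group)
  have b: "bij_betw ((\<lambda>k::nat. cis (2 * pi * real k / real n)) \<circ> nat) {0..<int n} {z. z ^ n = 1}"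
  proof (rule bij_betw_trans)
    show "bij_betw nat {0..<int n} {..<n}"
      by (rule bij_betwI[where g = int]) auto
    show "bij_betw (\<lambda>k::nat. cis (2 * pi * real k / real n)) {..<n} {z. z ^ n = 1}"
      using Complex.bij_betw_roots_unity[OF assms] by simp
  qed
  have b': "bij_betw ?f {0..<int n} {z. z ^ n = 1}"
    by (rule iffD1[OF bij_betw_cong b]) auto
  have add: "?f ((x + y) mod int n) = ?f x * ?f y" for x y
  proof -
    have "real_of_int (x + y) = real n * real_of_int ((x + y) div int n) + real_of_int ((x + y) mod int n)"
      by (metis mult_div_mod_eq of_int_add of_int_mult of_int_of_nat_eq)
    then have "2 * pi * real_of_int (x + y) / real n
        = 2 * pi * real_of_int ((x + y) div int n) + 2 * pi * real_of_int ((x + y) mod int n) / real n"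
      using assms by (simp add: field_simps)
    then have "?f (x + y) = cis (2 * pi * real_of_int ((x + y) div int n)) * ?f ((x + y) mod int n)"
      by (simp only: cis_mult)
    moreover have "cis (2 * pi * real_of_int ((x + y) div int n)) = 1"
      by (rule cis_multiple_2pi) simp
    moreover have "?f (x + y) = ?f x * ?f y"
      by (simp add: cis_mult ring_distribs add_divide_distrib)
    ultimately show ?thesis by simp
  qed
  show ?thesis
    using b' add bij_betwE[OF b']
    by (auto simp: iso_def hom_def unity_roots_group_def c)
qed

text \<open>\<^const>\<open>divide\<close> on polynomials is exact here, by the lemma that follows.\<close>
definition W_poly :: "nat \<Rightarrow> nat \<Rightarrow> int poly" where
  "W_poly m k = (\<Prod>i = 1..k. (1 - monom 1 (m * i)) div (1 - monom 1 i))"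

lemma W_poly_mult: "W_poly m k * (\<Prod>i = 1..k. 1 - monom 1 i) = (\<Prod>i = 1..k. 1 - monom 1 (m * i))"
  unfolding W_poly_def prod.distrib[symmetric]
proof (rule prod.cong[OF refl])
  fix i assume "i \<in> {1..k}"
  have "monom (1::int) (m * i) = monom 1 i ^ m"
    by (simp add: monom_power mult.commute)
  then have "(1 - monom 1 i :: int poly) dvd 1 - monom 1 (m * i)"
    by (simp add: one_diff_power_eq)
  then show "(1 - monom 1 (m * i)) div (1 - monom 1 i) * (1 - monom 1 i) = (1 - monom 1 (m * i) :: int poly)"
    by (rule dvd_div_mult_self)
qed

section \<open>Words\<close>

definition words :: "nat \<Rightarrow> nat \<Rightarrow> int list set" where
  "words m k = {x. length x = k \<and> set x \<subseteq> {0..<int m}}"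

definition extended_word :: "nat \<Rightarrow> int list \<Rightarrow> int list" where
  "extended_word m x =
     concat (map (\<lambda>i. map (\<lambda>a. (a - i) mod int m) x @ [int m - 1 - i]) [0..int m - 1])"

text \<open>With \<open>p\<close> the position (from \<open>0\<close>) of the leftmost zero, rotating left by \<open>p + 1\<close> puts it last.\<close>
definition phi :: "nat \<Rightarrow> nat \<Rightarrow> int list \<Rightarrow> int list" where
  "phi m k x =
     (let e = extended_word m x; p = length (takeWhile (\<lambda>a. a \<noteq> 0) e)
      in take k (rotate (p + 1) e))"

section \<open>Cores\<close>

text \<open>
  Partitions are identified with their Ferrers diagrams, finite sets of boxes (row, column) in
  English notation. Rows and columns are numbered from \<open>0\<close>, which does not affect contents.
\<close>
type_synonym diagram = "(nat \<times> nat) set"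

definition is_partition :: "diagram \<Rightarrow> bool" where
  "is_partition D \<longleftrightarrow>
     finite D \<and> (\<forall>a b a' b'. (a, b) \<in> D \<longrightarrow> a' \<le> a \<longrightarrow> b' \<le> b \<longrightarrow> (a', b') \<in> D)"

definition ferrers :: "nat list \<Rightarrow> diagram" where
  "ferrers ps = {(a, b). a < length ps \<and> b < ps ! a}"

definition hook_length :: "diagram \<Rightarrow> nat \<times> nat \<Rightarrow> nat" where
  "hook_length D = (\<lambda>(a, b).
     card {b'. b < b' \<and> (a, b') \<in> D} + card {a'. a < a' \<and> (a', b) \<in> D} + 1)"

definition is_core :: "nat \<Rightarrow> diagram \<Rightarrow> bool" where
  "is_core n D \<longleftrightarrow> is_partition D \<and> (\<forall>x \<in> D. hook_length D x \<noteq> n)"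

text \<open>The list of parts of \<open>R\<^bsub>k,{i\<^sub>1,\<dots>,i\<^sub>r}\<^esub>\<close>.\<close>
fun rect_parts :: "nat \<Rightarrow> nat list \<Rightarrow> nat list" where
  "rect_parts k [] = []"
| "rect_parts k (i # is) = replicate (k + 1 - i) (sum_list (i # is)) @ rect_parts k is"

definition cores :: "nat \<Rightarrow> nat \<Rightarrow> diagram set" where
  "cores m k = {D. is_core (k + 1) D \<and>
     (\<exists>is. length is = m - 1 \<and> set is \<subseteq> {1..k} \<and> sorted_wrt (\<ge>) is \<and>
           D \<subseteq> ferrers (rect_parts k is))}"

definition content :: "nat \<Rightarrow> nat \<times> nat \<Rightarrow> int" where
  "content k = (\<lambda>(a, b). (int b - int a) mod int (k + 1))"

definition addable :: "nat \<Rightarrow> nat \<Rightarrow> diagram \<Rightarrow> diagram" where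
  "addable k i D = {x. x \<notin> D \<and> is_partition (insert x D) \<and> content k x = int i}"

definition removable :: "nat \<Rightarrow> nat \<Rightarrow> diagram \<Rightarrow> diagram" where
  "removable k i D = {x \<in> D. is_partition (D - {x}) \<and> content k x = int i}"

definition core_reflection :: "nat \<Rightarrow> nat \<Rightarrow> diagram \<Rightarrow> diagram" where
  "core_reflection k i D =
     (if addable k i D \<noteq> {} then D \<union> addable k i D else D - removable k i D)"

section \<open>Alcoves\<close>

text \<open>
  The simple roots are \<open>\<alpha> 1, \<dots>, \<alpha> k\<close> (other values of \<open>\<alpha>\<close> are irrelevant), numbered along the
  Dynkin diagram. The Gram matrix is positive definite, so they are linearly independent and
  \<open>V = span (\<alpha> ` {1..k})\<close> is \<open>k\<close>-dimensional.
\<close>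
definition type_A_simple_roots :: "nat \<Rightarrow> (nat \<Rightarrow> 'a::real_inner) \<Rightarrow> bool" where
  "type_A_simple_roots k \<alpha> \<longleftrightarrow> (\<forall>i \<in> {1..k}. \<forall>j \<in> {1..k}.
     inner (\<alpha> i) (\<alpha> j) = (if i = j then 2 else if i = j + 1 \<or> j = i + 1 then -1 else 0))"

lemma type_A_simple_roots_exist:
  assumes "k < DIM('a::euclidean_space)"
  shows "\<exists>\<alpha> :: nat \<Rightarrow> 'a. type_A_simple_roots k \<alpha>"
proof -
  obtain b :: "nat \<Rightarrow> 'a" where b: "bij_betw b {0..<DIM('a)} Basis"
    using ex_bij_betw_nat_finite[OF finite_Basis] by blast
  have ip: "inner (b i) (b j) = (if i = j then 1 else 0)" if "i \<le> k" "j \<le> k" for i j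
    using that assms bij_betwE[OF b] inj_onD[OF bij_betw_imp_inj_on[OF b], of i j]
    by (auto simp: inner_Basis)
  have "type_A_simple_roots k (\<lambda>i. b (i - 1) - b i)"
    unfolding type_A_simple_roots_def
    by (auto simp: inner_diff_left inner_diff_right ip; presburger)
  then show ?thesis by blast
qed

definition root_space :: "nat \<Rightarrow> (nat \<Rightarrow> 'a::real_inner) \<Rightarrow> 'a set" where
  "root_space k \<alpha> = span (\<alpha> ` {1..k})"

definition type_A_roots :: "nat \<Rightarrow> (nat \<Rightarrow> 'a::real_inner) \<Rightarrow> 'a set" where
  "type_A_roots k \<alpha> =
     (\<Union>i \<in> {1..k}. \<Union>j \<in> {i..k}. {\<Sum>l = i..j. \<alpha> l, - (\<Sum>l = i..j. \<alpha> l)})"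

definition alpha0 :: "nat \<Rightarrow> (nat \<Rightarrow> 'a::real_inner) \<Rightarrow> 'a" where
  "alpha0 k \<alpha> = - (\<Sum>i = 1..k. \<alpha> i)"

definition hyperplane :: "'a::real_inner \<Rightarrow> real \<Rightarrow> 'a set" where
  "hyperplane v p = {x. inner v x = p}"

definition alcoves :: "nat \<Rightarrow> (nat \<Rightarrow> 'a::real_inner) \<Rightarrow> 'a set set" where
  "alcoves k \<alpha> =
     components (root_space k \<alpha> -
       (\<Union>\<beta> \<in> type_A_roots k \<alpha>. \<Union>p :: int. hyperplane \<beta> (of_int p)))"

definition dilated_simplex :: "nat \<Rightarrow> nat \<Rightarrow> (nat \<Rightarrow> 'a::real_inner) \<Rightarrow> 'a set" where
  "dilated_simplex m k \<alpha> =
     {x \<in> root_space k \<alpha>. (\<forall>i \<in> {1..k}. inner (\<alpha> i) x \<ge> 0) \<and> inner (- alpha0 k \<alpha>) x \<le> real m}"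

definition simplex_alcoves :: "nat \<Rightarrow> nat \<Rightarrow> (nat \<Rightarrow> 'a::real_inner) \<Rightarrow> 'a set set" where
  "simplex_alcoves m k \<alpha> = {A \<in> alcoves k \<alpha>. A \<subseteq> dilated_simplex m k \<alpha>}"

definition simplex_vertex :: "nat \<Rightarrow> nat \<Rightarrow> (nat \<Rightarrow> 'a::real_inner) \<Rightarrow> nat \<Rightarrow> 'a" where
  "simplex_vertex m k \<alpha> i =
     (if i = 0 then 0
      else THE v. v \<in> root_space k \<alpha> \<and>
             (\<forall>j \<in> {1..k}. inner (\<alpha> j) v = (if i = j then real m else 0)))"

definition affine_map_on :: "'a::real_vector set \<Rightarrow> ('a \<Rightarrow> 'a) \<Rightarrow> bool" where
  "affine_map_on V f \<longleftrightarrow> f \<in> V \<rightarrow> V \<and>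
     (\<forall>x \<in> V. \<forall>y \<in> V. \<forall>t. f ((1 - t) *\<^sub>R x + t *\<^sub>R y) = (1 - t) *\<^sub>R f x + t *\<^sub>R f y)"

text \<open>Extensionality makes the map unique as a function on the whole type.\<close>
definition rho :: "nat \<Rightarrow> nat \<Rightarrow> (nat \<Rightarrow> 'a::real_inner) \<Rightarrow> 'a \<Rightarrow> 'a" where
  "rho m k \<alpha> =
     (THE f. f \<in> extensional (root_space k \<alpha>) \<and> affine_map_on (root_space k \<alpha>) f \<and>
        (\<forall>i \<le> k. f (simplex_vertex m k \<alpha> i) = simplex_vertex m k \<alpha> ((i + 1) mod (k + 1))))"

section \<open>Alcoves and cores\<close>

definition reflection :: "'a::real_inner \<Rightarrow> real \<Rightarrow> 'a \<Rightarrow> 'a" where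
  "reflection v p x = x - (2 * (inner v x - p) / inner v v) *\<^sub>R v"

definition affine_generator :: "nat \<Rightarrow> (nat \<Rightarrow> 'a::real_inner) \<Rightarrow> nat \<Rightarrow> 'a \<Rightarrow> 'a" where
  "affine_generator k \<alpha> i =
     (if i = 0 then reflection (- alpha0 k \<alpha>) 1 else reflection (\<alpha> i) 0)"

definition fundamental_alcove :: "nat \<Rightarrow> (nat \<Rightarrow> 'a::real_inner) \<Rightarrow> 'a set" where
  "fundamental_alcove k \<alpha> =
     {x \<in> root_space k \<alpha>. (\<forall>i \<in> {1..k}. inner (\<alpha> i) x > 0) \<and> inner (- alpha0 k \<alpha>) x < 1}"

text \<open>
  An element \<open>u = s\<^bsub>i\<^sub>1\<^esub> \<cdots> s\<^bsub>i\<^sub>r\<^esub>\<close> of the affine symmetric group is given by a word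
  \<open>w = [i\<^sub>1, \<dots>, i\<^sub>r]\<close> in the generators. The alcove is \<open>u A\<^sub>0\<close>, with \<open>s\<^bsub>i\<^sub>r\<^esub>\<close> applied first, and
  the core is \<open>u\<inverse> \<emptyset> = s\<^bsub>i\<^sub>r\<^esub> \<cdots> s\<^bsub>i\<^sub>1\<^esub> \<emptyset>\<close>, with \<open>s\<^bsub>i\<^sub>1\<^esub>\<close> applied first.
\<close>
definition word_alcove :: "nat \<Rightarrow> (nat \<Rightarrow> 'a::real_inner) \<Rightarrow> nat list \<Rightarrow> 'a set" where
  "word_alcove k \<alpha> w = foldr (\<lambda>i A. affine_generator k \<alpha> i ` A) w (fundamental_alcove k \<alpha>)"

definition word_inverse_core :: "nat \<Rightarrow> nat list \<Rightarrow> diagram" where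
  "word_inverse_core k w = fold (core_reflection k) w {}"

definition core_of_alcove :: "nat \<Rightarrow> (nat \<Rightarrow> 'a::real_inner) \<Rightarrow> 'a set \<Rightarrow> diagram" where
  "core_of_alcove k \<alpha> A =
     (THE D. \<exists>w \<in> lists {0..k}. word_alcove k \<alpha> w = A \<and> word_inverse_core k w = D)"

definition core_rho :: "nat \<Rightarrow> nat \<Rightarrow> (nat \<Rightarrow> 'a::real_inner) \<Rightarrow> diagram \<Rightarrow> diagram" where
  "core_rho m k \<alpha> D =
     core_of_alcove k \<alpha> (rho m k \<alpha> ` the_inv_into (simplex_alcoves m k \<alpha>) (core_of_alcove k \<alpha>) D)"

end

theory Submission
  imports Defs "HOL-Number_Theory.Cong"
begin

text \<open>The residue condition is what turns alcoves into integers. The floors of the differences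
  of the levels of a regular point record the integer parts of the levels and the order of the
  fractional parts, nothing else; replacing the fractional parts by their ranks over n gives n
  distinct residues modulo n. The free choice of letters is visible only on words, so every count is
  taken there. Since the fixed sequences are again sequences of the same kind, for a smaller n, no
  second count is made. That the core belongs to the inverse of u comes from the two sides of
  multiplication. Prefixing a letter to a word reflects the alcove and composes the permutation on
  the right, permuting positions; appending a letter reflects the core and composes on the left,
  permuting values. One function \<open>wperm\<close> can therefore follow both
  constructions.\<close>

text \<open>
  All three sets are modelled by the increasing sequences \<open>s : \<int> \<rightarrow> \<int>\<close> with \<open>s 0 = 0\<close>,
  \<open>s (i + n) = s i + m n\<close> and \<open>s i \<equiv> s j (mod n)\<close> only for \<open>i \<equiv> j (mod n)\<close>, where \<open>n = k + 1\<close>;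
  the cyclic action becomes the shift of the index. The sequences fixed by the shift by a divisor
  \<open>e\<close> of \<open>n = d e\<close> are the sequences for \<open>e\<close> in place of \<open>n\<close> if \<open>m\<close> and \<open>d\<close> are coprime, and there
  are none otherwise. Their number, \<open>m\<^sup>e\<^sup>-\<^sup>1\<close> or \<open>0\<close>, is the value of the polynomial at a primitive
  \<open>d\<close>-th root of unity.

  For a word, \<open>s\<close> lists the positions, numbered from \<open>1\<close>, of the zeros in the periodically
  continued extended word. For an alcove in the dilated simplex, \<open>s\<close> lists the partial sums of the simple roots at the centre of
  the alcove, multiplied by \<open>n\<close>. The same centre, continued with period \<open>n\<close> instead of \<open>m n\<close>, is the
  affine permutation \<open>u\<inverse>\<close> of the alcove \<open>u A\<^sub>0\<close>; the core \<open>u\<inverse> \<emptyset>\<close> is the partition whose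
  vertical boundary steps have the labels \<open>u\<inverse> {\<dots>, -2, -1}\<close>, and the condition
  \<open>s k < s 0 + m n\<close> for lying in the simplex is the condition for the core to be contained in one of the
  unions of rectangles.
\<close>

section \<open>The polynomial at roots of unity\<close>

lemma map_poly_of_int_mult:
  "map_poly (of_int :: int \<Rightarrow> 'a::comm_ring_1) (P * Q) = map_poly of_int P * map_poly of_int Q"
  by (rule poly_eqI) (simp add: coeff_map_poly coeff_mult)

lemma map_poly_of_int_prod:
  "map_poly (of_int :: int \<Rightarrow> 'a::comm_ring_1) (\<Prod>i\<in>A. f i) = (\<Prod>i\<in>A. map_poly of_int (f i))"
  by (induction A rule: infinite_finite_induct) (simp_all add: map_poly_of_int_mult map_poly_1)

text \<open>As a geometric sum the quotient can also be evaluated at the roots of the denominator,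
  where the fraction is 0/0 and the value is m.\<close>

lemma poly_W_poly_factor:
  fixes z :: complex
  assumes "i > 0"
  shows "poly (map_poly of_int ((1 - monom 1 (m * i)) div (1 - monom 1 i))) z = (\<Sum>t<m. (z ^ i) ^ t)"
proof -
  have m: "monom (1::int) (m * i) = monom 1 i ^ m"
    by (simp add: monom_power mult.commute)
  have nz: "1 - monom (1::int) i \<noteq> 0"
  proof
    assume "1 - monom (1::int) i = 0"
    then have "coeff (1 - monom (1::int) i) 0 = coeff 0 0" by simp
    with assms show False by simp
  qed
  have "(1 - monom (1::int) (m * i)) div (1 - monom 1 i) = (\<Sum>t<m. monom 1 i ^ t)"
    unfolding m one_diff_power_eq using nz by simp
  also have "\<dots> = (\<Sum>t<m. monom 1 (i * t))"
    by (simp add: monom_power)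
  also have "map_poly of_int \<dots> = (\<Sum>t<m. monom (1::complex) (i * t))"
    by (rule poly_eqI) (auto simp: coeff_map_poly coeff_sum intro!: sum.cong)
  finally show ?thesis
    by (simp add: poly_sum poly_monom power_mult)
qed

lemma poly_W_poly:
  fixes z :: complex
  shows "poly (map_poly of_int (W_poly m k)) z = (\<Prod>i = 1..k. \<Sum>t<m. (z ^ i) ^ t)"
  unfolding W_poly_def map_poly_of_int_prod poly_prod
  by (rule prod.cong) (simp_all add: poly_W_poly_factor)

text \<open>Each of the indices divisible by d contributes a factor m. The other factors are (1 -
  z^(m i)) / (1 - z^i); if m and d are coprime, multiplication by m permutes the nonzero residues
  modulo d, so numerators and denominators cancel as a whole. If g = gcd m d exceeds 1, the
  numerator alone vanishes at i = d / g.\<close>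

lemma poly_W_poly_at_root:
  fixes z :: complex
  assumes ord: "\<And>t. z ^ t = 1 \<longleftrightarrow> d dvd t" and d: "d dvd k + 1"
  shows "poly (map_poly of_int (W_poly m k)) z =
    (if coprime m d then of_nat (m ^ ((k + 1) div d - 1)) else 0)"
proof -
  obtain e where e: "k + 1 = d * e" using d by blast
  then have pos: "d > 0" "e > 0" by (metis gr0I mult_0 mult_0_right add_is_0 one_neq_zero)+
  let ?f = "\<lambda>i. \<Sum>t<m. (z ^ i) ^ t"
  have geo: "?f i * (1 - z ^ i) = 1 - z ^ (m * i)" for i
    by (simp add: one_diff_power_eq power_mult mult.commute[of m])
  show ?thesis
  proof (cases "coprime m d")
    case True
    define I where "I = {i \<in> {1..k}. \<not> d dvd i}"
    define J where "J = {i \<in> {1..k}. d dvd i}"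
    have "(\<Prod>i = 1..k. ?f i) = prod ?f (I \<union> J)"
      by (rule prod.cong) (auto simp: I_def J_def)
    also have "\<dots> = prod ?f I * prod ?f J"
      by (rule prod.union_disjoint) (auto simp: I_def J_def)
    also have "prod ?f J = of_nat m ^ card J"
    proof -
      have "?f i = of_nat m" if "i \<in> J" for i
      proof -
        have "z ^ i = 1" using ord that by (simp add: J_def)
        then show ?thesis by simp
      qed
      then show ?thesis by simp
    qed
    also have "card J = e - 1"
    proof -
      have "J = (\<lambda>q. d * q) ` {1..<e}"
      proof (intro Set.set_eqI iffI)
        fix i assume "i \<in> J"
        then have i: "d dvd i" "1 \<le> i" "i < d * e" using e by (auto simp: J_def)
        then obtain q where "i = d * q" by blast
        then have "q < e" "q \<ge> 1" using i by (auto simp: Suc_le_eq intro: Nat.gr0I)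
        then show "i \<in> (\<lambda>q. d * q) ` {1..<e}" using \<open>i = d * q\<close> by auto
      next
        fix i assume "i \<in> (\<lambda>q. d * q) ` {1..<e}"
        then obtain q where q: "i = d * q" "q \<in> {1..<e}" by blast
        then have "d * q < d * e" using pos by auto
        moreover have "d * q \<ge> 1" using pos q by (auto simp: Suc_le_eq)
        ultimately show "i \<in> J" using e q(1) by (auto simp: J_def less_Suc_eq_le[symmetric] simp del: Suc_le_eq)
      qed
      moreover have "inj_on (\<lambda>q. d * q) {1..<e}" using pos by (auto simp: inj_on_def)
      ultimately show ?thesis by (simp add: card_image)
    qed
    also have "prod ?f I = 1"
    proof -
      \<comment> \<open>Multiplication by m inside each block of d consecutive indices. It stays in
        range because k + 1 is a multiple of d, so that no block is cut off.\<close>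
      define \<pi> where "\<pi> i = d * (i div d) + (m * i) mod d" for i
      have mod: "(m * i) mod d \<noteq> 0" if "i \<in> I" for i
        using that True by (auto simp: I_def coprime_dvd_mult_right_iff coprime_commute mod_eq_0_iff_dvd)
      have into: "\<pi> ` I \<subseteq> I"
      proof
        fix j assume "j \<in> \<pi> ` I"
        then obtain i where i: "i \<in> I" "j = \<pi> i" by blast
        have "i < d * e" using i e by (auto simp: I_def)
        then have "i div d < e" using pos by (simp add: div_less_iff_less_mult mult.commute)
        then have "d * (i div d) + d \<le> d * e"
          by (metis Suc_leI mult_Suc_right add.commute mult_le_mono2)
        moreover have "(m * i) mod d < d" using pos by simp
        ultimately have "j < d * e" using i by (simp add: \<pi>_def)
        moreover have "j mod d = (m * i) mod d" by (simp add: i \<pi>_def)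
        ultimately show "j \<in> I" using mod[OF i(1)] e by (auto simp: I_def intro: Nat.gr0I simp: Suc_le_eq)
      qed
      have inj: "inj_on \<pi> I"
      proof (rule inj_onI)
        fix i j assume ij: "i \<in> I" "j \<in> I" "\<pi> i = \<pi> j"
        have "\<pi> x div d = x div d" "\<pi> x mod d = (m * x) mod d" for x
          using pos by (simp_all add: \<pi>_def)
        then have "i div d = j div d" and "[m * i = m * j] (mod d)"
          using ij(3) by (metis, metis cong_def)
        then have "[i = j] (mod d)" using True by (simp add: cong_mult_lcancel_nat)
        with \<open>i div d = j div d\<close> show "i = j" by (metis cong_def div_mult_mod_eq)
      qed
      have "finite I" by (simp add: I_def)
      then have bij: "bij_betw \<pi> I I"
        using inj into by (simp add: bij_betw_def endo_inj_surj)
      have "(\<Prod>i\<in>I. 1 - z ^ i) = (\<Prod>i\<in>I. 1 - z ^ \<pi> i)"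
        by (rule prod.reindex_bij_betw[OF bij, symmetric])
      also have "\<dots> = (\<Prod>i\<in>I. 1 - z ^ (m * i))"
      proof (rule prod.cong[OF refl])
        fix i
        have zd: "z ^ d = 1" using ord by simp
        have "z ^ \<pi> i = z ^ (m * i mod d)" by (simp add: \<pi>_def power_add power_mult zd)
        also have "\<dots> = z ^ (d * (m * i div d) + m * i mod d)" by (simp only: power_add power_mult zd power_one mult_1)
        also have "\<dots> = z ^ (m * i)" by simp
        finally show "1 - z ^ \<pi> i = 1 - z ^ (m * i)" by simp
      qed
      also have "\<dots> = prod ?f I * (\<Prod>i\<in>I. 1 - z ^ i)"
        by (simp add: geo prod.distrib[symmetric])
      finally have "(\<Prod>i\<in>I. 1 - z ^ i) = prod ?f I * (\<Prod>i\<in>I. 1 - z ^ i)" .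
      moreover have "(\<Prod>i\<in>I. 1 - z ^ i) \<noteq> 0"
        using ord \<open>finite I\<close> by (simp add: I_def)
      ultimately show ?thesis by simp
    qed
    finally show ?thesis using True e pos by (simp add: poly_W_poly)
  next
    case False
    define g where "g = gcd m d"
    have g: "g > 1" "g dvd d" "g dvd m" using False pos
      by (auto simp: g_def coprime_iff_gcd_eq_1 Suc_lessI)
    define i where "i = d div g"
    have i: "d = g * i" using g by (simp add: i_def)
    then have "i > 0" "i < d" using pos g by (auto intro: Nat.gr0I)
    moreover have "d \<le> k + 1" using e pos by simp
    ultimately have ik: "i \<in> {1..k}" by auto
    have "d dvd m * i" using g i by (metis mult_dvd_mono dvd_refl)
    then have "z ^ (m * i) = 1" using ord by simp
    moreover have "z ^ i \<noteq> 1" using ord \<open>i > 0\<close> \<open>i < d\<close> by (meson dvd_imp_le leD)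
    ultimately have "?f i = 0" using geo[of i] by simp
    then have "(\<Prod>i = 1..k. ?f i) = 0" using ik by (intro prod_zero) auto
    then show ?thesis using False by (simp add: poly_W_poly)
  qed
qed

section \<open>Quasi-periodic integer sequences under the index shift\<close>

definition gapseq :: "nat \<Rightarrow> nat \<Rightarrow> (int \<Rightarrow> int) set" where
  "gapseq m n = {s. strict_mono s \<and> s 0 = 0 \<and> (\<forall>i. s (i + int n) = s i + int m * int n) \<and>
     (\<forall>i j. [s i = s j] (mod int n) \<longrightarrow> [i = j] (mod int n))}"

text \<open>Subtracting \<open>s e\<close> restores the value 0 at index 0, and shifts still compose
  additively.\<close>

definition shift :: "int \<Rightarrow> (int \<Rightarrow> int) \<Rightarrow> int \<Rightarrow> int" where
  "shift e s = (\<lambda>i. s (i + e) - s e)"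

lemma quasi_periodic_mult:
  fixes s :: "int \<Rightarrow> 'a::comm_ring_1"
  assumes "\<And>i. s (i + p) = s i + c"
  shows "s (i + p * t) = s i + c * of_int t"
proof (induction t rule: int_induct[where k = 0])
  case (step1 t)
  then show ?case using assms[of "i + p * t"] by (simp add: algebra_simps)
next
  case (step2 t)
  then show ?case using assms[of "i + p * (t - 1)"] by (simp add: algebra_simps)
qed simp

lemma gapseqD:
  assumes "s \<in> gapseq m n"
  shows "strict_mono s" "s 0 = 0" "s (i + int n) = s i + int m * int n"
    "s (i + int n * t) = s i + int m * int n * t"
    "[s i = s j] (mod int n) \<Longrightarrow> [i = j] (mod int n)"
  using assms quasi_periodic_mult[of s "int n" "int m * int n" i t] by (auto simp: gapseq_def)

lemma shift_0: "s 0 = 0 \<Longrightarrow> shift 0 s = s"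
  by (simp add: shift_def)

lemma shift_shift: "shift a (shift b s) = shift (a + b) s"
  by (simp add: shift_def algebra_simps)

lemma shift_in_gapseq:
  assumes "s \<in> gapseq m n"
  shows "shift e s \<in> gapseq m n"
proof -
  note s = gapseqD[OF assms]
  have "[i = j] (mod int n)" if "[s (i + e) - s e = s (j + e) - s e] (mod int n)" for i j
  proof -
    have "[s (i + e) = s (j + e)] (mod int n)"
      using cong_add[OF that cong_refl[of "s e"]] by simp
    then have "[i + e = j + e] (mod int n)" by (rule s)
    then show ?thesis by (simp add: cong_add_rcancel)
  qed
  moreover have "s (i + int n + e) = s (i + e) + int m * int n" for i
    using s(3)[of "i + e"] by (simp add: algebra_simps)
  ultimately show ?thesis using s(1) by (auto simp: gapseq_def shift_def strict_mono_def)
qed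

lemma shift_period:
  assumes "s \<in> gapseq m n"
  shows "shift (int n * t) s = s"
  using gapseqD(2)[OF assms] gapseqD(4)[OF assms, of _ t] gapseqD(4)[OF assms, of 0 t] by (simp add: shift_def)

lemma shift_mod:
  assumes "s \<in> gapseq m n"
  shows "shift (a mod int n) s = shift a s"
proof -
  have "shift a s = shift (a mod int n + int n * (a div int n)) s" by simp
  also have "\<dots> = shift (a mod int n) s"
    by (simp only: shift_shift[symmetric] shift_period[OF assms])
  finally show ?thesis by simp
qed

lemma shift_fixed_mult:
  assumes "s 0 = 0" "shift a s = s"
  shows "shift (a * t) s = s"
proof -
  have "s (i + a) = s i + s a" for i
    using fun_cong[OF assms(2), of i] by (simp add: shift_def)
  then have "s (i + a * t) = s i + s a * t" for i using quasi_periodic_mult[of s a "s a"] by simp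
  from this this[of 0] assms(1) show ?thesis by (simp add: shift_def)
qed

text \<open>By Bezout, because the shift by n is the identity. It reduces the fixed points of any
  group element to those of the shift by a divisor of n.\<close>

lemma shift_fixed_gcd:
  assumes "s \<in> gapseq m n"
  shows "shift e s = s \<longleftrightarrow> shift (gcd e (int n)) s = s"
proof
  assume e: "shift e s = s"
  obtain u v where uv: "u * e + v * int n = gcd e (int n)" using bezout_int by blast
  have "shift (gcd e (int n)) s = shift (e * u) (shift (int n * v) s)"
    unfolding uv[symmetric] by (simp add: shift_shift mult.commute)
  then show "shift (gcd e (int n)) s = s"
    by (simp add: shift_period[OF assms] shift_fixed_mult[OF gapseqD(2)[OF assms] e])
next
  assume g: "shift (gcd e (int n)) s = s"
  obtain t where "e = gcd e (int n) * t" by (meson dvdE gcd_dvd1)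
  then show "shift e s = s" using shift_fixed_mult[OF gapseqD(2)[OF assms] g, of t] by simp
qed

text \<open>Invariance makes s grow by a constant over e steps; d such steps give m n, so the
  constant is m e. If g > 1 divides m and d, then s grows by a multiple of n over e d / g steps,
  although that number of steps is not divisible by n. If m and d are coprime, the residue condition
  passes between the moduli e and n because m is invertible modulo d.\<close>

lemma fixed_gapseq:
  assumes n: "n = d * e" and pos: "n > 0" "m > 0"
  shows "{s \<in> gapseq m n. shift (int e) s = s} = (if coprime m d then gapseq m e else {})"
proof -
  have de: "d > 0" "e > 0" using n pos by (auto intro: Nat.gr0I)
  have step: "s (i + int e) = s i + int m * int e"
    if "s \<in> gapseq m n" "shift (int e) s = s" for s i
  proof -
    note s = gapseqD[OF that(1)]
    have q: "s (i + int e) = s i + s (int e)" for i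
      using fun_cong[OF that(2), of i] by (simp add: shift_def)
    have "s (0 + int e * int d) = s 0 + s (int e) * int d"
      using quasi_periodic_mult[of s "int e" "s (int e)" 0 "int d"] q by simp
    then have "s (int e) * int d = int m * int n"
      using s(2) s(3)[of 0] n by (simp add: mult.commute)
    then have "s (int e) = int m * int e" using n de by simp
    then show ?thesis using q by simp
  qed
  have cop: "coprime m d" if s: "s \<in> gapseq m n" "shift (int e) s = s" for s
  proof (rule ccontr)
    assume "\<not> coprime m d"
    define g where "g = gcd m d"
    have g: "g > 1" "g dvd d" "g dvd m" using \<open>\<not> coprime m d\<close> de
      by (auto simp: g_def coprime_iff_gcd_eq_1 Suc_lessI)
    then obtain a b where ab: "d = g * a" "m = g * b" by blast
    have "s (int e * int a) = int m * int e * int a"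
      using quasi_periodic_mult[of s "int e" "int m * int e" 0 "int a"] step[OF s] gapseqD(2)[OF s(1)] by simp
    also have "\<dots> = int n * int b" using ab n by simp
    finally have "[s (int e * int a) = s 0] (mod int n)" using gapseqD(2)[OF s(1)] by (simp add: cong_0_iff)
    then have "[int e * int a = 0] (mod int n)" by (rule gapseqD[OF s(1)])
    then have "int n dvd int (e * a)" by (simp add: cong_0_iff)
    then have "n dvd e * a" by (simp only: of_nat_dvd_iff)
    then have "d dvd a" using n de by (simp add: mult.commute)
    moreover have "0 < a" "a < d" using ab g de by (auto intro: Nat.gr0I)
    ultimately show False by (meson dvd_imp_le leD)
  qed
  have sub: "s \<in> gapseq m e" if s: "s \<in> gapseq m n" "shift (int e) s = s" for s
  proof -
    have "[i = j] (mod int e)" if ij: "[s i = s j] (mod int e)" for i j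
    proof -
      obtain c where c: "s j - s i = int e * c" using ij by (metis cong_iff_lin add_diff_cancel_left')
      have "coprime (int m) (int d)" using cop[OF s] by simp
      then obtain u where u: "[int m * u = 1] (mod int d)" using coprime_iff_invertible_int by blast
      then have "int d dvd int m * u - 1" by (simp add: cong_iff_dvd_diff)
      then obtain v where v: "int m * u = 1 + int d * v" by (metis dvdE diff_add_cancel add.commute)
      \<comment> \<open>With u an inverse of m modulo d, these \<open>e * (u * c)\<close> steps
        change s by e c modulo n, which is exactly the gap between \<open>s i\<close> and
        \<open>s j\<close>. The residue condition modulo n then applies.\<close>
      have "s (i + int e * (u * c)) = s i + int m * int e * (u * c)"
        using quasi_periodic_mult[of s "int e" "int m * int e" i "u * c"] step[OF s] by simp
      also have "\<dots> = s i + (int m * u) * int e * c" by simp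
      also have "\<dots> = s j + int n * (v * c)" unfolding v using c n by (simp add: algebra_simps)
      finally have "[s (i + int e * (u * c)) = s j] (mod int n)" by (simp add: cong_def)
      then have "[i + int e * (u * c) = j] (mod int n)" by (rule gapseqD[OF s(1)])
      then have "[i + int e * (u * c) = j] (mod int e)"
        by (rule cong_dvd_modulus) (simp add: n)
      then show ?thesis by (simp add: cong_def)
    qed
    then show ?thesis using step[OF s] gapseqD(1,2)[OF s(1)] by (auto simp: gapseq_def)
  qed
  have sup: "s \<in> gapseq m n \<and> shift (int e) s = s" if s: "s \<in> gapseq m e" and c: "coprime m d" for s
  proof -
    note S = gapseqD[OF s]
    have "shift (int e) s = s" using S(2) S(3) S(3)[of 0] by (simp add: shift_def)
    moreover have "s (i + int n) = s i + int m * int n" for i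
      using S(4)[of i "int d"] n by (simp add: algebra_simps)
    moreover have "[i = j] (mod int n)" if ij: "[s i = s j] (mod int n)" for i j
    proof -
      have "[s i = s j] (mod int e)" using ij by (rule cong_dvd_modulus) (simp add: n)
      then have "[i = j] (mod int e)" by (rule S)
      then obtain t where t: "j = i + int e * t" by (metis cong_iff_lin)
      then have "s j = s i + int m * int e * t" using S(4) by simp
      then have "int n dvd int m * int e * t" using ij by (simp add: cong_iff_dvd_diff dvd_diff_commute)
      then have "int d dvd int m * t" using n de by (simp add: mult.assoc mult.left_commute[of _ "int e"] mult.commute[of "int d"])
      then have "int d dvd t" using c by (simp add: coprime_dvd_mult_right_iff coprime_commute)
      then show ?thesis using t n by (simp add: cong_iff_dvd_diff mult.commute)
    qed
    ultimately show ?thesis using S(1,2) by (auto simp: gapseq_def)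
  qed
  show ?thesis using sub cop sup by auto
qed

section \<open>Extended words\<close>

lemma strict_mono_int_step:
  fixes s :: "int \<Rightarrow> 'a::order"
  assumes "\<And>i. s i < s (i + 1)"
  shows "strict_mono s"
proof (rule strict_monoI)
  fix i j :: int
  assume "i < j"
  then show "s i < s j"
  proof (induction j rule: int_gr_induct)
    case base
    show ?case by (rule assms)
  next
    case (step j)
    then show ?case using assms[of j] by simp
  qed
qed

text \<open>The neighbours of an element within the range depend on the range alone, so agreement at
  0 spreads in both directions.\<close>

lemma strict_mono_range_eqI:
  fixes s t :: "int \<Rightarrow> 'a::linorder"
  assumes "strict_mono s" "strict_mono t" "range s = range t" "s 0 = t 0"
  shows "s = t"
proof -
  have up: "s (i + 1) \<le> t (i + 1)"
    if st: "strict_mono s" "strict_mono t" "range s = range t" "s i = t i" for s t :: "int \<Rightarrow> 'a" and i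
  proof -
    obtain j where j: "t (i + 1) = s j" using st(3) by blast
    have "s i < s j" using strict_monoD[OF st(2), of i "i + 1"] st(4) j by simp
    then have "i + 1 \<le> j" using strict_mono_less[OF st(1)] by simp
    then show ?thesis using j strict_mono_less_eq[OF st(1)] by simp
  qed
  have down: "t (i - 1) \<le> s (i - 1)"
    if st: "strict_mono s" "strict_mono t" "range s = range t" "s i = t i" for s t :: "int \<Rightarrow> 'a" and i
  proof -
    obtain j where j: "t (i - 1) = s j" using st(3) by blast
    have "s j < s i" using strict_monoD[OF st(2), of "i - 1" i] st(4) j by simp
    then have "j \<le> i - 1" using strict_mono_less[OF st(1)] by simp
    then show ?thesis using j strict_mono_less_eq[OF st(1)] by simp
  qed
  have "s i = t i" for i
  proof (induction i rule: int_induct[where k = 0])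
    case base
    then show ?case using assms by simp
  next
    case (step1 i)
    then show ?case using up[of s t i] up[of t s i] assms by (auto intro: order.antisym)
  next
    case (step2 i)
    then show ?case using down[of s t i] down[of t s i] assms by (auto intro: order.antisym)
  qed
  then show ?thesis by blast
qed

lemma periodic_strict_mono:
  fixes t :: "int \<Rightarrow> int"
  assumes per: "\<And>i. t (i + int n) = t i + c" and n: "n > 0"
    and win: "\<And>i j. 0 \<le> i \<Longrightarrow> i < j \<Longrightarrow> j < int n \<Longrightarrow> t i < t j"
    and last: "t (int n - 1) < t 0 + c"
  shows "strict_mono t"
proof (rule strict_mono_int_step)
  fix i :: int
  define r where "r = i mod int n"
  define q where "q = i div int n"
  have i: "i = r + int n * q" by (simp add: r_def q_def)
  have r: "0 \<le> r" "r < int n" using n by (simp_all add: r_def)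
  have per': "t (j + int n * q) = t j + c * q" for j q
    using quasi_periodic_mult[of t "int n" c j q] per by simp
  show "t i < t (i + 1)"
  proof (cases "r + 1 < int n")
    case True
    then have "t r < t (r + 1)" using r by (intro win) auto
    then show ?thesis using per'[of r q] per'[of "r + 1" q] by (simp add: i algebra_simps)
  next
    case False
    then have r': "r = int n - 1" using r by simp
    have "i + 1 = 0 + int n * (q + 1)" by (simp add: i r' algebra_simps)
    then have "t (i + 1) = t 0 + c * (q + 1)" by (simp only: per')
    moreover have "t i = t (int n - 1) + c * q" unfolding i r' by (rule per')
    ultimately show ?thesis using last by (simp add: algebra_simps)
  qed
qed

text \<open>The sorted list of S, continued by adding c in each period. Monotonicity is claimed
  inside one window only, since c may be too small for it beyond.\<close>

lemma ex_periodic_enumeration: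
  fixes S :: "int set"
  assumes S: "finite S" "card S = n" and n: "n > 0"
  shows "\<exists>t. (\<forall>i. t (i + int n) = t i + c) \<and> t ` {0..<int n} = S \<and>
    (\<forall>i j. 0 \<le> i \<longrightarrow> i < j \<longrightarrow> j < int n \<longrightarrow> t i < t j)"
proof (intro exI conjI allI impI)
  define L where "L = sorted_list_of_set S"
  have L: "length L = n" "set L = S" "sorted_wrt (<) L" using S by (simp_all add: L_def)
  define t where "t i = L ! nat (i mod int n) + c * (i div int n)" for i
  show "t (i + int n) = t i + c" for i using n by (simp add: t_def algebra_simps)
  have t: "t i = L ! nat i" if "0 \<le> i" "i < int n" for i using that by (simp add: t_def)
  show "t ` {0..<int n} = S"
  proof -
    have "t ` {0..<int n} = (\<lambda>i. L ! nat i) ` {0..<int n}" by (rule image_cong) (simp_all add: t)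
    also have "\<dots> = (\<lambda>i. L ! i) ` nat ` {0..<int n}" by (simp add: image_image)
    also have "nat ` {0..<int n} = {0..<n}" by (force simp: image_iff intro: bexI[of _ "int _"])
    also have "(\<lambda>i. L ! i) ` {0..<n} = set L" using L(1) by (auto simp: set_conv_nth)
    finally show ?thesis by (simp add: L)
  qed
  show "t i < t j" if "0 \<le> i" "i < j" "j < int n" for i j
  proof -
    have "L ! nat i < L ! nat j"
      by (rule sorted_wrt_nth_less[OF L(3)]) (use that L(1) in auto)
    then show ?thesis using that t[of i] t[of j] by simp
  qed
qed

lemma inj_mod_image:
  fixes s :: "int \<Rightarrow> int"
  assumes n: "n > 0" and inj: "\<And>i j. [s i = s j] (mod int n) \<Longrightarrow> [i = j] (mod int n)"
  shows "bij_betw (\<lambda>i. s i mod int n) {0..<int n} {0..<int n}"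
proof -
  have "i = j" if ij: "i \<in> {0..<int n}" "j \<in> {0..<int n}" "s i mod int n = s j mod int n" for i j
  proof -
    have "[s i = s j] (mod int n)" using ij(3) by (simp only: cong_def)
    then have "[i = j] (mod int n)" by (rule inj)
    then have "i mod int n = j mod int n" by (simp only: cong_def)
    then show "i = j" using ij(1,2) by simp
  qed
  then have "inj_on (\<lambda>i. s i mod int n) {0..<int n}" unfolding inj_on_def by blast
  moreover have "(\<lambda>i. s i mod int n) ` {0..<int n} \<subseteq> {0..<int n}" using n by auto
  ultimately show ?thesis using endo_inj_surj[OF finite_atLeastLessThan_int] unfolding bij_betw_def by blast
qed

text \<open>The extended word, continued to all integer positions.\<close>
definition ext_letter :: "nat \<Rightarrow> nat \<Rightarrow> int list \<Rightarrow> int \<Rightarrow> int" where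
  "ext_letter m k x t = ((x @ [int m - 1]) ! nat (t mod (int k + 1)) - t div (int k + 1)) mod int m"

definition zeros :: "nat \<Rightarrow> nat \<Rightarrow> int list \<Rightarrow> int set" where
  "zeros m k x = {t. ext_letter m k x (t - 1) = 0}"

lemma ext_letter_add:
  "ext_letter m k x (t + (int k + 1) * q) = (ext_letter m k x t - q) mod int m"
proof -
  let ?N = "int k + 1"
  have "(t + ?N * q) mod ?N = t mod ?N" "(t + ?N * q) div ?N = t div ?N + q"
    by (rule mod_mult_self2, subst div_mult_self2) simp_all
  then show ?thesis unfolding ext_letter_def by (simp only: mod_diff_left_eq diff_diff_eq)
qed

lemma ext_letter_mod: "ext_letter m k x t mod int m = ext_letter m k x t"
  by (simp add: ext_letter_def)

lemma concat_uniform_nth: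
  assumes "\<forall>xs \<in> set xss. length xs = n" "q < length xss" "r < n"
  shows "concat xss ! (n * q + r) = xss ! q ! r"
  using assms
proof (induction xss arbitrary: q)
  case (Cons xs xss)
  then show ?case by (cases q) (simp_all add: nth_append)
qed simp

lemma concat_uniform_length:
  assumes "\<forall>xs \<in> set xss. length xs = n"
  shows "length (concat xss) = n * length xss"
  using assms by (induction xss) auto

lemma extended_word_length:
  assumes "x \<in> words m k"
  shows "length (extended_word m x) = (k + 1) * m"
proof -
  have "length x = k" using assms by (simp add: words_def)
  then show ?thesis unfolding extended_word_def
    by (subst concat_uniform_length[where n = "k + 1"]) auto
qed

lemma extended_word_nth:
  assumes x: "x \<in> words m k" and p: "p < (k + 1) * m"
  shows "extended_word m x ! p = ext_letter m k x (int p)"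
proof -
  define q where "q = p div (k + 1)"
  define r where "r = p mod (k + 1)"
  have pqr: "p = (k + 1) * q + r" by (simp only: q_def r_def mult_div_mod_eq)
  have r: "r < k + 1" by (simp add: r_def)
  have q: "q < m" using p unfolding q_def by (simp add: div_less_iff_less_mult mult.commute)
  have len: "length x = k" using x by (simp add: words_def)
  have "extended_word m x ! p =
      (map (\<lambda>i. map (\<lambda>a. (a - i) mod int m) x @ [int m - 1 - i]) [0..int m - 1]) ! q ! r"
    unfolding extended_word_def pqr
    by (rule concat_uniform_nth) (use len q r in auto)
  also have "\<dots> = ((x @ [int m - 1]) ! r - int q) mod int m"
    using q r len by (cases "r < k") (auto simp: nth_append)
  also have "\<dots> = ext_letter m k x (int p)"
  proof -
    have "int p mod (int k + 1) = int r" "int p div (int k + 1) = int q"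
      by (simp_all add: r_def q_def zmod_int zdiv_int add.commute)
    then show ?thesis by (simp add: ext_letter_def)
  qed
  finally show ?thesis .
qed

lemma ext_letter_nth:
  assumes "x \<in> words m k" "r < k"
  shows "ext_letter m k x (int r) = x ! r"
proof -
  have "x ! r \<in> set x" using assms by (simp add: words_def)
  then have "x ! r \<in> {0..<int m}" using assms unfolding words_def by blast
  then show ?thesis using assms by (simp add: ext_letter_def words_def nth_append)
qed

lemma zeros_add:
  "t + (int k + 1) * q \<in> zeros m k x \<longleftrightarrow> (ext_letter m k x (t - 1) - q) mod int m = 0"
  using ext_letter_add[of m k x "t - 1" q] by (simp add: zeros_def algebra_simps)

lemma zeros_period:
  assumes "t \<in> zeros m k x"
  shows "t + int m * (int k + 1) * q \<in> zeros m k x"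
  using assms zeros_add[of t k "int m * q" m x] by (simp add: zeros_def mult_ac)

text \<open>Along a residue class modulo k + 1 the letters go down by 1 at each step, so zeros recur
  exactly every m steps.\<close>

lemma zeros_cong:
  assumes "t \<in> zeros m k x" "u \<in> zeros m k x" "[t = u] (mod (int k + 1))"
  shows "[t = u] (mod (int m * (int k + 1)))"
proof -
  obtain q where q: "u = t + (int k + 1) * q" using assms(3) by (metis cong_iff_lin)
  then have "(0 - q) mod int m = 0" using assms zeros_add[of t k q m x] by (simp add: zeros_def)
  then have "int m dvd q" by (simp add: mod_eq_0_iff_dvd)
  then obtain v where "q = int m * v" by blast
  then have "u = t + int m * (int k + 1) * v" using q by simp
  then show ?thesis unfolding cong_iff_lin by blast
qed

text \<open>Position 0 is the last letter of the preceding period, the final 0 of the extended word.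
  It provides the normalization \<open>s 0 = 0\<close>.\<close>

lemma zero_in_zeros:
  assumes "length x = k"
  shows "0 \<in> zeros m k x"
proof -
  have "(- 1) mod (int k + 1) = int k" "(- 1) div (int k + 1) = - 1"
    by (simp_all add: zmod_minus1 div_eq_minus1)
  then show ?thesis using assms by (simp add: zeros_def ext_letter_def nth_append)
qed

lemma zeros_residue:
  assumes "m > 0"
  shows "\<exists>t \<in> zeros m k x. 0 \<le> t \<and> t < int m * (int k + 1) \<and> [t = r] (mod (int k + 1))"
proof -
  \<comment> \<open>The letter at position r reaches 0 after as many blocks as its own
    value.\<close>
  define u where "u = r + (int k + 1) * ext_letter m k x (r - 1)"
  have u: "u \<in> zeros m k x" unfolding u_def zeros_add by simp
  define t where "t = u mod (int m * (int k + 1))"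
  have "t = u + int m * (int k + 1) * (- (u div (int m * (int k + 1))))"
    unfolding t_def by (simp add: minus_mult_div_eq_mod[symmetric])
  then have "t \<in> zeros m k x" by (simp only: zeros_period[OF u])
  moreover have "0 \<le> t" "t < int m * (int k + 1)" using assms by (simp_all add: t_def)
  moreover have "[t = r] (mod (int k + 1))"
  proof -
    have "[t = u] (mod (int k + 1))" by (simp add: t_def cong_def mod_mod_cancel)
    then show ?thesis by (simp add: u_def cong_def)
  qed
  ultimately show ?thesis by blast
qed

text \<open>Each residue class modulo k + 1 has one zero per period of length m (k + 1), so a period
  holds k + 1 zeros, and listing them in order gives a sequence with the right growth.\<close>

lemma ex_gapseq_of_word:
  assumes m: "m > 0" and x: "x \<in> words m k"
  shows "\<exists>s \<in> gapseq m (k + 1). range s = zeros m k x"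
proof -
  let ?N = "int k + 1" and ?M = "int m * (int k + 1)"
  define S where "S = zeros m k x \<inter> {0..<?M}"
  have small: "t = u" if "[t = u] (mod ?M)" "t \<in> {0..<?M}" "u \<in> {0..<?M}" for t u
    using that by (simp add: cong_def)
  have "bij_betw (\<lambda>t. t mod ?N) S {0..<?N}"
    unfolding bij_betw_def
  proof
    show "inj_on (\<lambda>t. t mod ?N) S"
    proof (rule inj_onI)
      fix t u assume "t \<in> S" "u \<in> S" "t mod ?N = u mod ?N"
      then show "t = u" using zeros_cong[of t m k x u] small[of t u] by (simp add: S_def cong_def)
    qed
    show "(\<lambda>t. t mod ?N) ` S = {0..<?N}"
    proof (intro equalityI subsetI)
      fix r assume "r \<in> (\<lambda>t. t mod ?N) ` S"
      then obtain t where "r = t mod ?N" by blast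
      then show "r \<in> {0..<?N}" using pos_mod_bound[of ?N t] by simp
    next
      fix r assume r: "r \<in> {0..<?N}"
      obtain t where "t \<in> S" "[t = r] (mod ?N)"
        using zeros_residue[OF m, of k x r] by (auto simp: S_def)
      then show "r \<in> (\<lambda>t. t mod ?N) ` S" using r by (auto simp: cong_def image_iff intro!: bexI[of _ t])
    qed
  qed
  then have card: "card S = k + 1" by (simp add: bij_betw_same_card)
  have "finite S" by (simp add: S_def)
  from ex_periodic_enumeration[OF this card, of ?M] obtain s where
    per: "\<And>i. s (i + int (k + 1)) = s i + ?M" and im: "s ` {0..<int (k + 1)} = S"
    and mono: "\<And>i j. 0 \<le> i \<Longrightarrow> i < j \<Longrightarrow> j < int (k + 1) \<Longrightarrow> s i < s j"
    by auto
  have sS: "s i \<in> zeros m k x" "0 \<le> s i" "s i < ?M" if "0 \<le> i" "i < ?N" for i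
  proof -
    have "s i \<in> S" using im that by auto
    then show "s i \<in> zeros m k x" "0 \<le> s i" "s i < ?M" by (simp_all add: S_def)
  qed
  have s0: "s 0 = 0"
  proof -
    have "0 \<in> S" using zero_in_zeros[of x k m] x m by (simp add: S_def words_def)
    then obtain i where i: "s i = 0" "0 \<le> i" "i < ?N" using im by (auto simp: image_iff)
    then show ?thesis using mono[of 0 i] sS[of 0] by (cases "i = 0") auto
  qed
  have sm: "strict_mono s"
    by (rule periodic_strict_mono[where n = "k + 1" and c = ?M and t = s, OF per _ mono]) (use s0 sS[of "int k"] in simp_all)
  have red: "s i = s (i mod ?N) + ?M * (i div ?N)" for i
    using quasi_periodic_mult[of s "int (k + 1)" ?M "i mod ?N" "i div ?N"] per by (simp add: add.commute)
  have rng: "s i \<in> zeros m k x" for i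
    unfolding red[of i] using pos_mod_bound[of ?N i] by (intro zeros_period sS) simp_all
  have "range s = zeros m k x"
  proof (intro equalityI subsetI)
    fix t assume t: "t \<in> zeros m k x"
    have "t mod ?M = t + ?M * (- (t div ?M))" by (simp add: minus_mult_div_eq_mod[symmetric])
    then have "t mod ?M \<in> zeros m k x" by (simp only: zeros_period[OF t])
    then have "t mod ?M \<in> S" using m by (simp add: S_def)
    then obtain i where "s i = t mod ?M" using im by (metis imageE)
    then have "s (i + int (k + 1) * (t div ?M)) = t"
      using quasi_periodic_mult[of s "int (k + 1)" ?M i "t div ?M"] per by simp
    then show "t \<in> range s" by (metis rangeI)
  qed (use rng in auto)
  moreover have "[i = j] (mod int (k + 1))" if "[s i = s j] (mod int (k + 1))" for i j
  proof -
    have "[s i = s j] (mod ?M)" using that rng by (intro zeros_cong) (simp_all add: add.commute)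
    then have "[s (i mod ?N) = s (j mod ?N)] (mod ?M)" by (simp add: red[of i] red[of j] cong_def)
    then have "s (i mod ?N) = s (j mod ?N)" by (rule small) (use sS[of "i mod ?N"] sS[of "j mod ?N"] pos_mod_bound[of ?N] in simp_all)
    then show ?thesis using sm by (simp add: strict_mono_eq cong_def add.commute)
  qed
  ultimately show ?thesis using sm s0 per by (intro bexI[of _ s]) (auto simp: gapseq_def algebra_simps)
qed

text \<open>The r-th letter is forced: it is the number of blocks, modulo m, from position r + 1 to
  an element of the range in the same residue class. Such an element exists because the values of s
  meet every class.\<close>

lemma ex_word_of_gapseq:
  assumes m: "m > 0" and "s \<in> gapseq m (k + 1)"
  shows "\<exists>x \<in> words m k. zeros m k x = range s"
proof -
  note s = gapseqD[OF assms(2)]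
  let ?N = "int k + 1"
  have per: "s (i + ?N * t) = s i + int m * ?N * t" for i t
    using s(4)[of i t] by (simp add: algebra_simps)
  have inj: "[i = j] (mod ?N)" if "[s i = s j] (mod ?N)" for i j
    using s(5)[of i j] that by (simp add: add.commute)
  have "\<exists>c. c \<in> {0..<int m} \<and> int r + 1 + ?N * c \<in> range s" for r
  proof -
    have "(int r + 1) mod ?N \<in> (\<lambda>i. s i mod int (k + 1)) ` {0..<int (k + 1)}"
      using bij_betw_imp_surj_on[OF inj_mod_image[of "k + 1" s]] s(5)
        pos_mod_bound[of ?N "int r + 1"] by (simp add: add.commute)
    then obtain i where "s i mod ?N = (int r + 1) mod ?N" by (auto simp: add.commute)
    then have "[int r + 1 = s i] (mod ?N)" by (simp add: cong_def)
    then obtain q where q: "s i = int r + 1 + ?N * q" unfolding cong_iff_lin by blast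
    have "s (i + ?N * (- (q div int m))) = int r + 1 + ?N * (q - int m * (q div int m))"
      unfolding per q by (simp add: algebra_simps)
    then have "s (i + ?N * (- (q div int m))) = int r + 1 + ?N * (q mod int m)"
      by (simp only: minus_mult_div_eq_mod)
    then have "int r + 1 + ?N * (q mod int m) \<in> range s" by (metis rangeI)
    then show ?thesis using m by (intro exI[of _ "q mod int m"]) simp
  qed
  then obtain c where c: "c r \<in> {0..<int m}" "int r + 1 + ?N * c r \<in> range s" for r by metis
  define x where "x = map c [0..<k]"
  have x: "x \<in> words m k" using c(1) by (auto simp: x_def words_def)
  \<comment> \<open>The separator acts as one more letter: m - 1 places a zero at position m (k +
    1), and this is the value of s at k + 1.\<close>
  define y where "y = x @ [int m - 1]"
  have y: "int r + 1 + ?N * (y ! r) \<in> range s" if "r < k + 1" for r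
  proof (cases "r = k")
    case True
    have "s (0 + ?N * 1) = int m * ?N" unfolding per using s(2) by simp
    then have "int m * ?N \<in> range s" by (metis rangeI)
    moreover have "y ! k = int m - 1" by (simp add: y_def x_def nth_append)
    moreover have "int k + 1 + ?N * (int m - 1) = int m * ?N" by (simp add: algebra_simps)
    ultimately show ?thesis using True by simp
  next
    case False
    then show ?thesis using that c(2)[of r] by (simp add: y_def x_def nth_append)
  qed
  have "t \<in> zeros m k x \<longleftrightarrow> t \<in> range s" for t
  proof -
    define r where "r = nat ((t - 1) mod ?N)"
    define q where "q = (t - 1) div ?N"
    have "int r = (t - 1) mod ?N" by (simp add: r_def)
    then have t: "t = int r + 1 + ?N * q" using mult_div_mod_eq[of ?N "t - 1"] by (simp add: q_def)
    have r: "r < k + 1" using pos_mod_bound[of ?N "t - 1"] by (simp add: r_def nat_less_iff)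
    have z: "t \<in> zeros m k x \<longleftrightarrow> (y ! r - q) mod int m = 0"
      by (simp add: zeros_def ext_letter_def y_def r_def q_def)
    obtain i where i: "s i = int r + 1 + ?N * (y ! r)" using y[OF r] by (metis imageE)
    show ?thesis
    proof
      assume "t \<in> zeros m k x"
      then obtain u where "y ! r - q = int m * u" using z by (auto elim: dvdE)
      then have q': "q = y ! r - int m * u" by simp
      have "t = s (i + ?N * (- u))" unfolding per i unfolding t q' by (simp add: algebra_simps)
      then show "t \<in> range s" by blast
    next
      assume "t \<in> range s"
      then obtain j where j: "t = s j" by blast
      have "[s i = s j] (mod ?N)" unfolding i j[symmetric] t by (simp add: cong_def)
      then have "[i = j] (mod ?N)" by (rule inj)
      then obtain v where "j = i + ?N * v" by (metis cong_iff_lin)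
      then have "t = s i + int m * ?N * v" using j per by simp
      then have "?N * q = ?N * (y ! r + int m * v)" unfolding i t by (simp add: algebra_simps)
      then have "q = y ! r + int m * v" by simp
      then show "t \<in> zeros m k x" using z by simp
    qed
  qed
  then show ?thesis using x by blast
qed

text \<open>A letter comes down to 0 after as many blocks as its value, so the zeros in its residue
  class reveal it.\<close>

lemma zeros_inj:
  assumes x: "x \<in> words m k" and y: "y \<in> words m k" and eq: "zeros m k x = zeros m k y"
  shows "x = y"
proof (rule nth_equalityI)
  show "length x = length y" using x y by (simp add: words_def)
  fix r assume "r < length x"
  then have r: "r < k" using x by (simp add: words_def)
  have "int r + 1 + (int k + 1) * (x ! r) \<in> zeros m k x"
    unfolding zeros_add using ext_letter_nth[OF x r] by simp
  then have "(y ! r - x ! r) mod int m = 0"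
    unfolding eq zeros_add using ext_letter_nth[OF y r] by simp
  then have "[y ! r = x ! r] (mod int m)" by (simp add: cong_iff_dvd_diff mod_eq_0_iff_dvd)
  moreover have "x ! r \<in> set x" "y ! r \<in> set y" using x y r by (simp_all add: words_def)
  then have "x ! r \<in> {0..<int m}" "y ! r \<in> {0..<int m}"
    using x y unfolding words_def by blast+
  ultimately show "x ! r = y ! r" by (simp add: cong_def)
qed

text \<open>The leftmost zero stands at position \<open>s 1\<close>, so the rotation lowers all
  positions by \<open>s 1\<close>. What has to be checked is that the rotated word is the extended
  word of its first k letters, and the critical place is the separator.\<close>

lemma phi_zeros:
  assumes m: "m > 0" and s: "s \<in> gapseq m (k + 1)" and x: "x \<in> words m k"
    and rng: "range s = zeros m k x"
  shows "phi m k x \<in> words m k" "zeros m k (phi m k x) = range (shift 1 s)"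
proof -
  note S = gapseqD[OF s]
  let ?N = "int k + 1"
  define e where "e = extended_word m x"
  have len: "length e = (k + 1) * m" using extended_word_length[OF x] by (simp add: e_def)
  have nth: "e ! p = ext_letter m k x (int p)" if "p < (k + 1) * m" for p
    using extended_word_nth[OF x that] by (simp add: e_def)
  have pos: "0 < s 1" using strict_monoD[OF S(1), of 0 1] S(2) by simp
  define p where "p = nat (s 1 - 1)"
  have p: "int p = s 1 - 1" using pos by (simp add: p_def)
  have "s 1 \<le> s (0 + int (k + 1))" using strict_mono_less_eq[OF S(1), of 1 "0 + int (k + 1)"] by simp
  then have "int p < int ((k + 1) * m)" using S(2) p unfolding S(3) by (simp add: algebra_simps)
  then have pl: "p < (k + 1) * m" by (simp only: of_nat_less_iff)
  have zero: "e ! q = 0 \<longleftrightarrow> int q + 1 \<in> range s" if "q < (k + 1) * m" for q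
    using nth[OF that] rng by (simp add: zeros_def)
  have "takeWhile (\<lambda>a. a \<noteq> 0) e = take p e"
  proof (rule takeWhile_eq_take_P_nth)
    fix q assume q: "q < p" "q < length e"
    show "e ! q \<noteq> 0"
    proof
      assume "e ! q = 0"
      then obtain j where j: "s j = int q + 1" using zero q len by auto
      then have "s 0 < s j" "s j < s 1" using p q S(2) by auto
      then show False by (simp add: strict_mono_less[OF S(1)])
    qed
  next
    assume "p < length e"
    have "int p + 1 = s 1" using p by simp
    then show "\<not> e ! p \<noteq> 0" using zero[OF pl] by (metis rangeI)
  qed
  then have lp: "length (takeWhile (\<lambda>a. a \<noteq> 0) e) = p" using len pl by simp
  have phi: "phi m k x = take k (rotate (p + 1) e)"
    unfolding phi_def by (simp add: e_def[symmetric] lp Let_def)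
  have km: "k \<le> (k + 1) * m" using m by (cases m) auto
  \<comment> \<open>A rotation of the finite word is a translation of the continued word because the
    latter has the length of the former as a period.\<close>
  have period: "ext_letter m k x (u mod (?N * int m)) = ext_letter m k x u" for u
  proof -
    have "ext_letter m k x (u mod (?N * int m) + ?N * (int m * (u div (?N * int m)))) =
        ext_letter m k x (u mod (?N * int m))"
      unfolding ext_letter_add using ext_letter_mod[of m k x] by (simp add: mod_diff_right_eq[symmetric])
    then show ?thesis by (simp add: mult.assoc[symmetric])
  qed
  have phi_nth: "phi m k x ! r = ext_letter m k x (int r + s 1)" if "r < k" for r
  proof -
    have r: "r < (k + 1) * m" using that km by simp
    have "phi m k x ! r = e ! ((p + 1 + r) mod ((k + 1) * m))"
      using that r len nth_rotate[of r e "p + 1"] by (simp add: phi del: rotate_Suc)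
    also have "\<dots> = ext_letter m k x (int ((p + 1 + r) mod ((k + 1) * m)))"
      by (rule nth) (use m in simp)
    also have "int ((p + 1 + r) mod ((k + 1) * m)) = (int r + s 1) mod (?N * int m)"
    proof -
      have "int (p + 1 + r) = int r + s 1" using p by simp
      moreover have "int ((k + 1) * m) = ?N * int m" by (simp add: algebra_simps)
      ultimately show ?thesis by (simp only: zmod_int)
    qed
    finally show ?thesis by (simp only: period)
  qed
  have lphi: "length (phi m k x) = k" using len km by (simp add: phi)
  show w: "phi m k x \<in> words m k"
    using lphi phi_nth m by (auto simp: words_def in_set_conv_nth ext_letter_def)
  have ext: "ext_letter m k (phi m k x) u = ext_letter m k x (u + s 1)" for u
  proof -
    define r where "r = nat (u mod ?N)"
    define q where "q = u div ?N"
    have r: "r < k + 1" using pos_mod_bound[of ?N u] by (simp add: r_def nat_less_iff)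
    have "int r = u mod ?N" by (simp add: r_def)
    then have u: "u = int r + ?N * q" by (simp add: q_def)
    have "ext_letter m k (phi m k x) (int r) = ext_letter m k x (int r + s 1)"
    proof (cases "r < k")
      case True
      then show ?thesis using ext_letter_nth[OF w] phi_nth by simp
    next
      case False
      then have rk: "r = k" using r by simp
      \<comment> \<open>One block after a zero the letter is -1, that is m - 1, as the separator
        requires.\<close>
      have "s 1 \<in> zeros m k x" using rng by blast
      then have "ext_letter m k x (s 1 - 1 + ?N * 1) = (- 1) mod int m"
        unfolding ext_letter_add by (simp add: zeros_def)
      then have "ext_letter m k x (int r + s 1) = (- 1) mod int m" by (simp add: rk algebra_simps)
      moreover have "ext_letter m k (phi m k x) (int r) = (int m - 1) mod int m"
        using lphi by (simp add: ext_letter_def rk nth_append)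
      moreover have "(int m - 1) mod int m = (- 1) mod int m"
        using mod_add_self1[of "int m" "- 1"] by simp
      ultimately show ?thesis by simp
    qed
    moreover have "u + s 1 = int r + s 1 + ?N * q" unfolding u by simp
    ultimately show ?thesis using ext_letter_add[of m k "phi m k x" "int r" q]
        ext_letter_add[of m k x "int r + s 1" q] u by metis
  qed
  show "zeros m k (phi m k x) = range (shift 1 s)"
  proof (intro equalityI subsetI)
    fix t assume "t \<in> zeros m k (phi m k x)"
    then have "t + s 1 \<in> zeros m k x" using ext[of "t - 1"] by (simp add: zeros_def algebra_simps)
    then obtain j where "t + s 1 = s j" unfolding rng[symmetric] by blast
    then have "t = shift 1 s (j - 1)" by (simp add: shift_def)
    then show "t \<in> range (shift 1 s)" by blast
  next
    fix t assume "t \<in> range (shift 1 s)"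
    then obtain j where "t + s 1 = s (j + 1)" by (auto simp: shift_def)
    then have "t + s 1 \<in> zeros m k x" unfolding rng[symmetric] by simp
    then show "t \<in> zeros m k (phi m k x)" using ext[of "t - 1"] by (simp add: zeros_def algebra_simps)
  qed
qed

section \<open>The bijection between sequences and words, and the number of sequences\<close>

definition word_of_gapseq :: "nat \<Rightarrow> nat \<Rightarrow> (int \<Rightarrow> int) \<Rightarrow> int list" where
  "word_of_gapseq m k s = (THE x. x \<in> words m k \<and> zeros m k x = range s)"

lemma word_of_gapseq_eqI:
  "x \<in> words m k \<Longrightarrow> zeros m k x = range s \<Longrightarrow> word_of_gapseq m k s = x"
  unfolding word_of_gapseq_def by (rule the_equality) (auto intro: zeros_inj)

lemma bij_word_of_gapseq:
  assumes "m > 0"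
  shows "bij_betw (word_of_gapseq m k) (gapseq m (k + 1)) (words m k)"
  unfolding bij_betw_def
proof
  show "inj_on (word_of_gapseq m k) (gapseq m (k + 1))"
  proof (rule inj_onI)
    fix s t assume st: "s \<in> gapseq m (k + 1)" "t \<in> gapseq m (k + 1)"
      "word_of_gapseq m k s = word_of_gapseq m k t"
    obtain x y where "x \<in> words m k" "zeros m k x = range s" "y \<in> words m k" "zeros m k y = range t"
      using ex_word_of_gapseq[OF assms] st by meson
    then have "range s = range t" using st(3) by (simp add: word_of_gapseq_eqI)
    then show "s = t" using st by (intro strict_mono_range_eqI) (auto simp: gapseqD(1,2))
  qed
  show "word_of_gapseq m k ` gapseq m (k + 1) = words m k"
  proof (intro equalityI subsetI)
    fix x assume "x \<in> word_of_gapseq m k ` gapseq m (k + 1)"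
    then obtain s where s: "s \<in> gapseq m (k + 1)" "x = word_of_gapseq m k s" by blast
    then show "x \<in> words m k" using ex_word_of_gapseq[OF assms s(1)] word_of_gapseq_eqI by metis
  next
    fix x assume x: "x \<in> words m k"
    then obtain s where "s \<in> gapseq m (k + 1)" "range s = zeros m k x"
      using ex_gapseq_of_word[OF assms] by blast
    then show "x \<in> word_of_gapseq m k ` gapseq m (k + 1)"
      using word_of_gapseq_eqI[OF x] by (metis imageI)
  qed
qed

lemma phi_word_of_gapseq:
  assumes "m > 0" "s \<in> gapseq m (k + 1)"
  shows "phi m k (word_of_gapseq m k s) = word_of_gapseq m k (shift 1 s)"
proof -
  obtain x where x: "x \<in> words m k" "zeros m k x = range s" using ex_word_of_gapseq[OF assms] by blast
  then show ?thesis using phi_zeros[OF assms x(1)] word_of_gapseq_eqI by metis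
qed

lemma card_gapseq:
  assumes "m > 0" "n > 0"
  shows "finite (gapseq m n)" "card (gapseq m n) = m ^ (n - 1)"
proof -
  have bij: "bij_betw (word_of_gapseq m (n - 1)) (gapseq m n) (words m (n - 1))"
    using bij_word_of_gapseq[OF assms(1), of "n - 1"] assms(2) by simp
  have w: "words m (n - 1) = {xs. set xs \<subseteq> {0..<int m} \<and> length xs = n - 1}"
    by (auto simp: words_def)
  have "finite (words m (n - 1))" "card (words m (n - 1)) = m ^ (n - 1)"
    unfolding w by (simp_all add: finite_lists_length_eq card_lists_length_eq)
  then show "finite (gapseq m n)" "card (gapseq m n) = m ^ (n - 1)"
    using bij bij_betw_finite bij_betw_same_card by metis+
qed

section \<open>Cyclic sieving for sequences\<close>

text \<open>A power of \<open>\<omega> c\<close> is the image of a multiple of c, and injectivity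
  makes the kernel trivial. Hence the order of \<open>\<omega> c\<close> is the same for every
  choice of the isomorphism.\<close>

lemma iso_unity_roots_power_eq_1:
  assumes n: "n > 0" and \<omega>: "\<omega> \<in> iso (integer_mod_group n) (unity_roots_group n)"
    and c: "0 \<le> c" "c < int n"
  shows "\<omega> c ^ t = 1 \<longleftrightarrow> int n dvd c * int t"
proof -
  have car: "carrier (integer_mod_group n) = {0..<int n}"
    using n by (simp add: carrier_integer_mod_group)
  have hom: "\<omega> ((a + b) mod int n) = \<omega> a * \<omega> b" if "a \<in> {0..<int n}" "b \<in> {0..<int n}" for a b
    using \<omega> that car by (simp add: iso_def hom_def unity_roots_group_def)
  have inj: "inj_on \<omega> {0..<int n}" and into: "\<omega> ` {0..<int n} = {z. z ^ n = 1}"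
    using \<omega> car by (auto simp: iso_def bij_betw_def unity_roots_group_def)
  have "\<omega> 0 = \<omega> 0 * \<omega> 0" using hom[of 0 0] n by simp
  moreover have "\<omega> 0 ^ n = 1" using into n by auto
  then have "\<omega> 0 \<noteq> 0" using n by (metis power_0_left zero_neq_one neq0_conv)
  ultimately have one: "\<omega> 0 = 1" by simp
  have pow: "\<omega> ((c * int t) mod int n) = \<omega> c ^ t"
  proof (induction t)
    case (Suc t)
    have "(c * int (Suc t)) mod int n = ((c * int t) mod int n + c) mod int n"
      unfolding mod_add_left_eq by (simp add: algebra_simps)
    then have "\<omega> ((c * int (Suc t)) mod int n) = \<omega> ((c * int t) mod int n) * \<omega> c"
      using hom[of "(c * int t) mod int n" c] n c by simp
    then show ?case using Suc by simp
  qed (use one in simp)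
  have "\<omega> c ^ t = 1 \<longleftrightarrow> \<omega> ((c * int t) mod int n) = \<omega> 0" using pow one by simp
  also have "\<dots> \<longleftrightarrow> (c * int t) mod int n = 0"
    using inj_on_eq_iff[OF inj, of "(c * int t) mod int n" 0] n by simp
  finally show ?thesis by (simp add: mod_eq_0_iff_dvd)
qed

lemma cyclic_integer_mod_group:
  assumes "n > 0"
  shows "cyclic_group (integer_mod_group n)"
proof -
  have car: "carrier (integer_mod_group n) = {0..<int n}"
    using assms by (simp add: carrier_integer_mod_group)
  \<comment> \<open>For n = 1 the carrier is {0}, so the generator must be written as a
    remainder.\<close>
  have pow: "(1 mod int n) [^]\<^bsub>integer_mod_group n\<^esub> j = j mod int n" for j :: int
    using int_pow_integer_mod_group[of n "1 mod int n" j] by (simp add: mod_mult_right_eq)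
  have "carrier (integer_mod_group n) = range (\<lambda>j::int. j mod int n)"
  proof (intro equalityI subsetI)
    fix j assume "j \<in> carrier (integer_mod_group n)"
    then have "j = j mod int n" using car by simp
    then show "j \<in> range (\<lambda>j. j mod int n)" by (rule range_eqI)
  qed (use assms car in auto)
  then show ?thesis
    using assms car unfolding group.cyclic_group[OF group_integer_mod_group]
    by (intro bexI[of _ "1 mod int n"]) (simp_all add: pow)
qed

text \<open>With \<open>\<epsilon> = - 1\<close> this covers the geometric rotation, which shifts in the opposite direction.\<close>
lemma cyclic_sieving_by_shift:
  assumes m: "m > 0" and bij: "bij_betw h (gapseq m (k + 1)) X"
    and f: "\<And>s. s \<in> gapseq m (k + 1) \<Longrightarrow> f (h s) = h (shift \<epsilon> s)"
    and \<epsilon>: "\<epsilon> = 1 \<or> \<epsilon> = - 1"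
  shows "cyclic_sieving_by (k + 1) X (W_poly m k) f"
proof -
  let ?N = "k + 1"
  let ?G = "gapseq m ?N"
  let ?C = "integer_mod_group ?N"
  have car: "carrier ?C = {0..<int ?N}" by (simp add: carrier_integer_mod_group)
  have X: "X = h ` ?G" and inj: "inj_on h ?G" using bij by (auto simp: bij_betw_def)
  have fin: "finite X" unfolding X using card_gapseq[OF m] by simp
  have pow: "(f ^^ j) (h s) = h (shift (\<epsilon> * int j) s)" if "s \<in> ?G" for j s
  proof (induction j)
    case 0
    then show ?case using shift_0 gapseqD(2)[OF that] by simp
  next
    case (Suc j)
    then show ?case using f[OF shift_in_gapseq[OF that]]
      by (simp add: shift_shift algebra_simps)
  qed
  have act: "cyclic_action X f a (h s) = h (shift (\<epsilon> * a) s)" if "s \<in> ?G" "0 \<le> a" for a s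
    using that pow[OF that(1), of "nat a"] X by (simp add: cyclic_action_def)
  have act_in: "cyclic_action X f a (h s) \<in> X" if "s \<in> ?G" "0 \<le> a" for a s
    using act[OF that] X shift_in_gapseq[OF that(1)] by auto
  have shift_id: "shift (\<epsilon> * (a mod int ?N)) s = shift (\<epsilon> * a) s" if "s \<in> ?G" for a s
  proof -
    have "shift ((\<epsilon> * (a mod int ?N)) mod int ?N) s = shift ((\<epsilon> * a) mod int ?N) s"
      by (simp only: mod_mult_right_eq)
    then show ?thesis by (simp only: shift_mod[OF that])
  qed
  have comp: "cyclic_action X f ((a + b) mod int ?N) (h s) = cyclic_action X f a (cyclic_action X f b (h s))"
    if "s \<in> ?G" "0 \<le> a" "0 \<le> b" for a b s
  proof -
    have "cyclic_action X f a (cyclic_action X f b (h s)) = h (shift (\<epsilon> * (a + b)) s)"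
      using that act act shift_in_gapseq[OF that(1)] by (simp add: shift_shift algebra_simps)
    also have "\<dots> = cyclic_action X f ((a + b) mod int ?N) (h s)"
      using act[OF that(1), of "(a + b) mod int ?N"] shift_id[OF that(1), of "a + b"] by simp
    finally show ?thesis by simp
  qed
  have perm: "cyclic_action X f a \<in> Bij X" if a: "a \<in> {0..<int ?N}" for a
  proof -
    define b where "b = (- a) mod int ?N"
    have b: "0 \<le> b" "(a + b) mod int ?N = 0" "(b + a) mod int ?N = 0"
      by (simp_all add: b_def mod_add_right_eq mod_add_left_eq)
    have zero: "cyclic_action X f 0 x = x" if "x \<in> X" for x
      using that by (simp add: cyclic_action_def)
    have "bij_betw (cyclic_action X f a) X X"
    proof (rule bij_betwI)
      show "cyclic_action X f a \<in> X \<rightarrow> X" "cyclic_action X f b \<in> X \<rightarrow> X"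
        using act_in a b X by auto
      show "cyclic_action X f b (cyclic_action X f a x) = x" if "x \<in> X" for x
        using that comp[of _ b a] zero a b X by force
      show "cyclic_action X f a (cyclic_action X f b x) = x" if "x \<in> X" for x
        using that comp[of _ a b] zero a b X by force
    qed
    then show ?thesis by (simp add: Bij_def cyclic_action_def)
  qed
  have "group_action ?C X (cyclic_action X f)"
    unfolding group_action_def group_hom_def group_hom_axioms_def
  proof (intro conjI)
    show "cyclic_action X f \<in> hom ?C (BijGroup X)"
    proof (rule homI)
      fix a assume "a \<in> carrier ?C"
      then show "cyclic_action X f a \<in> carrier (BijGroup X)" using perm car by (simp add: BijGroup_def)
    next
      fix a b assume ab: "a \<in> carrier ?C" "b \<in> carrier ?C"
      have "cyclic_action X f ((a + b) mod int ?N) x = compose X (cyclic_action X f a) (cyclic_action X f b) x" for x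
      proof (cases "x \<in> X")
        case True
        then obtain s where "s \<in> ?G" "x = h s" using X by blast
        then show ?thesis using comp[of s a b] ab car True by (simp add: compose_eq)
      next
        case False
        then show ?thesis by (simp add: cyclic_action_def compose_def)
      qed
      then show "cyclic_action X f (a \<otimes>\<^bsub>?C\<^esub> b) =
          cyclic_action X f a \<otimes>\<^bsub>BijGroup X\<^esub> cyclic_action X f b"
        using ab perm car by (simp add: BijGroup_def mult_integer_mod_group fun_eq_iff)
    qed
  qed (auto simp: group_BijGroup)
  moreover have "poly (map_poly of_int (W_poly m k)) (\<omega> c) = of_nat (card {x \<in> X. cyclic_action X f c x = x})"
    if \<omega>: "\<omega> \<in> iso ?C (unity_roots_group (order ?C))" and c: "c \<in> carrier ?C" for \<omega> c
  proof -
    have ord: "order ?C = ?N" unfolding order_def car by simp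
    have c: "0 \<le> c" "c < int ?N" using c car by auto
    \<comment> \<open>The shifts by c and by e fix the same sequences, and n / e is the order of
      \<open>\<omega> c\<close>; this links the two sides of the identity.\<close>
    define e where "e = nat (gcd c (int ?N))"
    have e: "int e = gcd c (int ?N)" by (simp add: e_def)
    have "int e dvd int ?N" unfolding e by simp
    then have "e dvd ?N" by (simp only: of_nat_dvd_iff)
    then obtain d where d: "?N = d * e" by (metis dvdE mult.commute)
    have de: "d > 0" "e > 0" using d by (auto intro: Nat.gr0I)
    obtain c' where c': "c = int e * c'" unfolding e by (meson dvdE gcd_dvd1)
    have "coprime c' (int d)"
    proof -
      have "gcd c (int ?N) = gcd (int e * c') (int e * int d)" unfolding c' d by (simp add: mult.commute)
      also have "\<dots> = int e * gcd c' (int d)" by (simp add: gcd_mult_distrib_int[symmetric])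
      finally show ?thesis using e de by (simp add: coprime_iff_gcd_eq_1)
    qed
    have "\<omega> c ^ t = 1 \<longleftrightarrow> d dvd t" for t
    proof -
      have "\<omega> c ^ t = 1 \<longleftrightarrow> int ?N dvd c * int t"
        using iso_unity_roots_power_eq_1[of ?N \<omega> c t] \<omega> c unfolding ord by simp
      also have "\<dots> \<longleftrightarrow> int e * int d dvd int e * (c' * int t)"
        unfolding d c' by (simp only: of_nat_mult mult.commute[of "int d"] mult.assoc)
      also have "\<dots> \<longleftrightarrow> int d dvd c' * int t" using de by simp
      also have "\<dots> \<longleftrightarrow> int d dvd int t"
        using \<open>coprime c' (int d)\<close> by (simp add: coprime_dvd_mult_right_iff coprime_commute)
      finally show ?thesis by simp
    qed
    then have "poly (map_poly of_int (W_poly m k)) (\<omega> c) =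
        (if coprime m d then of_nat (m ^ (?N div d - 1)) else 0)"
      by (rule poly_W_poly_at_root) (simp only: d dvd_triv_left)
    also have "?N div d = e" using d de by (metis nonzero_mult_div_cancel_left neq0_conv)
    also have "(if coprime m d then of_nat (m ^ (e - 1)) else 0) = 
        (of_nat (card {s \<in> ?G. shift (int e) s = s}) :: complex)"
    proof -
      have "{s \<in> ?G. shift (int e) s = s} = (if coprime m d then gapseq m e else {})"
        by (rule fixed_gapseq[OF d _ m]) simp
      then show ?thesis using card_gapseq[OF m de(2)] by simp
    qed
    also have "card {s \<in> ?G. shift (int e) s = s} = card {x \<in> X. cyclic_action X f c x = x}"
    proof -
      have "cyclic_action X f c (h s) = h s \<longleftrightarrow> shift (int e) s = s" if s: "s \<in> ?G" for s
      proof -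
        have "cyclic_action X f c (h s) = h s \<longleftrightarrow> shift (\<epsilon> * c) s = s"
          unfolding act[OF s c(1)] using inj_on_eq_iff[OF inj shift_in_gapseq[OF s] s] .
        also have "\<dots> \<longleftrightarrow> shift (gcd (\<epsilon> * c) (int ?N)) s = s" by (rule shift_fixed_gcd[OF s])
        \<comment> \<open>The direction of the shift disappears in the gcd.\<close>
        also have "gcd (\<epsilon> * c) (int ?N) = int e" using \<epsilon> e by auto
        finally show ?thesis .
      qed
      then have "{x \<in> X. cyclic_action X f c x = x} = h ` {s \<in> ?G. shift (int e) s = s}"
        unfolding X by blast
      moreover have "inj_on h {s \<in> ?G. shift (int e) s = s}" by (rule inj_on_subset[OF inj]) blast
      ultimately show ?thesis by (simp add: card_image)
    qed
    finally show ?thesis .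
  qed
  moreover have "cyclic_group ?C" by (rule cyclic_integer_mod_group) simp
  ultimately show ?thesis
    using fin finite_atLeastLessThan_int[of 0 "int ?N"]
    unfolding cyclic_sieving_by_def cyclic_sieving_def car by blast
qed

lemma cyclic_sieving_words:
  assumes "m > 0"
  shows "cyclic_sieving_by (k + 1) (words m k) (W_poly m k) (phi m k)"
  by (rule cyclic_sieving_by_shift[OF assms bij_word_of_gapseq[OF assms] phi_word_of_gapseq[OF assms]])
    simp_all

section \<open>Alcoves\<close>

text \<open>The correction is the borrow in subtracting remainders. The next lemma has the same
  shape, so remainders modulo n and fractional parts can replace each other: both enter only through
  their order.\<close>

lemma diff_div_eq:
  fixes x y n :: int
  assumes "n > 0"
  shows "(x - y) div n = x div n - y div n - (if x mod n < y mod n then 1 else 0)"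
proof -
  have "x - y = (x mod n - y mod n) + n * (x div n - y div n)"
    using mult_div_mod_eq[of n x] mult_div_mod_eq[of n y] by (simp add: algebra_simps)
  then have "(x - y) div n = (x mod n - y mod n) div n + (x div n - y div n)"
    using assms by simp
  moreover have "(x mod n - y mod n) div n = - (if x mod n < y mod n then 1 else 0)"
  proof (cases "x mod n < y mod n")
    case True
    have "(x mod n - y mod n + n) div n = 0"
      using True assms pos_mod_bound[of n y] pos_mod_sign[of n x] by (intro div_pos_pos_trivial) linarith+
    moreover have "(x mod n - y mod n + n) div n = (x mod n - y mod n) div n + 1"
      using assms by simp
    ultimately show ?thesis using True by simp
  next
    case False
    then have "0 \<le> x mod n - y mod n" "x mod n - y mod n < n"
      using pos_mod_bound[of n x] pos_mod_sign[of n y] assms by linarith+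
    then show ?thesis using False by (simp add: div_pos_pos_trivial)
  qed
  ultimately show ?thesis by simp
qed

lemma floor_diff_eq:
  fixes x y :: real
  shows "\<lfloor>x - y\<rfloor> = \<lfloor>x\<rfloor> - \<lfloor>y\<rfloor> - (if frac x < frac y then 1 else 0)"
  by (rule floor_unique) (auto simp: frac_def; linarith)+

text \<open>The condition is confined to the window 0, ..., k, so that it can be stated before a
  function has been continued periodically.\<close>

definition distinct_residues :: "nat \<Rightarrow> (int \<Rightarrow> int) \<Rightarrow> bool" where
  "distinct_residues k s \<longleftrightarrow>
     (\<forall>i \<le> k. \<forall>j \<le> k. [s (int i) = s (int j)] (mod (int k + 1)) \<longrightarrow> i = j)"

lemma distinct_residues_bij:
  assumes "distinct_residues k s"
  shows "bij_betw (\<lambda>j. s (int j) mod (int k + 1)) {..k} {0..<int k + 1}"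
proof -
  have inj: "inj_on (\<lambda>j. s (int j) mod (int k + 1)) {..k}"
    using assms unfolding inj_on_def distinct_residues_def cong_def by blast
  moreover have "(\<lambda>j. s (int j) mod (int k + 1)) ` {..k} = {0..<int k + 1}"
  proof (rule card_subset_eq)
    show "card ((\<lambda>j. s (int j) mod (int k + 1)) ` {..k}) = card {0..<int k + 1}"
      using inj by (simp add: card_image)
    show "(\<lambda>j. s (int j) mod (int k + 1)) ` {..k} \<subseteq> {0..<int k + 1}"
      using pos_mod_bound[of "int k + 1"] by auto
  qed simp
  ultimately show ?thesis by (simp add: bij_betw_def)
qed

text \<open>The residues are a permutation of \<open>0, \<dots>, k\<close>, so each one is its own rank; the ranks
  can be read off the quotients.\<close>
lemma quotients_determine_differences:
  assumes s: "distinct_residues k s" and t: "distinct_residues k t"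
    and eq: "\<And>i j. i \<le> k \<Longrightarrow> j \<le> k \<Longrightarrow>
      (s (int j) - s (int i)) div (int k + 1) = (t (int j) - t (int i)) div (int k + 1)"
    and j: "j \<le> k"
  shows "s (int j) - s 0 = t (int j) - t 0"
proof -
  let ?N = "int k + 1"
  define a where "a i = s (int i) - s 0" for i :: nat
  define b where "b i = t (int i) - t 0" for i :: nat
  have rank: "nat (c j mod ?N) = card {i \<in> {..k}. c i mod ?N < c j mod ?N}"
    if c: "bij_betw (\<lambda>i. c i mod ?N) {..k} {0..<?N}" and j: "j \<le> k" for c :: "nat \<Rightarrow> int" and j
  proof -
    have "(\<lambda>i. c i mod ?N) ` {i \<in> {..k}. c i mod ?N < c j mod ?N} = {0..<c j mod ?N}"
    proof (intro equalityI subsetI)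
      fix v assume v: "v \<in> {0..<c j mod ?N}"
      then have "v \<in> {0..<?N}" using pos_mod_bound[of ?N "c j"] by auto
      then obtain i where "i \<in> {..k}" "v = c i mod ?N" using c unfolding bij_betw_def by blast
      then show "v \<in> (\<lambda>i. c i mod ?N) ` {i \<in> {..k}. c i mod ?N < c j mod ?N}" using v by auto
    qed auto
    moreover have "inj_on (\<lambda>i. c i mod ?N) {i \<in> {..k}. c i mod ?N < c j mod ?N}"
      using bij_betw_imp_inj_on[OF c] by (rule inj_on_subset) blast
    ultimately have "card {i \<in> {..k}. c i mod ?N < c j mod ?N} = card {0..<c j mod ?N}"
      using card_image[of "\<lambda>i. c i mod ?N" "{i \<in> {..k}. c i mod ?N < c j mod ?N}"] by simp
    then show ?thesis by simp
  qed
  have bij: "bij_betw (\<lambda>i. (u (int i) - u 0) mod ?N) {..k} {0..<?N}"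
    if u: "distinct_residues k u" for u
  proof -
    have "distinct_residues k (\<lambda>i. u i - u 0)"
      using u by (simp add: distinct_residues_def cong_iff_dvd_diff)
    from distinct_residues_bij[OF this] show ?thesis .
  qed
  have bij_a: "bij_betw (\<lambda>i. a i mod ?N) {..k} {0..<?N}" unfolding a_def by (rule bij[OF s])
  have bij_b: "bij_betw (\<lambda>i. b i mod ?N) {..k} {0..<?N}" unfolding b_def by (rule bij[OF t])
  have quot: "a i div ?N = b i div ?N" if "i \<le> k" for i
    using eq[of 0 i] that by (simp add: a_def b_def)
  have "a i mod ?N < a j mod ?N \<longleftrightarrow> b i mod ?N < b j mod ?N" if i: "i \<le> k" for i
  proof -
    have "(a i - a j) div ?N = (b i - b j) div ?N" using eq[of j i] i j by (simp add: a_def b_def)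
    then show ?thesis using diff_div_eq[of ?N "a i" "a j"] diff_div_eq[of ?N "b i" "b j"] quot i j
      by (simp split: if_splits)
  qed
  then have "{i \<in> {..k}. a i mod ?N < a j mod ?N} = {i \<in> {..k}. b i mod ?N < b j mod ?N}" by auto
  then have "nat (a j mod ?N) = nat (b j mod ?N)" using rank[OF bij_a j] rank[OF bij_b j] by simp
  then have "a j mod ?N = b j mod ?N" using eq_nat_nat_iff[of "a j mod ?N" "b j mod ?N"] by simp
  with quot[OF j] have "a j = b j" by (metis mult_div_mod_eq)
  then show ?thesis by (simp add: a_def b_def)
qed

section \<open>Partial sums of the simple roots as coordinates\<close>

locale type_A =
  fixes k :: nat and \<alpha> :: "nat \<Rightarrow> 'a::real_inner"
  assumes k: "k \<ge> 1" and roots: "type_A_simple_roots k \<alpha>"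
begin

abbreviation V :: "'a set" where "V \<equiv> root_space k \<alpha>"

text \<open>In the usual coordinates, where \<alpha> l is e_l - e_(l+1), this is y_1 - y_(j+1).
  Every root is a difference of two levels.\<close>

definition level :: "'a \<Rightarrow> nat \<Rightarrow> real" where
  "level y j = (\<Sum>l = 1..j. inner (\<alpha> l) y)"

lemma subspace_V: "subspace V"
  by (simp add: root_space_def)

lemma inner_roots:
  "i \<in> {1..k} \<Longrightarrow> j \<in> {1..k} \<Longrightarrow>
    inner (\<alpha> i) (\<alpha> j) = (if i = j then 2 else if i = j + 1 \<or> j = i + 1 then -1 else 0)"
  using roots unfolding type_A_simple_roots_def by blast

lemma root_in_V: "l \<in> {1..k} \<Longrightarrow> \<alpha> l \<in> V"
  unfolding root_space_def by (intro span_base) blast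

lemma level_0 [simp]: "level y 0 = 0"
  by (simp add: level_def)

lemma level_Suc: "level y (Suc j) = level y j + inner (\<alpha> (Suc j)) y"
  by (simp add: level_def)

lemma inner_root_level: "l \<ge> 1 \<Longrightarrow> inner (\<alpha> l) y = level y l - level y (l - 1)"
  using level_Suc[of y "l - 1"] by simp

lemma level_add: "level (y + z) j = level y j + level z j"
  by (simp add: level_def inner_add_right sum.distrib)

lemma level_scale: "level (r *\<^sub>R y) j = r * level y j"
  by (simp add: level_def sum_distrib_left)

lemma root_space_eqI:
  assumes "y \<in> V" "z \<in> V" "\<And>l. l \<in> {1..k} \<Longrightarrow> inner (\<alpha> l) y = inner (\<alpha> l) z"
  shows "y = z"
proof -
  have "y - z \<in> span (\<alpha> ` {1..k})" using assms(1,2) subspace_diff[OF subspace_V] by (simp add: root_space_def)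
  moreover have "orthogonal (y - z) x" if "x \<in> \<alpha> ` {1..k}" for x
    using that assms(3) by (auto simp: orthogonal_def inner_commute[of "y - z"] inner_diff_right)
  ultimately have "orthogonal (y - z) (y - z)" by (rule orthogonal_to_span)
  then show ?thesis by (simp add: orthogonal_self)
qed

lemma level_eqI:
  assumes "y \<in> V" "z \<in> V" "\<And>j. j \<le> k \<Longrightarrow> level y j = level z j"
  shows "y = z"
proof (rule root_space_eqI[OF assms(1,2)])
  fix l assume l: "l \<in> {1..k}"
  then show "inner (\<alpha> l) y = inner (\<alpha> l) z"
    using assms(3)[of l] assms(3)[of "l - 1"] by (auto simp: inner_root_level)
qed

text \<open>The Cartan matrix acts as a negated second difference; the zero values at 0 and k + 1
  stand for the neighbours missing at the ends of the Dynkin diagram.\<close>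

lemma inner_root_sum:
  assumes c: "c 0 = 0" "c (k + 1) = 0" and l: "l \<in> {1..k}"
  shows "inner (\<alpha> l) (\<Sum>j = 1..k. c j *\<^sub>R \<alpha> j) = 2 * c l - c (l - 1) - c (l + 1)"
proof -
  have "inner (\<alpha> l) (\<Sum>j = 1..k. c j *\<^sub>R \<alpha> j) = (\<Sum>j = 1..k. c j * inner (\<alpha> l) (\<alpha> j))"
    by (simp add: inner_sum_right)
  also have "\<dots> = (\<Sum>j = 1..k. (if j = l then 2 * c j else 0) + (if j = l - 1 then - c j else 0)
      + (if j = l + 1 then - c j else 0))"
    using l by (intro sum.cong[OF refl]) (auto simp: inner_roots)
  also have "\<dots> = 2 * c l + (if l - 1 \<in> {1..k} then - c (l - 1) else 0)
      + (if l + 1 \<in> {1..k} then - c (l + 1) else 0)"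
    using l by (simp add: sum.distrib)
  also have "(if l - 1 \<in> {1..k} then - c (l - 1) else 0) = - c (l - 1)"
    using l c by (cases "l = 1") auto
  also have "(if l + 1 \<in> {1..k} then - c (l + 1) else 0) = - c (l + 1)"
    using l c by (cases "l = k") auto
  finally show ?thesis by simp
qed

text \<open>The coefficients of the fundamental weights are the entries of the inverse Cartan matrix.\<close>
lemma ex_fundamental_weight:
  assumes i: "i \<in> {1..k}"
  shows "\<exists>w \<in> V. \<forall>l \<in> {1..k}. inner (\<alpha> l) w = (if l = i then 1 else 0)"
proof -
  \<comment> \<open>The function min i j bends only at i. The linear term leaves second differences
    unchanged and makes c vanish at k + 1.\<close>
  define c where "c j = real (min i j) - real i / (real k + 1) * real j" for j
  have c0: "c 0 = 0" "c (k + 1) = 0" using i by (simp_all add: c_def field_simps)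
  show ?thesis
  proof (intro bexI ballI)
    show "(\<Sum>j = 1..k. c j *\<^sub>R \<alpha> j) \<in> V"
      by (intro subspace_sum[OF subspace_V] subspace_scale[OF subspace_V] root_in_V)
    fix l assume l: "l \<in> {1..k}"
    have "2 * c l - c (l - 1) - c (l + 1) =
        2 * real (min i l) - real (min i (l - 1)) - real (min i (l + 1))"
      using l by (simp add: c_def of_nat_diff algebra_simps add_divide_distrib diff_divide_distrib)
    also have "\<dots> = (if l = i then 1 else 0)" using l by (auto simp: min_def of_nat_diff)
    finally show "inner (\<alpha> l) (\<Sum>j = 1..k. c j *\<^sub>R \<alpha> j) = (if l = i then 1 else 0)"
      using inner_root_sum[of c l] c0 l by simp
  qed
qed

lemma ex_level:
  assumes "g 0 = 0"
  shows "\<exists>y \<in> V. \<forall>j \<le> k. level y j = g j"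
proof -
  obtain w where w: "\<And>i. i \<in> {1..k} \<Longrightarrow> w i \<in> V"
    "\<And>i l. i \<in> {1..k} \<Longrightarrow> l \<in> {1..k} \<Longrightarrow> inner (\<alpha> l) (w i) = (if l = i then 1 else 0)"
    using ex_fundamental_weight by metis
  define y where "y = (\<Sum>i = 1..k. (g i - g (i - 1)) *\<^sub>R w i)"
  have y: "y \<in> V" unfolding y_def
    by (intro subspace_sum[OF subspace_V] subspace_scale[OF subspace_V] w)
  have "inner (\<alpha> l) y = g l - g (l - 1)" if "l \<in> {1..k}" for l
  proof -
    have "inner (\<alpha> l) y = (\<Sum>i = 1..k. (g i - g (i - 1)) * (if l = i then 1 else 0))"
      unfolding y_def inner_sum_right inner_scaleR_right
      by (rule sum.cong[OF refl]) (use that w(2) in simp)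
    then show ?thesis using that by (simp add: if_distrib[of "\<lambda>x. _ * x"] cong: if_cong)
  qed
  then have "level y j = g j" if "j \<le> k" for j
    using that by (induction j) (simp_all add: assms level_Suc)
  with y show ?thesis by blast
qed

lemma inner_positive_root:
  assumes "1 \<le> i" "i \<le> j"
  shows "inner (\<Sum>l = i..j. \<alpha> l) y = level y j - level y (i - 1)"
proof -
  have "{1..j} = {1..i - 1} \<union> {i..j}" using assms by auto
  then have "level y j = level y (i - 1) + (\<Sum>l = i..j. inner (\<alpha> l) y)"
    unfolding level_def by (simp add: sum.union_disjoint)
  then show ?thesis by (simp add: inner_sum_left)
qed

section \<open>Alcoves as cells of constant floors\<close>

definition regular :: "'a \<Rightarrow> bool" where
  "regular y \<longleftrightarrow> (\<forall>i \<le> k. \<forall>j \<le> k. i \<noteq> j \<longrightarrow> level y j - level y i \<notin> \<int>)"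

lemma hyperplane_complement:
  "V - (\<Union>\<beta> \<in> type_A_roots k \<alpha>. \<Union>p :: int. hyperplane \<beta> (of_int p)) = {y \<in> V. regular y}"
proof -
  have "y \<in> (\<Union>\<beta> \<in> type_A_roots k \<alpha>. \<Union>p :: int. hyperplane \<beta> (of_int p)) \<longleftrightarrow> \<not> regular y" for y
  proof
    assume "y \<in> (\<Union>\<beta> \<in> type_A_roots k \<alpha>. \<Union>p :: int. hyperplane \<beta> (of_int p))"
    then obtain \<beta> p where \<beta>: "\<beta> \<in> type_A_roots k \<alpha>" "inner \<beta> y = of_int p"
      by (auto simp: hyperplane_def)
    then obtain i j where ij: "1 \<le> i" "i \<le> j" "j \<le> k"
      "\<beta> = (\<Sum>l = i..j. \<alpha> l) \<or> \<beta> = - (\<Sum>l = i..j. \<alpha> l)"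
      by (auto simp: type_A_roots_def)
    then have "level y j - level y (i - 1) = of_int p \<or> level y j - level y (i - 1) = of_int (- p)"
      using \<beta>(2) inner_positive_root[OF ij(1,2), of y] by auto
    then have "level y j - level y (i - 1) \<in> \<int>" by (metis Ints_of_int)
    moreover have "i - 1 \<le> k" "i - 1 \<noteq> j" using ij by auto
    ultimately show "\<not> regular y" using ij unfolding regular_def by blast
  next
    assume "\<not> regular y"
    then obtain a b where ab: "a \<le> k" "b \<le> k" "a \<noteq> b" "level y b - level y a \<in> \<int>"
      unfolding regular_def by blast
    have *: "y \<in> (\<Union>\<beta> \<in> type_A_roots k \<alpha>. \<Union>p :: int. hyperplane \<beta> (of_int p))"
      if ab: "b \<le> k" "a < b" "level y b - level y a \<in> \<int>" for a b
    proof -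
      obtain p where "level y b - level y a = of_int p" using ab(3) by (auto elim: Ints_cases)
      then have "inner (\<Sum>l = Suc a..b. \<alpha> l) y = of_int p"
        using inner_positive_root[of "Suc a" b y] ab by simp
      moreover have "(\<Sum>l = Suc a..b. \<alpha> l) \<in> type_A_roots k \<alpha>"
        unfolding type_A_roots_def using ab by (intro UN_I[of "Suc a"] UN_I[of b]) auto
      ultimately show ?thesis unfolding hyperplane_def by blast
    qed
    show "y \<in> (\<Union>\<beta> \<in> type_A_roots k \<alpha>. \<Union>p :: int. hyperplane \<beta> (of_int p))"
    proof (cases "a < b")
      case True
      then show ?thesis using *[of b a] ab by blast
    next
      case False
      have "level y a - level y b \<in> \<int>" using Ints_minus[OF ab(4)] by simp
      then show ?thesis using *[of a b] ab False by simp
    qed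
  qed
  then show ?thesis by blast
qed

definition cell :: "'a \<Rightarrow> 'a set" where
  "cell y = {z \<in> V. regular z \<and>
     (\<forall>i \<le> k. \<forall>j \<le> k. \<lfloor>level z j - level z i\<rfloor> = \<lfloor>level y j - level y i\<rfloor>)}"

text \<open>Regularity turns the floor conditions into strict inequalities, so a cell is the part of
  V in an intersection of open slabs.\<close>

lemma convex_cell:
  assumes "regular y"
  shows "convex (cell y)"
proof -
  define n where "n i j = \<lfloor>level y j - level y i\<rfloor>" for i j
  have cell: "cell y = {z \<in> V. \<forall>i \<le> k. \<forall>j \<le> k. i \<noteq> j \<longrightarrow>
      of_int (n i j) < level z j - level z i \<and> level z j - level z i < of_int (n i j) + 1}"
    (is "_ = ?C")
  proof (intro equalityI subsetI)
    fix z assume z: "z \<in> cell y"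
    have "of_int (n i j) < level z j - level z i \<and> level z j - level z i < of_int (n i j) + 1"
      if "i \<le> k" "j \<le> k" "i \<noteq> j" for i j
    proof -
      have "\<lfloor>level z j - level z i\<rfloor> = n i j" "level z j - level z i \<notin> \<int>"
        using z that by (simp_all add: cell_def n_def regular_def)
      moreover from this have "of_int (n i j) \<noteq> level z j - level z i" by (metis Ints_of_int)
      ultimately show ?thesis by linarith
    qed
    then show "z \<in> ?C" using z by (simp add: cell_def)
  next
    fix z assume z: "z \<in> ?C"
    have fl: "\<lfloor>level z j - level z i\<rfloor> = n i j" if "i \<le> k" "j \<le> k" for i j
    proof (cases "i = j")
      case False
      then have "of_int (n i j) < level z j - level z i" "level z j - level z i < of_int (n i j) + 1"
        using z that by auto
      then show ?thesis by linarith
    qed (simp add: n_def)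
    have "level z j - level z i \<notin> \<int>" if "i \<le> k" "j \<le> k" "i \<noteq> j" for i j
    proof
      assume "level z j - level z i \<in> \<int>"
      then have "level z j - level z i = of_int (n i j)" using fl[of i j] that by (metis Ints_cases floor_of_int)
      then show False using z that by force
    qed
    then show "z \<in> cell y" using z fl by (simp add: cell_def regular_def n_def)
  qed
  show ?thesis unfolding cell
  proof (rule convexI)
    fix x z :: 'a and u v :: real
    assume x: "x \<in> ?C" and z: "z \<in> ?C" and uv: "0 \<le> u" "0 \<le> v" "u + v = 1"
    have "u *\<^sub>R x + v *\<^sub>R z \<in> V" using x z by (auto intro!: subspace_add[OF subspace_V] subspace_scale[OF subspace_V])
    moreover have "of_int (n i j) < level (u *\<^sub>R x + v *\<^sub>R z) j - level (u *\<^sub>R x + v *\<^sub>R z) i \<and>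
        level (u *\<^sub>R x + v *\<^sub>R z) j - level (u *\<^sub>R x + v *\<^sub>R z) i < of_int (n i j) + 1"
      if "i \<le> k" "j \<le> k" "i \<noteq> j" for i j
    proof -
      have "level x j - level x i \<in> {of_int (n i j)<..<of_int (n i j) + 1}"
        "level z j - level z i \<in> {of_int (n i j)<..<of_int (n i j) + 1}"
        using x z that by auto
      then have "u *\<^sub>R (level x j - level x i) + v *\<^sub>R (level z j - level z i)
          \<in> {of_int (n i j)<..<of_int (n i j) + 1}"
        using uv by (intro convexD[OF convex_real_interval(8)]) auto
      then show ?thesis by (simp add: level_add level_scale algebra_simps)
    qed
    ultimately show "u *\<^sub>R x + v *\<^sub>R z \<in> ?C" by blast
  qed
qed

lemma continuous_on_level: "continuous_on S (\<lambda>y. level y j)"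
  unfolding level_def by (intro continuous_intros)

text \<open>On a connected set of regular points a difference of two levels is continuous and omits
  the integers, so its floor is constant. Conversely, cells are convex and hence connected.\<close>

lemma connected_component_regular:
  assumes y: "y \<in> V" "regular y"
  shows "connected_component_set {z \<in> V. regular z} y = cell y"
proof
  show "cell y \<subseteq> connected_component_set {z \<in> V. regular z} y"
    by (rule connected_component_maximal)
      (use y convex_cell[OF y(2)] in \<open>auto simp: cell_def convex_connected\<close>)
  show "connected_component_set {z \<in> V. regular z} y \<subseteq> cell y"
  proof
    fix z assume "z \<in> connected_component_set {z \<in> V. regular z} y"
    then obtain T where T: "connected T" "T \<subseteq> {z \<in> V. regular z}" "y \<in> T" "z \<in> T"
      unfolding connected_component_def by auto
    have "\<lfloor>level z j - level z i\<rfloor> = \<lfloor>level y j - level y i\<rfloor>" if "i \<le> k" "j \<le> k" for i j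
    proof (cases "i = j")
      case False
      define h where "h x = level x j - level x i" for x
      have "connected (h ` T)" unfolding h_def
        by (intro connected_continuous_image T(1) continuous_on_diff continuous_on_level)
      then have int: "is_interval (h ` T)" by (simp add: is_interval_connected_1)
      have nint: "h x \<notin> \<int>" if "x \<in> T" for x
        using T(2) that \<open>i \<le> k\<close> \<open>j \<le> k\<close> False unfolding h_def regular_def by blast
      have le: "\<lfloor>h a\<rfloor> \<ge> \<lfloor>h b\<rfloor>" if "a \<in> T" "b \<in> T" for a b
      proof (rule ccontr)
        assume "\<not> \<lfloor>h a\<rfloor> \<ge> \<lfloor>h b\<rfloor>"
        then have "h a \<le> of_int \<lfloor>h b\<rfloor>" "of_int \<lfloor>h b\<rfloor> \<le> h b" by linarith+
        then have "of_int \<lfloor>h b\<rfloor> \<in> h ` T"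
          using mem_is_interval_1_I[OF int, of "h a" "h b"] that by blast
        then show False using nint by (metis Ints_of_int imageE)
      qed
      show ?thesis using le[OF T(3,4)] le[OF T(4,3)] by (simp add: h_def)
    qed simp
    then show "z \<in> cell y" using T by (auto simp: cell_def)
  qed
qed

lemma alcoves_eq: "alcoves k \<alpha> = cell ` {y \<in> V. regular y}"
  unfolding alcoves_def hyperplane_complement components_def
  by (rule image_cong) (auto simp: connected_component_regular)

definition alc :: "(int \<Rightarrow> int) \<Rightarrow> 'a set" where
  "alc s = {y \<in> V. \<forall>i \<le> k. \<forall>j \<le> k.
     \<lfloor>level y j - level y i\<rfloor> = (s (int j) - s (int i)) div (int k + 1)}"

text \<open>An integral difference would have opposite floors in the two orders, whereas the
  quotients of a non-multiple of k + 1 and of its negative add up to -1.\<close>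

lemma regular_alc:
  assumes s: "distinct_residues k s" and y: "y \<in> alc s"
  shows "regular y"
  unfolding regular_def
proof (intro allI impI notI)
  fix i j assume ij: "i \<le> k" "j \<le> k" "i \<noteq> j" and "level y j - level y i \<in> \<int>"
  then obtain p where p: "level y j - level y i = of_int p" by (auto elim: Ints_cases)
  then have p': "level y i - level y j = of_int (- p)" by simp
  let ?a = "s (int j)" and ?b = "s (int i)"
  have fl: "\<lfloor>level y j - level y i\<rfloor> = (s (int j) - s (int i)) div (int k + 1)"
    if "i \<le> k" "j \<le> k" for i j
    using y that by (simp add: alc_def)
  have "p = (?a - ?b) div (int k + 1)" using fl[OF ij(1,2)] unfolding p by simp
  moreover have "- p = (?b - ?a) div (int k + 1)" using fl[OF ij(2,1)] unfolding p' by simp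
  moreover have "?a mod (int k + 1) \<noteq> ?b mod (int k + 1)"
    using s ij by (auto simp: distinct_residues_def cong_def)
  ultimately show False
    using diff_div_eq[of "int k + 1" ?a ?b] diff_div_eq[of "int k + 1" ?b ?a] by (simp split: if_splits)
qed

lemma alc_eq_cell:
  assumes "distinct_residues k s" "y \<in> alc s"
  shows "alc s = cell y"
  using assms regular_alc[OF assms(1)] by (auto simp: alc_def cell_def)

text \<open>The point with levels (s j - s 0) / (k + 1) lies in \<open>alc s\<close> for every s. It
  shows that \<open>alc s\<close> is nonempty and lets inequalities on the alcove be read off from
  s.\<close>

lemma ex_center:
  "\<exists>y \<in> alc s. \<forall>i \<le> k. \<forall>j \<le> k. level y j - level y i = of_int (s (int j) - s (int i)) / (real k + 1)"
proof -
  obtain y where y: "y \<in> V" "\<And>j. j \<le> k \<Longrightarrow> level y j = of_int (s (int j) - s 0) / (real k + 1)"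
    using ex_level[of "\<lambda>j. of_int (s (int j) - s 0) / (real k + 1)"] by auto
  then have d: "level y j - level y i = of_int (s (int j) - s (int i)) / (real k + 1)"
    if "i \<le> k" "j \<le> k" for i j
    using that by (simp add: diff_divide_distrib[symmetric])
  have "\<lfloor>level y j - level y i\<rfloor> = (s (int j) - s (int i)) div (int k + 1)" if "i \<le> k" "j \<le> k" for i j
    unfolding d[OF that] using floor_divide_of_int_eq[of "s (int j) - s (int i)" "int k + 1", where 'a = real]
    by simp
  then show ?thesis using y(1) d unfolding alc_def by blast
qed

lemma alc_in_alcoves:
  assumes "distinct_residues k s"
  shows "alc s \<in> alcoves k \<alpha>"
proof -
  obtain y where "y \<in> alc s" using ex_center by blast
  then show ?thesis
    using alc_eq_cell[OF assms] regular_alc[OF assms] unfolding alcoves_eq alc_def by blast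
qed

text \<open>Replacing the fractional parts of the levels by their ranks moves a point to the centre of
  its alcove.\<close>
lemma ex_alc_of_alcove:
  assumes "A \<in> alcoves k \<alpha>"
  shows "\<exists>s. distinct_residues k s \<and> A = alc s"
proof -
  obtain y where y: "y \<in> V" "regular y" "A = cell y" using assms unfolding alcoves_eq by blast
  let ?N = "int k + 1"
  define f where "f j = frac (level y j)" for j
  define r where "r j = card {i \<in> {..k}. f i < f j}" for j
  define s where "s x = ?N * \<lfloor>level y (nat x)\<rfloor> + int (r (nat x))" for x
  have r: "r j < k + 1" if "j \<le> k" for j
  proof -
    have "{i \<in> {..k}. f i < f j} \<subset> {..k}" using that by auto
    then have "r j < card {..k}" unfolding r_def by (intro psubset_card_mono) auto
    then show ?thesis by simp
  qed
  have r_less: "r i < r j" if "f i < f j" "i \<le> k" for i j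
    unfolding r_def using that by (intro psubset_card_mono) (auto intro: order.strict_trans)
  have r_iff: "r i < r j \<longleftrightarrow> f i < f j" if "i \<le> k" "j \<le> k" for i j
  proof
    assume "r i < r j"
    moreover have "r i = r j" if "f i = f j" using that by (simp add: r_def)
    ultimately show "f i < f j" using r_less[of j i] \<open>j \<le> k\<close>
      by (cases "f i" "f j" rule: linorder_cases) auto
  qed (rule r_less[OF _ that(1)])
  have quot: "s (int j) div ?N = \<lfloor>level y j\<rfloor>" "s (int j) mod ?N = int (r j)" if "j \<le> k" for j
    using r[OF that] by (simp_all add: s_def div_pos_pos_trivial)
  have f_inj: "i = j" if "f i = f j" "i \<le> k" "j \<le> k" for i j
  proof (rule ccontr)
    assume "i \<noteq> j"
    have "level y j - level y i = of_int (\<lfloor>level y j\<rfloor> - \<lfloor>level y i\<rfloor>)"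
      using that(1) by (simp add: f_def frac_def)
    then have "level y j - level y i \<in> \<int>" by (metis Ints_of_int)
    then show False using y(2) that \<open>i \<noteq> j\<close> unfolding regular_def by blast
  qed
  have s: "distinct_residues k s"
    unfolding distinct_residues_def cong_def
  proof (intro allI impI)
    fix i j assume ij: "i \<le> k" "j \<le> k" "s (int i) mod ?N = s (int j) mod ?N"
    then have "r i = r j" using quot by simp
    then have "f i = f j" using r_iff[of i j] r_iff[of j i] ij by (metis less_irrefl linorder_cases)
    then show "i = j" using f_inj ij by blast
  qed
  have "y \<in> alc s"
    using y(1) r_iff unfolding alc_def
    by (auto simp: floor_diff_eq diff_div_eq quot f_def[symmetric])
  then show ?thesis using s y(3) alc_eq_cell[OF s] by blast
qed

lemma alc_inj:
  assumes s: "distinct_residues k s" and t: "distinct_residues k t" and eq: "alc s = alc t"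
    and j: "j \<le> k"
  shows "s (int j) - s 0 = t (int j) - t 0"
proof -
  obtain y where "y \<in> alc s" "y \<in> alc t" using ex_center[of s] eq by blast
  then show ?thesis using j by (intro quotients_determine_differences[OF s t]) (auto simp: alc_def)
qed

lemma alc_cong:
  assumes "\<And>j. j \<le> k \<Longrightarrow> s (int j) - s 0 = t (int j) - t 0"
  shows "alc s = alc t"
proof -
  have "s (int j) - s (int i) = t (int j) - t (int i)" if "i \<le> k" "j \<le> k" for i j
    using assms[of i] assms[of j] that by linarith
  then show ?thesis unfolding alc_def by auto
qed

lemma inner_minus_alpha0: "inner (- alpha0 k \<alpha>) y = level y k"
  by (simp add: alpha0_def level_def inner_sum_left)

text \<open>From left to right it is enough to test the centre; its weak inequalities become strict
  because the residues are distinct. From right to left the inequalities bound the floors, and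
  thereby every point of the alcove.\<close>

lemma alc_subset_simplex_iff:
  assumes s: "distinct_residues k s"
  shows "alc s \<subseteq> dilated_simplex m k \<alpha> \<longleftrightarrow>
    (\<forall>j < k. s (int j) < s (int j + 1)) \<and> s (int k) < s 0 + int m * (int k + 1)"
    (is "?l \<longleftrightarrow> ?r")
proof
  assume ?l
  obtain y where y: "y \<in> alc s"
    "\<And>i j. i \<le> k \<Longrightarrow> j \<le> k \<Longrightarrow> level y j - level y i = of_int (s (int j) - s (int i)) / (real k + 1)"
    using ex_center by blast
  then have sim: "y \<in> dilated_simplex m k \<alpha>" using \<open>?l\<close> by blast
  have ne: "s (int i) \<noteq> s (int j) + int m * (int k + 1)" if "i \<le> k" "j \<le> k" "i \<noteq> j" for i j m
    using s that by (auto simp: distinct_residues_def cong_def)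
  have "s (int j) < s (int j + 1)" if "j < k" for j
  proof -
    have "inner (\<alpha> (Suc j)) y \<ge> 0" using sim that by (simp add: dilated_simplex_def)
    then have "level y (Suc j) - level y j \<ge> 0" by (simp add: level_Suc)
    then have "s (int j) \<le> s (int (Suc j))" using y(2)[of j "Suc j"] that by (simp add: zero_le_divide_iff)
    then show ?thesis using ne[of j "Suc j" 0] that by (simp add: add.commute)
  qed
  moreover have "s (int k) < s 0 + int m * (int k + 1)"
  proof -
    have "level y k \<le> real m" using sim unfolding dilated_simplex_def inner_minus_alpha0 by simp
    then have "of_int (s (int k) - s 0) / (real k + 1) \<le> real m" using y(2)[of 0 k] by simp
    then have "of_int (s (int k) - s 0) \<le> real m * (real k + 1)" by (simp add: divide_le_eq)
    then have "real_of_int (s (int k) - s 0) \<le> real_of_int (int m * (int k + 1))" by simp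
    then have "s (int k) - s 0 \<le> int m * (int k + 1)" by (simp only: of_int_le_iff)
    then show ?thesis using ne[of k 0 m] k by simp
  qed
  ultimately show ?r by blast
next
  assume r: ?r
  show ?l
  proof
    fix y assume y: "y \<in> alc s"
    then have fl: "\<lfloor>level y j - level y i\<rfloor> = (s (int j) - s (int i)) div (int k + 1)" if "i \<le> k" "j \<le> k" for i j
      using that by (simp add: alc_def)
    have "inner (\<alpha> i) y \<ge> 0" if i: "i \<in> {1..k}" for i
    proof -
      have "i - 1 < k" using i by auto
      then have "s (int (i - 1)) < s (int (i - 1) + 1)" using r by blast
      then have "s (int (i - 1)) < s (int i)" using i by (simp add: of_nat_diff)
      then have "0 \<le> \<lfloor>level y i - level y (i - 1)\<rfloor>" 
        using fl[of "i - 1" i] i by (auto simp: pos_imp_zdiv_nonneg_iff simp del: zero_le_floor)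
      then show ?thesis using i by (simp add: inner_root_level)
    qed
    moreover have "level y k \<le> real m"
    proof -
      have "(s (int k) - s 0) div (int k + 1) < int m"
      proof (rule ccontr)
        assume "\<not> ?thesis"
        then have "int m * (int k + 1) \<le> ((s (int k) - s 0) div (int k + 1)) * (int k + 1)"
          by (intro mult_right_mono) auto
        moreover have "\<dots> \<le> s (int k) - s 0"
          using mult_div_mod_eq[of "int k + 1" "s (int k) - s 0"] pos_mod_sign[of "int k + 1"]
          by (simp add: minus_mod_eq_div_mult[symmetric])
        ultimately show False using r by linarith
      qed
      then have "\<lfloor>level y k\<rfloor> < int m" using fl[of 0 k] by simp
      then show ?thesis by linarith
    qed
    ultimately show "y \<in> dilated_simplex m k \<alpha>"
      using y by (simp only: dilated_simplex_def inner_minus_alpha0) (simp add: alc_def)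
  qed
qed

end

section \<open>Rotation of the dilated simplex\<close>

lemma gapseq_distinct_residues:
  assumes "s \<in> gapseq m (k + 1)"
  shows "distinct_residues k s"
  unfolding distinct_residues_def
proof (intro allI impI)
  fix i j assume ij: "i \<le> k" "j \<le> k" "[s (int i) = s (int j)] (mod (int k + 1))"
  then have "[s (int i) = s (int j)] (mod int (k + 1))" by (simp add: add.commute)
  then have "[int i = int j] (mod int (k + 1))" by (rule gapseqD[OF assms])
  then show "i = j" using ij by (simp add: cong_def)
qed

lemma int_window_cases:
  obtains j q where "j \<le> k" "i = int j + (int k + 1) * q"
proof
  show "nat (i mod (int k + 1)) \<le> k" using pos_mod_bound[of "int k + 1" i] by linarith
  show "i = int (nat (i mod (int k + 1))) + (int k + 1) * (i div (int k + 1))" by simp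
qed

context type_A
begin

text \<open>An increasing window whose last value stays below s 0 + m n is the same as a strictly
  increasing continuation with growth m n per period.\<close>

lemma bij_alc:
  assumes m: "m > 0"
  shows "bij_betw alc (gapseq m (k + 1)) (simplex_alcoves m k \<alpha>)"
  unfolding bij_betw_def
proof
  let ?N = "int k + 1"
  have per: "s (int j + ?N * q) = s (int j) + int m * ?N * q" if "s \<in> gapseq m (k + 1)" for s j q
    using gapseqD(4)[OF that, of "int j" q] by (simp add: algebra_simps)
  show "inj_on alc (gapseq m (k + 1))"
  proof (rule inj_onI)
    fix s t assume st: "s \<in> gapseq m (k + 1)" "t \<in> gapseq m (k + 1)" "alc s = alc t"
    show "s = t"
    proof
      fix i
      obtain j q where j: "j \<le> k" "i = int j + ?N * q" by (rule int_window_cases)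
      have "s (int j) = t (int j)"
        using alc_inj[OF gapseq_distinct_residues[OF st(1)] gapseq_distinct_residues[OF st(2)] st(3) j(1)]
          gapseqD(2)[OF st(1)] gapseqD(2)[OF st(2)] by simp
      then show "s i = t i" unfolding j(2) by (simp only: per[OF st(1)] per[OF st(2)])
    qed
  qed
  show "alc ` gapseq m (k + 1) = simplex_alcoves m k \<alpha>"
  proof (intro equalityI subsetI)
    fix A assume "A \<in> alc ` gapseq m (k + 1)"
    then obtain s where s: "s \<in> gapseq m (k + 1)" "A = alc s" by blast
    note S = gapseqD[OF s(1)]
    have "s (int k) < s (0 + int (k + 1))" by (rule strict_monoD[OF S(1)]) simp
    then have "s (int k) < s 0 + int m * ?N" using S(3)[of 0] by (simp add: algebra_simps)
    moreover have "s (int j) < s (int j + 1)" for j by (rule strict_monoD[OF S(1)]) simp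
    ultimately have "A \<subseteq> dilated_simplex m k \<alpha>"
      using alc_subset_simplex_iff[OF gapseq_distinct_residues[OF s(1)]] s(2) by simp
    then show "A \<in> simplex_alcoves m k \<alpha>"
      using alc_in_alcoves[OF gapseq_distinct_residues[OF s(1)]] s(2) by (simp add: simplex_alcoves_def)
  next
    fix A assume A: "A \<in> simplex_alcoves m k \<alpha>"
    then obtain s where s: "distinct_residues k s" "A = alc s"
      using ex_alc_of_alcove unfolding simplex_alcoves_def by blast
    have "alc s \<subseteq> dilated_simplex m k \<alpha>" using A s by (simp add: simplex_alcoves_def)
    then have win: "\<And>j. j < k \<Longrightarrow> s (int j) < s (int j + 1)" "s (int k) < s 0 + int m * ?N"
      unfolding alc_subset_simplex_iff[OF s(1)] by blast+
    \<comment> \<open>An alcove fixes the window only up to an additive constant, so the value at 0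
      is normalized before the window is continued.\<close>
    define t where "t i = s (i mod ?N) - s 0 + int m * ?N * (i div ?N)" for i
    have t: "t (int j) = s (int j) - s 0" if "j \<le> k" for j using that by (simp add: t_def)
    have tper: "t (i + ?N * q) = t i + int m * ?N * q" for i q
    proof -
      have "(i + ?N * q) mod ?N = i mod ?N" "(i + ?N * q) div ?N = i div ?N + q"
        by (rule mod_mult_self2, subst div_mult_self2) simp_all
      then show ?thesis unfolding t_def by (simp only: distrib_left)
    qed
    have step: "t (int j) < t (int j + 1)" if "j \<le> k" for j
    proof (cases "j < k")
      case True
      then show ?thesis using win(1)[of j] t[of j] t[of "Suc j"] by (simp add: add.commute)
    next
      case False
      then have "j = k" using that by simp
      then show ?thesis using win(2) t[of k] t[of 0] tper[of 0 1] by (simp add: add.commute)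
    qed
    have "strict_mono t"
    proof (rule strict_mono_int_step)
      fix i
      obtain j q where j: "j \<le> k" "i = int j + ?N * q" by (rule int_window_cases)
      have i: "i + 1 = int j + 1 + ?N * q" using j by simp
      show "t i < t (i + 1)" unfolding i unfolding j(2) tper using step[OF j(1)] by simp
    qed
    moreover have "t 0 = 0" using t[of 0] by simp
    moreover have "t (i + int (k + 1)) = t i + int m * int (k + 1)" for i
      using tper[of i 1] by (simp add: add.commute)
    moreover have "[i = j] (mod int (k + 1))" if "[t i = t j] (mod int (k + 1))" for i j
    proof -
      obtain a p where a: "a \<le> k" "i = int a + ?N * p" by (rule int_window_cases)
      obtain b q where b: "b \<le> k" "j = int b + ?N * q" by (rule int_window_cases)
      have "[t i = t j] (mod ?N)" using that by (simp add: add.commute)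
      then have "?N dvd (s (int a) - s (int b)) + ?N * (int m * p - int m * q)"
        unfolding a b tper t[OF a(1)] t[OF b(1)] cong_iff_dvd_diff by (simp add: algebra_simps)
      then have "?N dvd s (int a) - s (int b)" by (metis dvd_add_left_iff dvd_triv_left)
      then have "a = b" using s(1) a b unfolding distinct_residues_def cong_iff_dvd_diff by blast
      then have "i - j = ?N * (p - q)" using a b by (simp add: algebra_simps)
      then have "?N dvd i - j" by simp
      then show ?thesis by (simp add: cong_iff_dvd_diff add.commute)
    qed
    ultimately have "t \<in> gapseq m (k + 1)" unfolding gapseq_def by blast
    moreover have "alc t = alc s" by (rule alc_cong) (use t t[of 0] in simp)
    ultimately show "A \<in> alc ` gapseq m (k + 1)" using s(2) by blast
  qed
qed

text \<open>The levels continued to all integer positions, so that rotating a dilated simplex and the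
  affine reflections become index shifts and transpositions.\<close>
definition height :: "nat \<Rightarrow> 'a \<Rightarrow> int \<Rightarrow> real" where
  "height c y i = level y (nat (i mod (int k + 1))) + real c * of_int (i div (int k + 1))"

lemma height_window: "j \<le> k \<Longrightarrow> height c y (int j) = level y j"
  by (simp add: height_def)

lemma height_period: "height c y (i + (int k + 1) * q) = height c y i + real c * of_int q"
proof -
  have "(i + (int k + 1) * q) mod (int k + 1) = i mod (int k + 1)"
    "(i + (int k + 1) * q) div (int k + 1) = i div (int k + 1) + q"
    by (rule mod_mult_self2, subst div_mult_self2) simp_all
  then show ?thesis by (simp add: height_def algebra_simps)
qed

lemma height_minus_1: "height c y (- 1) = level y k - real c"
  using height_period[of c y "int k" "- 1"] height_window[of k c y] by simp

text \<open>Moving an index by a period changes both sides by the same integer, so the conditions on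
  the window imply all others. Quantified over all integers, they survive any change of the indices.
  The growth c is m for the rotation and 1 for the affine reflections.\<close>

lemma alc_height_iff:
  assumes "\<And>i q. s (i + (int k + 1) * q) = s i + int c * (int k + 1) * q" "y \<in> V"
  shows "y \<in> alc s \<longleftrightarrow>
    (\<forall>i j. \<lfloor>height c y j - height c y i\<rfloor> = (s j - s i) div (int k + 1))"
proof
  assume y: "y \<in> alc s"
  show "\<forall>i j. \<lfloor>height c y j - height c y i\<rfloor> = (s j - s i) div (int k + 1)"
  proof (intro allI)
    fix i j
    obtain a p where a: "a \<le> k" "i = int a + (int k + 1) * p" by (rule int_window_cases)
    obtain b q where b: "b \<le> k" "j = int b + (int k + 1) * q" by (rule int_window_cases)
    have "height c y j - height c y i = level y b - level y a + of_int (int c * (q - p))"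
      unfolding a b height_period height_window[OF a(1)] height_window[OF b(1)]
      by (simp add: algebra_simps)
    moreover have "\<lfloor>level y b - level y a\<rfloor> = (s (int b) - s (int a)) div (int k + 1)"
      using y a b by (simp add: alc_def)
    moreover have "s j - s i = s (int b) - s (int a) + (int k + 1) * (int c * (q - p))"
      unfolding a b assms(1) by (simp add: algebra_simps)
    ultimately show "\<lfloor>height c y j - height c y i\<rfloor> = (s j - s i) div (int k + 1)"
      by (simp only: floor_add_int[symmetric] div_mult_self2)
  qed
next
  assume *: "\<forall>i j. \<lfloor>height c y j - height c y i\<rfloor> = (s j - s i) div (int k + 1)"
  have "\<lfloor>level y j - level y i\<rfloor> = (s (int j) - s (int i)) div (int k + 1)" if "i \<le> k" "j \<le> k" for i j
    using *[rule_format, of "int j" "int i"] that by (simp add: height_window)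
  then show "y \<in> alc s" using assms(2) by (simp add: alc_def)
qed

lemma height_affine:
  "height c ((1 - t) *\<^sub>R x + t *\<^sub>R y) i = (1 - t) * height c x i + t * height c y i"
  unfolding height_def level_add level_scale by (simp add: algebra_simps)

lemma height_eqI_window:
  assumes "\<And>j. j \<le> k \<Longrightarrow> level z j = g (int j)"
    and "\<And>i q. g (i + (int k + 1) * q) = g i + real c * of_int q"
  shows "height c z i = g i"
proof -
  obtain a p where a: "a \<le> k" "i = int a + (int k + 1) * p" by (rule int_window_cases)
  show ?thesis unfolding a(2) height_period assms(2) height_window[OF a(1)] by (simp add: assms(1)[OF a(1)])
qed

text \<open>The candidate for \<open>rho\<close>: indices go down by one, and subtracting the height
  at -1 makes level 0 vanish again. By \<open>level_eqI\<close> only one point of V has these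
  levels.\<close>

definition rotate_simplex :: "nat \<Rightarrow> 'a \<Rightarrow> 'a" where
  "rotate_simplex m y =
     (SOME z. z \<in> V \<and> (\<forall>j \<le> k. level z j = height m y (int j - 1) - height m y (- 1)))"

lemma rotate_simplex:
  "rotate_simplex m y \<in> V"
  "j \<le> k \<Longrightarrow> level (rotate_simplex m y) j = height m y (int j - 1) - height m y (- 1)"
proof -
  have "\<exists>z. z \<in> V \<and> (\<forall>j \<le> k. level z j = height m y (int j - 1) - height m y (- 1))"
    using ex_level[of "\<lambda>j. height m y (int j - 1) - height m y (- 1)"] by auto
  from someI_ex[OF this] show "rotate_simplex m y \<in> V"
    "j \<le> k \<Longrightarrow> level (rotate_simplex m y) j = height m y (int j - 1) - height m y (- 1)"
    by (auto simp: rotate_simplex_def)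
qed

lemma simplex_vertex:
  assumes "i \<le> k"
  shows "simplex_vertex m k \<alpha> i \<in> V"
    "j \<le> k \<Longrightarrow> level (simplex_vertex m k \<alpha> i) j = (if 1 \<le> i \<and> i \<le> j then real m else 0)"
proof -
  have "simplex_vertex m k \<alpha> i \<in> V \<and>
    (\<forall>j \<le> k. level (simplex_vertex m k \<alpha> i) j = (if 1 \<le> i \<and> i \<le> j then real m else 0))"
  proof (cases "i = 0")
    case True
    have "level 0 j = 0" for j by (simp add: level_def)
    then show ?thesis using True subspace_0[OF subspace_V] by (simp add: simplex_vertex_def)
  next
    case False
    let ?P = "\<lambda>v. v \<in> V \<and> (\<forall>j \<in> {1..k}. inner (\<alpha> j) v = (if i = j then real m else 0))"
    obtain v where v: "v \<in> V" "\<And>j. j \<le> k \<Longrightarrow> level v j = (if 1 \<le> i \<and> i \<le> j then real m else 0)"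
      using ex_level[of "\<lambda>j. if 1 \<le> i \<and> i \<le> j then real m else 0"] False by auto
    have "inner (\<alpha> j) v = (if i = j then real m else 0)" if "j \<in> {1..k}" for j
      using that v(2)[of j] v(2)[of "j - 1"] False by (auto simp: inner_root_level)
    then have "?P v" using v(1) by blast
    moreover have "w = v" if "?P w" for w
      using that \<open>?P v\<close> by (intro root_space_eqI) auto
    ultimately have "(THE v. ?P v) = v" by (rule the_equality)
    then show ?thesis using False v by (simp add: simplex_vertex_def)
  qed
  then show "simplex_vertex m k \<alpha> i \<in> V"
    "j \<le> k \<Longrightarrow> level (simplex_vertex m k \<alpha> i) j = (if 1 \<le> i \<and> i \<le> j then real m else 0)" by auto
qed

lemma rotate_simplex_affine: "affine_map_on V (rotate_simplex m)"
  unfolding affine_map_on_def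
proof (intro conjI ballI allI)
  show "rotate_simplex m \<in> V \<rightarrow> V" using rotate_simplex(1) by auto
  fix x y :: 'a and t :: real
  let ?R = "rotate_simplex m"
  show "?R ((1 - t) *\<^sub>R x + t *\<^sub>R y) = (1 - t) *\<^sub>R ?R x + t *\<^sub>R ?R y"
  proof (rule level_eqI)
    show "(1 - t) *\<^sub>R ?R x + t *\<^sub>R ?R y \<in> V"
      by (intro subspace_add[OF subspace_V] subspace_scale[OF subspace_V] rotate_simplex)
    show "level (?R ((1 - t) *\<^sub>R x + t *\<^sub>R y)) j = level ((1 - t) *\<^sub>R ?R x + t *\<^sub>R ?R y) j"
      if "j \<le> k" for j
      unfolding rotate_simplex(2)[OF that] height_affine level_add level_scale by (simp add: algebra_simps)
  qed (rule rotate_simplex)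
qed

text \<open>The heights of the vertex jump by m at the index i and its translates by k + 1. The
  rotation moves the jump to i + 1; for i = k it leaves the window, and the vertex 0
  remains.\<close>

lemma rotate_simplex_vertex:
  assumes i: "i \<le> k"
  shows "rotate_simplex m (simplex_vertex m k \<alpha> i) = simplex_vertex m k \<alpha> ((i + 1) mod (k + 1))"
proof (rule level_eqI)
  have i': "(i + 1) mod (k + 1) \<le> k" by (simp add: less_Suc_eq_le[symmetric])
  show "simplex_vertex m k \<alpha> ((i + 1) mod (k + 1)) \<in> V" by (rule simplex_vertex[OF i'])
  fix j assume j: "j \<le> k"
  let ?v = "simplex_vertex m k \<alpha> i"
  show "level (rotate_simplex m ?v) j = level (simplex_vertex m k \<alpha> ((i + 1) mod (k + 1))) j"
  proof (cases "j = 0")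
    case False
    then have "height m ?v (int j - 1) = level ?v (j - 1)"
      using height_window[of "j - 1" m ?v] j by (simp add: of_nat_diff)
    then have "level (rotate_simplex m ?v) j = level ?v (j - 1) - (level ?v k - real m)"
      using rotate_simplex(2)[OF j] by (simp add: height_minus_1)
    then show ?thesis using i j False simplex_vertex(2)[OF i] simplex_vertex(2)[OF i' j]
      by (cases "i = k") auto
  qed simp
qed (rule rotate_simplex)

text \<open>The set where the maps agree contains 0 and is closed under affine combinations, so it
  is a subspace; for m > 0 the other vertices span V.\<close>

lemma affine_map_on_vertices_unique:
  assumes f: "affine_map_on V f" and g: "affine_map_on V g" and m: "m > 0"
    and eq: "\<And>i. i \<le> k \<Longrightarrow> f (simplex_vertex m k \<alpha> i) = g (simplex_vertex m k \<alpha> i)"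
    and y: "y \<in> V"
  shows "f y = g y"
proof -
  define E where "E = {x \<in> V. f x = g x}"
  have "0 \<in> E" using eq[of 0] subspace_0[OF subspace_V] by (simp add: E_def simplex_vertex_def)
  have comb: "(1 - t) *\<^sub>R x + t *\<^sub>R z \<in> E" if "x \<in> E" "z \<in> E" for x z t
  proof -
    have "(1 - t) *\<^sub>R x + t *\<^sub>R z \<in> V" using that
      by (intro subspace_add[OF subspace_V] subspace_scale[OF subspace_V]) (auto simp: E_def)
    then show ?thesis using that f g unfolding affine_map_on_def E_def by simp
  qed
  have scale: "t *\<^sub>R x \<in> E" if "x \<in> E" for x t using comb[OF \<open>0 \<in> E\<close> that, of t] by simp
  \<comment> \<open>A sum is the midpoint of the doubled points.\<close>
  have add: "x + z \<in> E" if "x \<in> E" "z \<in> E" for x z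
    using comb[OF scale[OF that(1), of 2] scale[OF that(2), of 2], of "1/2"] by simp
  have sub: "subspace E" unfolding subspace_def using \<open>0 \<in> E\<close> scale add by blast
  define w where "w = (\<Sum>l = 1..k. (inner (\<alpha> l) y / real m) *\<^sub>R simplex_vertex m k \<alpha> l)"
  have "w \<in> E" unfolding w_def
    by (intro subspace_sum[OF sub] subspace_scale[OF sub]) (simp add: E_def eq simplex_vertex)
  moreover have "w = y"
  proof (rule root_space_eqI)
    show "w \<in> V" using \<open>w \<in> E\<close> by (simp add: E_def)
    fix l assume l: "l \<in> {1..k}"
    have v: "inner (\<alpha> l) (simplex_vertex m k \<alpha> i) = (if i = l then real m else 0)" if "i \<in> {1..k}" for i
      using that l simplex_vertex(2)[of i l m] simplex_vertex(2)[of i "l - 1" m] by (auto simp: inner_root_level)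
    have "inner (\<alpha> l) w = (\<Sum>i = 1..k. inner (\<alpha> i) y / real m * (if i = l then real m else 0))"
      unfolding w_def inner_sum_right inner_scaleR_right by (rule sum.cong[OF refl]) (simp only: v)
    also have "\<dots> = inner (\<alpha> l) y"
      using l m by (simp add: if_distrib[of "\<lambda>x. _ * x"] cong: if_cong)
    finally show "inner (\<alpha> l) w = inner (\<alpha> l) y" .
  qed (rule y)
  ultimately show ?thesis by (simp add: E_def)
qed

lemma rho_eq:
  assumes m: "m > 0"
  shows "rho m k \<alpha> = restrict (rotate_simplex m) V"
  unfolding rho_def
proof (rule the_equality)
  have aff: "affine_map_on V (restrict (rotate_simplex m) V)"
    using rotate_simplex_affine[of m] subspace_V
    unfolding affine_map_on_def by (auto simp: subspace_add subspace_scale)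
  then show "restrict (rotate_simplex m) V \<in> extensional V \<and> affine_map_on V (restrict (rotate_simplex m) V) \<and>
      (\<forall>i \<le> k. restrict (rotate_simplex m) V (simplex_vertex m k \<alpha> i) = simplex_vertex m k \<alpha> ((i + 1) mod (k + 1)))"
    by (simp add: simplex_vertex rotate_simplex_vertex)
  fix f
  assume f: "f \<in> extensional V \<and> affine_map_on V f \<and>
      (\<forall>i \<le> k. f (simplex_vertex m k \<alpha> i) = simplex_vertex m k \<alpha> ((i + 1) mod (k + 1)))"
  show "f = restrict (rotate_simplex m) V"
  proof (rule extensionalityI)
    fix x assume x: "x \<in> V"
    show "f x = restrict (rotate_simplex m) V x"
      by (rule affine_map_on_vertices_unique[where f = f, OF _ aff m])
        (use f x in \<open>simp_all add: simplex_vertex rotate_simplex_vertex\<close>)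
  qed (use f in auto)
qed

lemma rho:
  assumes m: "m > 0" and y: "y \<in> V"
  shows "rho m k \<alpha> y \<in> V" "height m (rho m k \<alpha> y) i = height m y (i - 1) - height m y (- 1)"
proof -
  have eq: "rho m k \<alpha> y = rotate_simplex m y" using y by (simp add: rho_eq[OF m])
  show "rho m k \<alpha> y \<in> V" unfolding eq by (rule rotate_simplex)
  show "height m (rho m k \<alpha> y) i = height m y (i - 1) - height m y (- 1)"
    unfolding eq
  proof (rule height_eqI_window)
    show "height m y (i + (int k + 1) * q - 1) - height m y (- 1) =
        height m y (i - 1) - height m y (- 1) + real m * of_int q" for i q
      using height_period[of m y "i - 1" q] by (simp add: algebra_simps)
  qed (rule rotate_simplex)
qed

text \<open>The rotation lowers the indices of the heights by one, which is the shift of s by -1.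
  For the reverse inclusion, a preimage is built from the heights with indices raised by
  one.\<close>

lemma rho_alc:
  assumes m: "m > 0" and s: "s \<in> gapseq m (k + 1)"
  shows "rho m k \<alpha> ` alc s = alc (shift (- 1) s)"
proof -
  have per: "s (i + (int k + 1) * q) = s i + int m * (int k + 1) * q" if "s \<in> gapseq m (k + 1)" for s i q
    using gapseqD(4)[OF that, of i q] by (simp add: algebra_simps)
  note iff = alc_height_iff[OF per[OF s]] alc_height_iff[OF per[OF shift_in_gapseq[OF s]]]
  show ?thesis
  proof (intro equalityI subsetI)
    fix z assume "z \<in> rho m k \<alpha> ` alc s"
    then obtain y where y: "y \<in> alc s" "z = rho m k \<alpha> y" by blast
    then have yV: "y \<in> V" by (simp add: alc_def)
    show "z \<in> alc (shift (- 1) s)"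
      unfolding y iff(2)[OF rho(1)[OF m yV]] rho(2)[OF m yV]
      using y(1) unfolding iff(1)[OF yV] by (simp add: shift_def)
  next
    fix z assume z: "z \<in> alc (shift (- 1) s)"
    then have zV: "z \<in> V" by (simp add: alc_def)
    obtain y where y: "y \<in> V" "\<And>j. j \<le> k \<Longrightarrow> level y j = height m z (int j + 1) - height m z 1"
      using ex_level[of "\<lambda>j. height m z (int j + 1) - height m z 1"] by auto
    have h: "height m y i = height m z (i + 1) - height m z 1" for i
    proof (rule height_eqI_window[OF y(2)])
      show "height m z (i + (int k + 1) * q + 1) - height m z 1 =
          height m z (i + 1) - height m z 1 + real m * of_int q" for i q
        using height_period[of m z "i + 1" q] by (simp add: algebra_simps)
    qed
    have "rho m k \<alpha> y = z"
    proof (rule level_eqI[OF rho(1)[OF m y(1)] zV])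
      fix j assume j: "j \<le> k"
      have "height m (rho m k \<alpha> y) (int j) = height m z (int j) - height m z 0"
        unfolding rho(2)[OF m y(1)] h by simp
      then show "level (rho m k \<alpha> y) j = level z j"
        using height_window[OF j] height_window[of 0 m z] by simp
    qed
    moreover have "y \<in> alc s"
    proof -
      have "\<lfloor>height m y j - height m y i\<rfloor> = (s j - s i) div (int k + 1)" for i j
        using z[unfolded iff(2)[OF zV], rule_format, of "j + 1" "i + 1"] by (simp add: h shift_def)
      then show ?thesis unfolding iff(1)[OF y(1)] by blast
    qed
    ultimately show "z \<in> rho m k \<alpha> ` alc s" by blast
  qed
qed

lemma cyclic_sieving_simplex_alcoves:
  assumes "m > 0"
  shows "cyclic_sieving_by (k + 1) (simplex_alcoves m k \<alpha>) (W_poly m k) (\<lambda>A. rho m k \<alpha> ` A)"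
  by (rule cyclic_sieving_by_shift[OF assms bij_alc[OF assms] rho_alc[OF assms]]) simp_all

end

section \<open>Affine permutations\<close>

text \<open>The simple reflection s_i of the affine symmetric group acting on the integers: i - 1
  and i are exchanged, and likewise all their translates by multiples of k + 1.\<close>

definition aff_swap :: "nat \<Rightarrow> nat \<Rightarrow> int \<Rightarrow> int" where
  "aff_swap k i j = (if int k + 1 dvd j - int i then j - 1
     else if int k + 1 dvd j - int i + 1 then j + 1 else j)"

lemma aff_swap_period: "aff_swap k i (j + (int k + 1) * q) = aff_swap k i j + (int k + 1) * q"
proof -
  have "j + (int k + 1) * q - int i = (j - int i) + (int k + 1) * q" by simp
  then have "int k + 1 dvd j + (int k + 1) * q - int i \<longleftrightarrow> int k + 1 dvd j - int i"
    by (metis dvd_add_left_iff dvd_triv_left)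
  moreover have "j + (int k + 1) * q - int i + 1 = (j - int i + 1) + (int k + 1) * q" by simp
  then have "int k + 1 dvd j + (int k + 1) * q - int i + 1 \<longleftrightarrow> int k + 1 dvd j - int i + 1"
    by (metis dvd_add_left_iff dvd_triv_left)
  ultimately show ?thesis by (simp add: aff_swap_def)
qed

text \<open>The period is at least 2, so the two moving cases of \<open>aff_swap\<close> do not
  overlap.\<close>

lemma not_both_residues:
  assumes "k \<ge> 1" "int k + 1 dvd a"
  shows "\<not> int k + 1 dvd a + 1" "\<not> int k + 1 dvd a - 1"
proof -
  have "\<not> int k + 1 dvd 1" using assms(1) by simp
  then show "\<not> int k + 1 dvd a + 1" "\<not> int k + 1 dvd a - 1"
    using assms(2) by (metis dvd_add_right_iff, metis dvd_diff_right_iff)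
qed

lemma aff_swap_invol:
  assumes "k \<ge> 1"
  shows "aff_swap k i (aff_swap k i j) = j"
proof -
  consider "int k + 1 dvd j - int i" | "int k + 1 dvd j - int i + 1" "\<not> int k + 1 dvd j - int i"
    | "\<not> int k + 1 dvd j - int i" "\<not> int k + 1 dvd j - int i + 1" by blast
  then show ?thesis
  proof cases
    case 1
    have e: "j - 1 - int i = j - int i - 1" by simp
    show ?thesis using 1 not_both_residues(2)[OF assms 1] by (simp add: aff_swap_def e)
  next
    case 2
    have e: "j + 1 - int i = j - int i + 1" by simp
    show ?thesis using 2 by (simp add: aff_swap_def e)
  qed (simp add: aff_swap_def)
qed

text \<open>No integer moves by more than one and the map is injective, so the order can be reversed
  only for two neighbours that are exchanged.\<close>

lemma aff_swap_less:
  assumes k: "k \<ge> 1" and xy: "x < y" "\<not> (int k + 1 dvd x - int i + 1 \<and> y = x + 1)"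
  shows "aff_swap k i x < aff_swap k i y"
proof -
  have "aff_swap k i x \<noteq> aff_swap k i y" using xy(1) aff_swap_invol[OF k, of i] by (metis less_irrefl)
  moreover have "aff_swap k i x \<le> aff_swap k i y"
  proof (cases "int k + 1 dvd x - int i + 1")
    case x: True
    then have "y \<noteq> x + 1" using xy(2) by blast
    then show ?thesis using xy(1) by (auto simp: aff_swap_def)
  next
    case False
    then have "aff_swap k i x \<le> x" by (simp add: aff_swap_def)
    then show ?thesis using xy(1) by (auto simp: aff_swap_def)
  qed
  ultimately show ?thesis by simp
qed

lemma dvd_small_iff:
  fixes d n :: int
  assumes "\<bar>d\<bar> < n"
  shows "n dvd d \<longleftrightarrow> d = 0"
  using assms dvd_imp_le_int[of d n] by auto

lemma aff_swap_window_pos: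
  assumes "1 \<le> i" "i \<le> k" "j \<le> k"
  shows "aff_swap k i (int j) = (if j = i then int (i - 1) else if j = i - 1 then int i else int j)"
proof -
  have "int k + 1 dvd int j - int i \<longleftrightarrow> j = i"
    using assms by (subst dvd_small_iff) auto
  moreover have "int k + 1 dvd int j - int i + 1 \<longleftrightarrow> j = i - 1"
    using assms by (subst dvd_small_iff) auto
  ultimately show ?thesis using assms by (auto simp: aff_swap_def of_nat_diff)
qed

lemma aff_swap_window_0:
  assumes "k \<ge> 1" "j \<le> k"
  shows "aff_swap k 0 (int j) = (if j = 0 then - 1 else if j = k then int k + 1 else int j)"
proof -
  have "int k + 1 dvd int j \<longleftrightarrow> j = 0"
    using assms by (subst dvd_small_iff) auto
  moreover have "int k + 1 dvd int j + 1 \<longleftrightarrow> j = k"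
  proof
    assume "int k + 1 dvd int j + 1"
    then have "int k + 1 \<le> int j + 1" by (rule zdvd_imp_le) simp
    then show "j = k" using assms by simp
  qed simp
  ultimately show ?thesis using assms by (auto simp: aff_swap_def)
qed

context type_A
begin

lemma level_root:
  assumes i: "i \<in> {1..k}" and j: "j \<le> k"
  shows "level (\<alpha> i) j = (if j = i then 1 else 0) - (if j = i - 1 then 1 else 0) + (if i = 1 then 1 else 0)"
  using j
proof (induction j)
  case (Suc j)
  then show ?case using i inner_roots[of "Suc j" i] by (auto simp: level_Suc)
qed (use i in auto)

text \<open>The highest root pairs to 1 with each end of the Dynkin diagram. The two contributions
  are kept as separate terms because they add up to 2 when k = 1.\<close>

lemma level_highest_root:
  assumes j: "j \<le> k"
  shows "level (- alpha0 k \<alpha>) j = 1 - (if j = 0 then 1 else 0) + (if j = k then 1 else 0)"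
proof -
  define c :: "nat \<Rightarrow> real" where "c j = (if 1 \<le> j \<and> j \<le> k then 1 else 0)" for j
  have "- alpha0 k \<alpha> = (\<Sum>j = 1..k. c j *\<^sub>R \<alpha> j)"
    by (simp add: alpha0_def c_def)
  then have "inner (\<alpha> l) (- alpha0 k \<alpha>) = 2 * c l - c (l - 1) - c (l + 1)" if "l \<in> {1..k}" for l
    using inner_root_sum[of c l] that by (simp add: c_def)
  then have inner: "inner (\<alpha> l) (- alpha0 k \<alpha>) = (if l = 1 then 1 else 0) + (if l = k then 1 else 0)"
    if "l \<in> {1..k}" for l using that by (auto simp: c_def)
  show ?thesis using j
  proof (induction j)
    case (Suc j)
    then show ?case using inner[of "Suc j"] k by (auto simp: level_Suc)
  qed (use k in simp)
qed

lemma level_diff_scale: "level (y - r *\<^sub>R z) j = level y j - r * level z j"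
  using level_add[of y "- r *\<^sub>R z" j] level_scale[of "- r" z j] by simp

lemma generator_in_V:
  assumes "i \<le> k" "y \<in> V"
  shows "affine_generator k \<alpha> i y \<in> V"
proof -
  have "alpha0 k \<alpha> \<in> V" unfolding alpha0_def
    by (intro subspace_neg[OF subspace_V] subspace_sum[OF subspace_V] root_in_V)
  then have neg: "- alpha0 k \<alpha> \<in> V" by (rule subspace_neg[OF subspace_V])
  have refl: "reflection v p y \<in> V" if "v \<in> V" for v p
    unfolding reflection_def
    by (intro subspace_diff[OF subspace_V] subspace_scale[OF subspace_V] assms(2) that)
  show ?thesis
  proof (cases "i = 0")
    case True
    then show ?thesis using refl[OF neg] by (simp add: affine_generator_def)
  next
    case False
    then show ?thesis using refl[OF root_in_V[of i]] assms(1) by (simp add: affine_generator_def)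
  qed
qed

text \<open>A simple reflection exchanges two neighbouring levels. The affine one does so across the
  end of the window, where the growth 1 per period supplies the constant of the affine hyperplane.
  The subtracted term restores level 0, which is moved for i = 0 and i = 1.\<close>

lemma level_generator:
  assumes i: "i \<le> k" and j: "j \<le> k"
  shows "level (affine_generator k \<alpha> i y) j = height 1 y (aff_swap k i (int j)) - height 1 y (aff_swap k i 0)"
proof (cases "i = 0")
  case True
  let ?v = "- alpha0 k \<alpha>"
  have "inner ?v ?v = 2" using level_highest_root[of k] k unfolding inner_minus_alpha0 by simp
  moreover have "affine_generator k \<alpha> i y = reflection ?v 1 y" using True by (simp add: affine_generator_def)
  ultimately have "level (affine_generator k \<alpha> i y) j = level y j - (level y k - 1) * level ?v j"
    by (simp only: reflection_def level_diff_scale inner_minus_alpha0)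
  moreover have "height 1 y (int k + 1) = 1"
    using height_period[of 1 y 0 1] height_window[of 0 1 y] by (simp add: add.commute)
  ultimately show ?thesis
    using True j k aff_swap_window_0[OF k j] aff_swap_window_0[OF k, of 0]
      level_highest_root[OF j] height_minus_1[of 1 y] height_window[OF j, of 1 y]
    by (auto simp: algebra_simps)
next
  case False
  then have i': "i \<in> {1..k}" using i by simp
  then have "level (affine_generator k \<alpha> i y) j = level y j - (level y i - level y (i - 1)) * level (\<alpha> i) j"
    using False inner_roots[OF i' i'] inner_root_level[of i y]
    by (simp add: affine_generator_def reflection_def level_diff_scale)
  moreover have "height 1 y (aff_swap k i (int j)) =
      (if j = i then level y (i - 1) else if j = i - 1 then level y i else level y j)" if "j \<le> k" for j
    using aff_swap_window_pos[of i k j] i' that height_window[of "i - 1" 1 y] height_window[of i 1 y]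
      height_window[of j 1 y] by auto
  from this[OF j] this[of 0] have
    "height 1 y (aff_swap k i (int j)) = (if j = i then level y (i - 1) else if j = i - 1 then level y i else level y j)"
    "height 1 y (aff_swap k i 0) = (if i = 1 then level y 1 else 0)"
    using i' by auto
  ultimately show ?thesis using level_root[OF i' j] i' by (auto simp: algebra_simps)
qed

lemma height_generator:
  assumes "i \<le> k"
  shows "height 1 (affine_generator k \<alpha> i y) j = height 1 y (aff_swap k i j) - height 1 y (aff_swap k i 0)"
  by (rule height_eqI_window) (simp_all add: level_generator[OF assms] aff_swap_period height_period)

lemma generator_invol:
  assumes i: "i \<le> k" and y: "y \<in> V"
  shows "affine_generator k \<alpha> i (affine_generator k \<alpha> i y) = y"
proof (rule level_eqI)
  fix j assume j: "j \<le> k"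
  show "level (affine_generator k \<alpha> i (affine_generator k \<alpha> i y)) j = level y j"
    unfolding level_generator[OF i j] height_generator[OF i] aff_swap_invol[OF k]
    using height_window[OF j, of 1 y] height_window[of 0 1 y] by simp
qed (use i y generator_in_V in auto)

text \<open>Reflections permute the indices of the heights, so s is composed on the right. The
  reverse inclusion follows because both maps are involutions.\<close>

lemma generator_alc:
  assumes i: "i \<le> k" and per: "\<And>i q. s (i + (int k + 1) * q) = s i + (int k + 1) * q"
  shows "affine_generator k \<alpha> i ` alc s = alc (s \<circ> aff_swap k i)"
proof -
  have sub: "affine_generator k \<alpha> i y \<in> alc (s \<circ> aff_swap k i)"
    if per: "\<And>i q. s (i + (int k + 1) * q) = s i + (int k + 1) * q" and y: "y \<in> alc s" for s y
  proof -
    have yV: "y \<in> V" using y by (simp add: alc_def)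
    have per1: "s (i + (int k + 1) * q) = s i + int 1 * (int k + 1) * q" for i q using per by simp
    have per2: "(s \<circ> aff_swap k i) (j + (int k + 1) * q) = (s \<circ> aff_swap k i) j + int 1 * (int k + 1) * q" for j q
      using per by (simp add: aff_swap_period)
    show ?thesis
      unfolding alc_height_iff[OF per2 generator_in_V[OF i yV]] height_generator[OF i]
      using y unfolding alc_height_iff[OF per1 yV] by simp
  qed
  show ?thesis
  proof (intro equalityI subsetI)
    fix z assume "z \<in> affine_generator k \<alpha> i ` alc s"
    then show "z \<in> alc (s \<circ> aff_swap k i)" using sub[OF per] by blast
  next
    fix z assume z: "z \<in> alc (s \<circ> aff_swap k i)"
    have "affine_generator k \<alpha> i z \<in> alc ((s \<circ> aff_swap k i) \<circ> aff_swap k i)"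
      by (rule sub[OF _ z]) (simp add: aff_swap_period per)
    moreover have "(s \<circ> aff_swap k i) \<circ> aff_swap k i = s" by (simp add: fun_eq_iff aff_swap_invol[OF k])
    ultimately have "affine_generator k \<alpha> i z \<in> alc s" by simp
    then show "z \<in> affine_generator k \<alpha> i ` alc s"
      using generator_invol[OF i, of z] z by (metis (no_types, lifting) alc_def imageI mem_Collect_eq)
  qed
qed

text \<open>The levels of such a point increase strictly and rise by less than 1 in total, so their
  differences have floor 0 or -1 according to the order of the indices, just as for the window 0,
  ..., k.\<close>

lemma fundamental_alcove_eq: "fundamental_alcove k \<alpha> = alc id"
proof (intro equalityI subsetI)
  fix y assume y: "y \<in> fundamental_alcove k \<alpha>"
  then have pos: "\<And>l. l \<in> {1..k} \<Longrightarrow> inner (\<alpha> l) y > 0" and last: "level y k < 1" and V: "y \<in> V"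
    unfolding fundamental_alcove_def inner_minus_alpha0 by auto
  have less: "level y i < level y j" if "i < j" "j \<le> k" for i j
    using that
  proof (induction j)
    case (Suc j)
    have "level y j < level y (Suc j)" using pos[of "Suc j"] Suc.prems by (simp add: level_Suc)
    then show ?case using Suc by (cases "i = j") auto
  qed simp
  have small: "level y j - level y i < 1" if "i < j" "j \<le> k" for i j
  proof -
    have "level y j \<le> level y k" using less[of j k] that by (cases "j = k") auto
    moreover have "level y 0 \<le> level y i" using less[of 0 i] that by (cases "i = 0") auto
    ultimately show ?thesis using last by simp
  qed
  have "\<lfloor>level y j - level y i\<rfloor> = (int j - int i) div (int k + 1)" if "i \<le> k" "j \<le> k" for i j
  proof (cases i j rule: linorder_cases)
    case less
    have "\<lfloor>level y j - level y i\<rfloor> = 0" using \<open>\<And>i j. i < j \<Longrightarrow> j \<le> k \<Longrightarrow> level y i < level y j\<close>[of i j] small[of i j] less that by linarith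
    moreover have "(int j - int i) div (int k + 1) = 0" using less that by (intro div_pos_pos_trivial) auto
    ultimately show ?thesis by simp
  next
    case greater
    have "\<lfloor>level y j - level y i\<rfloor> = - 1" using less[of j i] small[of j i] greater that by linarith
    moreover have "(int j - int i) div (int k + 1) = - 1"
      using greater that by (intro int_div_pos_eq[of _ _ _ "int k + 1 + int j - int i"]) auto
    ultimately show ?thesis by simp
  qed simp
  then show "y \<in> alc id" using V by (simp add: alc_def)
next
  fix y assume y: "y \<in> alc id"
  then have fl: "\<lfloor>level y j - level y i\<rfloor> = (int j - int i) div (int k + 1)" if "i \<le> k" "j \<le> k" for i j
    using that by (simp add: alc_def)
  have "inner (\<alpha> l) y > 0" if l: "l \<in> {1..k}" for l
  proof -
    have "int (l - 1) - int l = - 1" using l by (simp add: of_nat_diff)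
    then have "\<lfloor>level y (l - 1) - level y l\<rfloor> = (- 1) div (int k + 1)" using fl[of l "l - 1"] l by auto
    also have "\<dots> = - 1" by (simp add: div_eq_minus1)
    finally show ?thesis using l by (simp add: inner_root_level) linarith
  qed
  moreover have "\<lfloor>level y k\<rfloor> = 0" using fl[of 0 k] by (simp add: div_pos_pos_trivial)
  then have "level y k < 1" by linarith
  ultimately show "y \<in> fundamental_alcove k \<alpha>"
    using y unfolding fundamental_alcove_def inner_minus_alpha0 alc_def by blast
qed

end

text \<open>For a word of u this is the inverse of u, as later letters are composed on the
  left.\<close>

definition wperm :: "nat \<Rightarrow> nat list \<Rightarrow> int \<Rightarrow> int" where
  "wperm k w = fold (\<lambda>i s. aff_swap k i \<circ> s) w id"

lemma wperm_Nil: "wperm k [] = id"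
  by (simp add: wperm_def)

lemma wperm_snoc: "wperm k (w @ [i]) = aff_swap k i \<circ> wperm k w"
  by (simp add: wperm_def)

text \<open>Left and right multiplication commute, so the letters may also be composed on the right.\<close>
lemma wperm_Cons: "wperm k (i # w) = wperm k w \<circ> aff_swap k i"
proof -
  have "fold (\<lambda>i s. aff_swap k i \<circ> s) w (s \<circ> g) = fold (\<lambda>i s. aff_swap k i \<circ> s) w s \<circ> g" for s g
    by (induction w arbitrary: s) (simp_all add: comp_assoc[symmetric] del: fold_Cons_rev fold_append)
  from this[of id "aff_swap k i"] show ?thesis by (simp add: wperm_def)
qed

lemma wperm_period: "wperm k w (i + (int k + 1) * q) = wperm k w i + (int k + 1) * q"
  by (induction w rule: rev_induct) (simp_all add: wperm_Nil wperm_snoc aff_swap_period)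

lemma (in type_A) word_alcove_eq:
  "w \<in> lists {0..k} \<Longrightarrow> word_alcove k \<alpha> w = alc (wperm k w)"
proof (induction w)
  case (Cons i w)
  then show ?case using generator_alc[of i "wperm k w"]
    by (simp add: word_alcove_def wperm_Cons wperm_period comp_def)
qed (simp add: word_alcove_def wperm_Nil fundamental_alcove_eq)

text \<open>The affine symmetric group in window notation, with the window at 0, ..., k. Fixing the
  window sum leaves no room for adding a constant.\<close>

definition affine_perm :: "nat \<Rightarrow> (int \<Rightarrow> int) \<Rightarrow> bool" where
  "affine_perm k s \<longleftrightarrow> (\<forall>i q. s (i + (int k + 1) * q) = s i + (int k + 1) * q) \<and>
     (\<forall>i j. [s i = s j] (mod (int k + 1)) \<longrightarrow> [i = j] (mod (int k + 1))) \<and>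
     (\<Sum>j \<le> k. s (int j)) = (\<Sum>j \<le> k. int j)"

lemma affine_permD:
  assumes "affine_perm k s"
  shows "s (i + (int k + 1) * q) = s i + (int k + 1) * q"
    "[s i = s j] (mod (int k + 1)) \<Longrightarrow> [i = j] (mod (int k + 1))"
    "(\<Sum>j \<le> k. s (int j)) = (\<Sum>j \<le> k. int j)"
  using assms by (auto simp: affine_perm_def)

lemma affine_perm_id: "affine_perm k id"
  by (simp add: affine_perm_def)

lemma affine_perm_distinct_residues:
  assumes "affine_perm k s"
  shows "distinct_residues k s"
  unfolding distinct_residues_def
proof (intro allI impI)
  fix i j assume ij: "i \<le> k" "j \<le> k" "[s (int i) = s (int j)] (mod (int k + 1))"
  then have "[int i = int j] (mod (int k + 1))" using affine_permD(2)[OF assms] by blast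
  then show "i = j" using ij by (simp add: cong_def)
qed

text \<open>The change of the window sum depends only on the residues of the window values. These
  are the residues of 0, ..., k, for which one change of +1 and one of -1 cancel.\<close>

lemma affine_perm_swap:
  assumes k: "k \<ge> 1" and i: "i \<le> k" and s: "affine_perm k s"
  shows "affine_perm k (aff_swap k i \<circ> s)"
  unfolding affine_perm_def
proof (intro conjI allI impI)
  let ?N = "int k + 1"
  note S = affine_permD[OF s]
  show "(aff_swap k i \<circ> s) (j + ?N * q) = (aff_swap k i \<circ> s) j + ?N * q" for j q
    by (simp add: S aff_swap_period)
  show "[a = b] (mod ?N)" if h: "[(aff_swap k i \<circ> s) a = (aff_swap k i \<circ> s) b] (mod ?N)" for a b
  proof -
    obtain q where "aff_swap k i (s b) = aff_swap k i (s a) + ?N * q" using h unfolding cong_iff_lin comp_def by blast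
    then have "aff_swap k i (aff_swap k i (s b)) = aff_swap k i (aff_swap k i (s a)) + ?N * q"
      by (simp only: aff_swap_period)
    then have "[s a = s b] (mod ?N)" unfolding cong_iff_lin aff_swap_invol[OF k] by blast
    then show ?thesis by (rule S)
  qed
  define g where "g x = aff_swap k i x - x" for x
  have "g (x + ?N * q) = g x" for x q unfolding g_def aff_swap_period by simp
  from this[of "_ mod ?N" "_ div ?N"] have g: "g (x mod ?N) = g x" for x
    by (metis mod_mult_div_eq)
  have bij: "bij_betw (\<lambda>j. s (int j) mod ?N) {..k} {0..<?N}"
    by (rule distinct_residues_bij[OF affine_perm_distinct_residues[OF s]])
  have "distinct_residues k id" by (rule affine_perm_distinct_residues[OF affine_perm_id])
  then have bij': "bij_betw (\<lambda>j. int j mod ?N) {..k} {0..<?N}" using distinct_residues_bij[of k id] by simp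
  have "(\<Sum>j \<le> k. g (s (int j))) = (\<Sum>j \<le> k. g (s (int j) mod ?N))" by (simp only: g)
  also have "\<dots> = (\<Sum>r \<in> {0..<?N}. g r)" by (rule sum.reindex_bij_betw[OF bij])
  also have "\<dots> = (\<Sum>j \<le> k. g (int j mod ?N))" by (rule sum.reindex_bij_betw[OF bij', symmetric])
  also have "\<dots> = (\<Sum>j \<le> k. g (int j))" by (simp only: g)
  also have "\<dots> = (\<Sum>j \<le> k. (if j = i then - 1 else 0) + (if j = (if i = 0 then k else i - 1) then 1 else 0))"
  proof (rule sum.cong[OF refl])
    fix j assume "j \<in> {..k}"
    then show "g (int j) = (if j = i then - 1 else 0) + (if j = (if i = 0 then k else i - 1) then 1 else 0)"
      using aff_swap_window_0[OF k, of j] aff_swap_window_pos[of i k j] i k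
      by (cases "i = 0") (auto simp: g_def of_nat_diff)
  qed
  also have "\<dots> = 0" using i k by (auto simp: sum.distrib)
  finally have "(\<Sum>j \<le> k. g (s (int j))) = 0" .
  then show "(\<Sum>j \<le> k. (aff_swap k i \<circ> s) (int j)) = (\<Sum>j \<le> k. int j)"
    using S(3) by (simp add: g_def sum_subtractf)
qed

lemma affine_perm_wperm: "k \<ge> 1 \<Longrightarrow> w \<in> lists {0..k} \<Longrightarrow> affine_perm k (wperm k w)"
  by (induction w rule: rev_induct) (auto simp: wperm_Nil wperm_snoc affine_perm_id intro: affine_perm_swap)

lemma affine_perm_ext:
  assumes s: "affine_perm k s" and t: "affine_perm k t" and eq: "\<And>j. j \<le> k \<Longrightarrow> s (int j) = t (int j)"
  shows "s = t"
proof
  fix i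
  obtain j q where j: "j \<le> k" "i = int j + (int k + 1) * q" by (rule int_window_cases)
  show "s i = t i" unfolding j(2) affine_permD(1)[OF s] affine_permD(1)[OF t] using eq[OF j(1)] by simp
qed

lemma affine_perm_residue:
  assumes "affine_perm k s"
  shows "\<exists>j \<le> k. int k + 1 dvd s (int j) - x"
proof -
  have "x mod (int k + 1) \<in> (\<lambda>j. s (int j) mod (int k + 1)) ` {..k}"
    using bij_betw_imp_surj_on[OF distinct_residues_bij[OF affine_perm_distinct_residues[OF assms]]]
      pos_mod_bound[of "int k + 1" x] by simp
  then obtain j where "j \<le> k" "s (int j) mod (int k + 1) = x mod (int k + 1)" by auto
  then show ?thesis by (auto simp: mod_eq_dvd_iff)
qed

lemma affine_perm_residue_unique:
  assumes "affine_perm k s" "i \<le> k" "j \<le> k" "int k + 1 dvd s (int i) - x" "int k + 1 dvd s (int j) - x"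
  shows "i = j"
proof -
  have "s (int i) - s (int j) = (s (int i) - x) - (s (int j) - x)" by simp
  then have "int k + 1 dvd s (int i) - s (int j)" using assms(4,5) by (metis dvd_diff)
  then show ?thesis using affine_perm_distinct_residues[OF assms(1)] assms(2,3)
    unfolding distinct_residues_def cong_iff_dvd_diff by blast
qed

text \<open>For affine permutations this is the affine Grassmannian condition: it selects one
  representative from each class modulo rearranging the window, and on the alcove it expresses
  dominance.\<close>

definition increasing_on_window :: "nat \<Rightarrow> (int \<Rightarrow> int) \<Rightarrow> bool" where
  "increasing_on_window k s \<longleftrightarrow> (\<forall>j < k. s (int j) < s (int j + 1))"

lemma increasing_on_window_less:
  assumes "increasing_on_window k s" "i < j" "j \<le> k"
  shows "s (int i) + int (j - i) \<le> s (int j)"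
  using assms(2,3)
proof (induction j)
  case (Suc j)
  have "s (int j) < s (int (Suc j))" using assms(1) Suc.prems by (simp add: increasing_on_window_def add.commute)
  then show ?case using Suc by (cases "i = j") (auto simp: of_nat_diff)
qed simp

text \<open>Going through the residue classes upwards from \<open>s 0\<close>, the window value in
  the class of \<open>s 0 + d\<close> never exceeds \<open>s 0 + d\<close>. All window values thus
  lie within k of \<open>s 0\<close>; an increasing window must then be consecutive, and the sum
  gives \<open>s 0 = 0\<close>.\<close>

lemma affine_perm_no_descent_id:
  assumes s: "affine_perm k s" and inc: "increasing_on_window k s"
    and no: "\<And>a b. a \<le> k \<Longrightarrow> b \<le> k \<Longrightarrow> int k + 1 dvd s (int b) - (s (int a) + 1) \<Longrightarrow>
      s (int b) \<le> s (int a) + 1"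
  shows "s = id"
proof (rule affine_perm_ext[OF s affine_perm_id])
  have ex: "\<exists>b \<le> k. int k + 1 dvd s (int b) - (s 0 + int d) \<and> s (int b) \<le> s 0 + int d" for d
  proof (induction d)
    case 0
    show ?case by (intro exI[of _ 0]) simp
  next
    case (Suc d)
    then obtain a where a: "a \<le> k" "int k + 1 dvd s (int a) - (s 0 + int d)" "s (int a) \<le> s 0 + int d" by blast
    obtain b where b: "b \<le> k" "int k + 1 dvd s (int b) - (s 0 + int (Suc d))"
      using affine_perm_residue[OF s] by blast
    have "s (int b) - (s (int a) + 1) = (s (int b) - (s 0 + int (Suc d))) - (s (int a) - (s 0 + int d))" by simp
    then have "int k + 1 dvd s (int b) - (s (int a) + 1)" using a b by (metis dvd_diff)
    then have "s (int b) \<le> s (int a) + 1" using no a b by blast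
    then show ?case using a b by (intro exI[of _ b]) simp
  qed
  have upper: "s (int j) \<le> s 0 + int k" if j: "j \<le> k" for j
  proof -
    define d where "d = nat ((s (int j) - s 0) mod (int k + 1))"
    have d: "int d = (s (int j) - s 0) mod (int k + 1)" by (simp add: d_def)
    then have "d \<le> k" using pos_mod_bound[of "int k + 1" "s (int j) - s 0"] by simp
    have "int k + 1 dvd s (int j) - (s 0 + int d)" unfolding d diff_diff_eq[symmetric]
      by (simp add: dvd_minus_mod)
    moreover obtain b where "b \<le> k" "int k + 1 dvd s (int b) - (s 0 + int d)" "s (int b) \<le> s 0 + int d"
      using ex by blast
    ultimately have "s (int j) \<le> s 0 + int d" using affine_perm_residue_unique[OF s j] by blast
    then show ?thesis using \<open>d \<le> k\<close> by simp
  qed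
  have eq: "s (int j) = s 0 + int j" if "j \<le> k" for j
    using increasing_on_window_less[OF inc, of 0 j] increasing_on_window_less[OF inc, of j k] upper[of k] that
    by (cases "j = 0"; cases "j = k") (auto simp: of_nat_diff)
  have "(\<Sum>j \<le> k. s (int j)) = (\<Sum>j \<le> k. s 0 + int j)" using eq by (intro sum.cong) auto
  then have "(int k + 1) * s 0 = 0" using affine_permD(3)[OF s] by (simp add: sum.distrib algebra_simps)
  then show "s (int j) = id (int j)" if "j \<le> k" for j using eq[OF that] by auto
qed

text \<open>Descent on the sum of squares of the window. If a value lies more than 1 above a value
  of the preceding residue class, exchanging the two classes moves these values towards each other
  and lowers the sum; if no such pair exists, the permutation is the identity.\<close>

lemma ex_wperm:
  assumes k: "k \<ge> 1"
  shows "affine_perm k s \<Longrightarrow> increasing_on_window k s \<Longrightarrow> \<exists>w \<in> lists {0..k}. wperm k w = s"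
proof (induction "nat (\<Sum>j \<le> k. (s (int j))\<^sup>2)" arbitrary: s rule: less_induct)
  case less
  let ?N = "int k + 1"
  note s = less.prems(1) and inc = less.prems(2)
  show ?case
  proof (cases "\<exists>a \<le> k. \<exists>b \<le> k. ?N dvd s (int b) - (s (int a) + 1) \<and> s (int a) + 1 < s (int b)")
    case False
    then have "s = id" by (intro affine_perm_no_descent_id[OF s inc]) (meson not_less)
    then show ?thesis by (intro bexI[of _ "[]"]) (simp_all add: wperm_Nil)
  next
    case True
    then obtain a b where ab: "a \<le> k" "b \<le> k" "?N dvd s (int b) - (s (int a) + 1)" "s (int a) + 1 < s (int b)"
      by blast
    define i where "i = nat (s (int b) mod ?N)"
    have i: "int i = s (int b) mod ?N" by (simp add: i_def)
    then have ik: "i \<le> k" using pos_mod_bound[of ?N "s (int b)"] by simp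
    have bi: "?N dvd s (int b) - int i" unfolding i by (simp add: dvd_minus_mod)
    have "s (int a) - int i + 1 = (s (int b) - int i) - (s (int b) - (s (int a) + 1))" by simp
    then have ai: "?N dvd s (int a) - int i + 1" using bi ab(3) by (metis dvd_diff)
    have only_b: "p = b" if "p \<le> k" "?N dvd s (int p) - int i" for p
      using affine_perm_residue_unique[OF s that(1) ab(2) that(2) bi] .
    have only_a: "p = a" if "p \<le> k" "?N dvd s (int p) - int i + 1" for p
      using affine_perm_residue_unique[OF s that(1) ab(1), of "int i - 1"] that(2) ai by (simp add: algebra_simps)
    define t where "t = aff_swap k i \<circ> s"
    have t: "affine_perm k t" unfolding t_def by (rule affine_perm_swap[OF k ik s])
    have inct: "increasing_on_window k t"
      unfolding increasing_on_window_def t_def comp_def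
    proof (intro allI impI aff_swap_less[OF k] notI)
      fix j assume j: "j < k"
      then show "s (int j) < s (int j + 1)" using inc by (simp add: increasing_on_window_def)
      \<comment> \<open>Only consecutive values in the classes of i - 1 and i could change their
        order. They would have to be those at a and b, which are more than 1 apart.\<close>
      assume "?N dvd s (int j) - int i + 1 \<and> s (int j + 1) = s (int j) + 1"
      then have h: "?N dvd s (int j) - int i + 1" "s (int (Suc j)) = s (int j) + 1" by (simp_all add: add.commute)
      then have "?N dvd s (int (Suc j)) - int i" by (simp add: algebra_simps)
      then have "Suc j = b" "j = a" using only_a only_b h j by auto
      then show False using h ab(4) by simp
    qed
    have "a \<noteq> b" using ab(4) by auto
    have "(t (int p))\<^sup>2 = (s (int p))\<^sup>2 + ((if p = a then 2 * s (int a) + 1 else 0) + (if p = b then 1 - 2 * s (int b) else 0))"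
      if p: "p \<le> k" for p
    proof -
      consider "p = a" | "p = b" | "p \<noteq> a" "p \<noteq> b" by blast
      then show ?thesis
      proof cases
        case 1
        then have "\<not> ?N dvd s (int p) - int i" using only_b[OF p] \<open>a \<noteq> b\<close> by blast
        then have tp: "t (int p) = s (int p) + 1" using 1 ai by (simp add: t_def aff_swap_def)
        show ?thesis unfolding tp using 1 \<open>a \<noteq> b\<close> by (simp add: power2_eq_square algebra_simps)
      next
        case 2
        then have tp: "t (int p) = s (int p) - 1" using bi by (simp add: t_def aff_swap_def)
        show ?thesis unfolding tp using 2 \<open>a \<noteq> b\<close> by (simp add: power2_eq_square algebra_simps)
      next
        case 3
        then have "t (int p) = s (int p)" using only_a[OF p] only_b[OF p] by (auto simp: t_def aff_swap_def)
        then show ?thesis using 3 by simp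
      qed
    qed
    then have "(\<Sum>p \<le> k. (t (int p))\<^sup>2) = (\<Sum>p \<le> k. (s (int p))\<^sup>2) + ((2 * s (int a) + 1) + (1 - 2 * s (int b)))"
      using ab(1,2) by (simp add: sum.distrib)
    then have "(\<Sum>p \<le> k. (t (int p))\<^sup>2) < (\<Sum>p \<le> k. (s (int p))\<^sup>2)" using ab(4) by simp
    moreover have "0 \<le> (\<Sum>p \<le> k. (t (int p))\<^sup>2)" by (simp add: sum_nonneg)
    ultimately have "nat (\<Sum>p \<le> k. (t (int p))\<^sup>2) < nat (\<Sum>p \<le> k. (s (int p))\<^sup>2)" by simp
    from less.hyps[OF this t inct] obtain w where w: "w \<in> lists {0..k}" "wperm k w = t" by blast
    have "wperm k (w @ [i]) = s"
      unfolding wperm_snoc w(2) t_def by (simp add: fun_eq_iff aff_swap_invol[OF k])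
    moreover have "w @ [i] \<in> lists {0..k}" using w(1) ik by simp
    ultimately show ?thesis by blast
  qed
qed

section \<open>Cores and their boundary paths\<close>

definition row_len :: "diagram \<Rightarrow> nat \<Rightarrow> nat" where
  "row_len D a = card {b. (a, b) \<in> D}"

definition col_len :: "diagram \<Rightarrow> nat \<Rightarrow> nat" where
  "col_len D b = card {a. (a, b) \<in> D}"

text \<open>The vertical steps of the boundary path, labelled by contents.\<close>
definition bead :: "diagram \<Rightarrow> nat \<Rightarrow> int" where
  "bead D a = int (row_len D a) - int a - 1"

definition beads :: "diagram \<Rightarrow> int set" where
  "beads D = range (bead D)"

lemma down_closed_eq_lessThan:
  fixes A :: "nat set"
  assumes "finite A" "\<And>b b'. b \<in> A \<Longrightarrow> b' \<le> b \<Longrightarrow> b' \<in> A"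
  shows "A = {..<card A}"
proof (cases "A = {}")
  case False
  have "A = {..Max A}" using assms(2)[OF Max_in[OF assms(1) False]] Max_ge[OF assms(1)] by auto
  then show ?thesis by (metis card_atMost lessThan_Suc_atMost)
qed simp

lemma partition_closed:
  "is_partition D \<Longrightarrow> (a, b) \<in> D \<Longrightarrow> a' \<le> a \<Longrightarrow> b' \<le> b \<Longrightarrow> (a', b') \<in> D"
  unfolding is_partition_def by blast

lemma partition_row:
  assumes "is_partition D"
  shows "(a, b) \<in> D \<longleftrightarrow> b < row_len D a"
proof -
  have "{b. (a, b) \<in> D} = snd ` (D \<inter> {a} \<times> UNIV)" by force
  then have "finite {b. (a, b) \<in> D}" using assms by (simp add: is_partition_def)
  then have "{b. (a, b) \<in> D} = {..<row_len D a}"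
    unfolding row_len_def by (rule down_closed_eq_lessThan) (use partition_closed[OF assms] in blast)
  then show ?thesis by auto
qed

lemma partition_col:
  assumes "is_partition D"
  shows "(a, b) \<in> D \<longleftrightarrow> a < col_len D b"
proof -
  have "{a. (a, b) \<in> D} = fst ` (D \<inter> UNIV \<times> {b})" by force
  then have "finite {a. (a, b) \<in> D}" using assms by (simp add: is_partition_def)
  then have "{a. (a, b) \<in> D} = {..<col_len D b}"
    unfolding col_len_def by (rule down_closed_eq_lessThan) (use partition_closed[OF assms] in blast)
  then show ?thesis by auto
qed

lemma row_antimono:
  assumes "is_partition D" "a \<le> a'"
  shows "row_len D a' \<le> row_len D a"
  using partition_row[OF assms(1)] partition_closed[OF assms(1) _ assms(2)] by (meson leI less_irrefl order_refl)

lemma row_eventually_0: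
  assumes "is_partition D"
  shows "\<exists>M. \<forall>a \<ge> M. row_len D a = 0"
proof -
  have "finite (fst ` D)" using assms by (simp add: is_partition_def)
  then obtain M where M: "\<forall>a \<in> fst ` D. a < M" using finite_nat_set_iff_bounded by blast
  have "row_len D a = 0" if "a \<ge> M" for a
  proof -
    have "(a, 0) \<notin> D" using M that by force
    then show ?thesis using partition_row[OF assms] by simp
  qed
  then show ?thesis by blast
qed

lemma bead_less_iff:
  assumes "is_partition D"
  shows "bead D a' < bead D a \<longleftrightarrow> a < a'"
proof -
  have "bead D a' < bead D a" if "a < a'" for a a'
    using row_antimono[OF assms, of a a'] that by (simp add: bead_def)
  from this[of a a'] this[of a' a] show ?thesis by (cases a a' rule: linorder_cases) auto
qed

lemma bead_inj: "is_partition D \<Longrightarrow> bead D a = bead D a' \<longleftrightarrow> a = a'"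
  using bead_less_iff[of D] by (metis linorder_neqE_nat less_irrefl)

text \<open>Adjacent beads are consecutive rows of equal length. A free place just above the bead of
  row a therefore means that the row can be extended.\<close>

lemma bead_Suc_in_beads_iff:
  assumes D: "is_partition D"
  shows "bead D a + 1 \<in> beads D \<longleftrightarrow> (\<exists>a'. a = Suc a' \<and> row_len D a' = row_len D a)"
proof
  assume "bead D a + 1 \<in> beads D"
  then obtain c where c: "bead D c = bead D a + 1" by (auto simp: beads_def)
  then have "c < a" using bead_less_iff[OF D, of a c] by simp
  then obtain a' where a': "a = Suc a'" by (cases a) auto
  then have "bead D a < bead D a'" "bead D a' \<le> bead D c"
    using bead_less_iff[OF D] \<open>c < a\<close> by (simp, metis leI not_less less_Suc_eq_le)
  then have "bead D a' = bead D a + 1" using c by simp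
  then show "\<exists>a'. a = Suc a' \<and> row_len D a' = row_len D a" using a' by (auto simp: bead_def)
next
  assume "\<exists>a'. a = Suc a' \<and> row_len D a' = row_len D a"
  then obtain a' where "a = Suc a'" "row_len D a' = row_len D a" by blast
  then have "bead D a + 1 = bead D a'" by (simp add: bead_def)
  then show "bead D a + 1 \<in> beads D" by (simp add: beads_def)
qed

lemma bead_pred_in_beads_iff:
  assumes D: "is_partition D"
  shows "bead D a - 1 \<in> beads D \<longleftrightarrow> row_len D (Suc a) = row_len D a"
proof
  assume "bead D a - 1 \<in> beads D"
  then obtain c where c: "bead D c = bead D a - 1" by (auto simp: beads_def)
  then have "a < c" using bead_less_iff[OF D, of c a] by simp
  then have "bead D (Suc a) < bead D a" "bead D c \<le> bead D (Suc a)"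
    using bead_less_iff[OF D] by (simp, metis leI not_less less_Suc_eq_le)
  then have "bead D (Suc a) = bead D a - 1" using c by simp
  then show "row_len D (Suc a) = row_len D a" by (simp add: bead_def)
next
  assume "row_len D (Suc a) = row_len D a"
  then have "bead D a - 1 = bead D (Suc a)" by (simp add: bead_def)
  then show "bead D a - 1 \<in> beads D" by (simp add: beads_def)
qed

lemma strict_antimono_range_eqI:
  fixes f g :: "nat \<Rightarrow> int"
  assumes f: "\<And>a b. f b < f a \<longleftrightarrow> a < b" and g: "\<And>a b. g b < g a \<longleftrightarrow> a < b"
    and eq: "range f = range g"
  shows "f = g"
proof
  fix n
  show "f n = g n"
  proof (induction n rule: less_induct)
    case (less n)
    obtain p where p: "f n = g p" using eq by blast
    obtain q where q: "g n = f q" using eq by blast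
    have "\<not> p < n"
    proof
      assume "p < n"
      then have "f n = f p" using less p by simp
      then show False using f[of n p] \<open>p < n\<close> by simp
    qed
    then have "f n \<le> g n" using g[of n p] g[of p n] p by auto
    have "\<not> q < n"
    proof
      assume "q < n"
      then have "g n = g q" using less q by simp
      then show False using g[of n q] \<open>q < n\<close> by simp
    qed
    then have "g n \<le> f n" using f[of n q] f[of q n] q by auto
    with \<open>f n \<le> g n\<close> show ?case by simp
  qed
qed

lemma beads_inj:
  assumes D: "is_partition D" and E: "is_partition E" and eq: "beads D = beads E"
  shows "D = E"
proof -
  have b: "bead D = bead E"
    by (rule strict_antimono_range_eqI) (use bead_less_iff D E eq in \<open>auto simp: beads_def\<close>)
  have "row_len D a = row_len E a" for a using fun_cong[OF b, of a] by (simp add: bead_def)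
  then show ?thesis using partition_row[OF D] partition_row[OF E] by auto
qed

text \<open>The horizontal steps of the boundary path carry the remaining labels.\<close>
lemma gap_iff:
  assumes D: "is_partition D"
  shows "z \<notin> beads D \<longleftrightarrow> (\<exists>b. z = int b - int (col_len D b))"
proof
  assume "\<exists>b. z = int b - int (col_len D b)"
  then obtain b where b: "z = int b - int (col_len D b)" by blast
  have "bead D a \<noteq> z" for a
  proof (cases "(a, b) \<in> D")
    case True
    then have "b < row_len D a" "a < col_len D b" using partition_row[OF D] partition_col[OF D] by auto
    then show ?thesis by (simp add: b bead_def)
  next
    case False
    then have "row_len D a \<le> b" "col_len D b \<le> a"
      using partition_row[OF D, of a b] partition_col[OF D, of a b] by simp_all
    then show ?thesis by (simp add: b bead_def)
  qed
  then show "z \<notin> beads D" by (auto simp: beads_def)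
next
  assume z: "z \<notin> beads D"
  obtain M where M: "\<forall>a \<ge> M. row_len D a = 0" using row_eventually_0[OF D] by blast
  have "\<exists>a. bead D a < z"
    using M by (intro exI[of _ "max M (nat (- z))"]) (simp add: bead_def)
  \<comment> \<open>The number of beads above z, which is the length of the column whose foot is the
    horizontal step with label z.\<close>
  define a where "a = (LEAST a. bead D a < z)"
  have a: "bead D a < z" unfolding a_def by (rule LeastI_ex) fact
  have above: "z < bead D c" if "c < a" for c
  proof -
    have "\<not> bead D c < z" using that not_less_Least unfolding a_def by blast
    moreover have "bead D c \<noteq> z" using z by (auto simp: beads_def)
    ultimately show ?thesis by simp
  qed
  define b where "b = nat (z + int a)"
  have b: "int b = z + int a" using a by (simp add: b_def bead_def)
  have "c < col_len D b \<longleftrightarrow> c < a" for c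
  proof -
    have "c < col_len D b \<longleftrightarrow> b < row_len D c" using partition_row[OF D] partition_col[OF D] by blast
    also have "\<dots> \<longleftrightarrow> c < a"
    proof
      assume "c < a"
      then obtain a' where a': "a = Suc a'" "c \<le> a'" by (cases a) auto
      then have "b < row_len D a'" using above[of a'] b by (simp add: bead_def)
      then show "b < row_len D c" using row_antimono[OF D a'(2)] by simp
    next
      assume "b < row_len D c"
      then show "c < a" using row_antimono[OF D, of a c] a b by (cases "c < a") (auto simp: bead_def)
    qed
    finally show ?thesis .
  qed
  then have "col_len D b = a" by (meson linorder_neqE_nat less_irrefl)
  then show "\<exists>b. z = int b - int (col_len D b)" using b by (intro exI[of _ b]) simp
qed

text \<open>The hook of a box spans the boundary path from the horizontal step below its column to
  the vertical step at the end of its row.\<close>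

lemma hook_length_eq:
  assumes D: "is_partition D" and x: "(a, b) \<in> D"
  shows "int (hook_length D (a, b)) = bead D a - (int b - int (col_len D b))"
proof -
  have r: "b < row_len D a" and c: "a < col_len D b" using x partition_row[OF D] partition_col[OF D] by auto
  have "{b'. b < b' \<and> (a, b') \<in> D} = {b<..<row_len D a}" using partition_row[OF D] by auto
  moreover have "{a'. a < a' \<and> (a', b) \<in> D} = {a<..<col_len D b}" using partition_col[OF D] by auto
  ultimately show ?thesis using r c by (simp add: hook_length_def bead_def of_nat_diff)
qed

text \<open>A bead x with x - n vacant is a vertical and a horizontal step at distance n, and these
  determine a box with hook length n.\<close>

lemma is_core_iff:
  assumes D: "is_partition D" and n: "n > 0"
  shows "is_core n D \<longleftrightarrow> (\<forall>x \<in> beads D. x - int n \<in> beads D)"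
proof
  assume core: "is_core n D"
  show "\<forall>x \<in> beads D. x - int n \<in> beads D"
  proof (rule ballI, rule ccontr)
    fix x assume "x \<in> beads D" and "x - int n \<notin> beads D"
    then obtain a b where ab: "x = bead D a" "x - int n = int b - int (col_len D b)"
      using gap_iff[OF D] by (auto simp: beads_def)
    \<comment> \<open>The label of the row exceeds that of the column, as n is positive, so row and
      column cross inside the diagram.\<close>
    have "(a, b) \<in> D"
    proof (rule ccontr)
      assume "(a, b) \<notin> D"
      then have "row_len D a \<le> b" "col_len D b \<le> a"
        using partition_row[OF D, of a b] partition_col[OF D, of a b] by simp_all
      then show False using ab n by (simp add: bead_def)
    qed
    moreover from this have "hook_length D (a, b) = n" using hook_length_eq[OF D, of a b] ab by simp
    ultimately show False using core unfolding is_core_def by blast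
  qed
next
  assume closed: "\<forall>x \<in> beads D. x - int n \<in> beads D"
  have "hook_length D (a, b) \<noteq> n" if "(a, b) \<in> D" for a b
  proof
    assume "hook_length D (a, b) = n"
    then have "bead D a - int n = int b - int (col_len D b)" using hook_length_eq[OF D that] by simp
    then have "bead D a - int n \<notin> beads D" using gap_iff[OF D] by blast
    then show False using closed by (simp add: beads_def)
  qed
  then show "is_core n D" using D by (auto simp: is_core_def)
qed

section \<open>Corners of a diagram and the beads next to them\<close>

definition young :: "(nat \<Rightarrow> nat) \<Rightarrow> diagram" where
  "young r = {(a, b). b < r a}"

lemma row_young: "row_len (young r) = r"
  by (rule ext) (simp add: row_len_def young_def)

lemma partition_young:
  assumes anti: "\<And>a. r (Suc a) \<le> r a" and ev: "\<And>a. a \<ge> M \<Longrightarrow> r a = 0"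
  shows "is_partition (young r)"
proof -
  have le: "r a' \<le> r a" if "a \<le> a'" for a a' using lift_Suc_antimono_le[of r] anti that by blast
  have "young r \<subseteq> {..<M} \<times> {..<r 0}"
  proof
    fix x assume "x \<in> young r"
    then obtain a b where x: "x = (a, b)" "b < r a" by (auto simp: young_def)
    then have "a < M" using ev[of a] by (cases "a < M") auto
    then show "x \<in> {..<M} \<times> {..<r 0}" using x le[of 0 a] by auto
  qed
  then have "finite (young r)" by (rule finite_subset) simp
  moreover have "b' < r a'" if "b < r a" "a' \<le> a" "b' \<le> b" for a b a' b'
    using le[OF that(2)] that by simp
  ultimately show ?thesis unfolding is_partition_def young_def by blast
qed

lemma addable_box_iff:
  assumes D: "is_partition D"
  shows "(a, b) \<notin> D \<and> is_partition (insert (a, b) D) \<longleftrightarrow> b = row_len D a \<and> bead D a + 1 \<notin> beads D"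
    (is "?l \<longleftrightarrow> ?r")
proof
  assume l: ?l
  then have "row_len D a \<le> b" using partition_row[OF D] by (simp add: not_less)
  moreover have "\<not> row_len D a < b"
  proof
    assume "row_len D a < b"
    then have "(a, row_len D a) \<in> insert (a, b) D" using l partition_closed[of "insert (a, b) D" a b a "row_len D a"] by simp
    then show False using \<open>row_len D a < b\<close> partition_row[OF D, of a "row_len D a"] by auto
  qed
  ultimately have b: "b = row_len D a" by simp
  moreover have "bead D a + 1 \<notin> beads D"
  proof
    assume "bead D a + 1 \<in> beads D"
    then obtain a' where a': "a = Suc a'" "row_len D a' = row_len D a" using bead_Suc_in_beads_iff[OF D] by blast
    then have "(a', b) \<in> insert (a, b) D" using l partition_closed[of "insert (a, b) D" a b a' b] by simp
    then show False using a' b partition_row[OF D, of a' b] by auto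
  qed
  ultimately show ?r by blast
next
  assume r: ?r
  have more: "row_len D a < row_len D a'" if a': "a' < a" for a'
  proof -
    obtain c where c: "a = Suc c" "a' \<le> c" using a' by (cases a) auto
    have "row_len D c \<noteq> row_len D a" using r c bead_Suc_in_beads_iff[OF D] by blast
    then show ?thesis using row_antimono[OF D, of c a] row_antimono[OF D c(2)] c by simp
  qed
  have "(a', b') \<in> insert (a, b) D" if "a' \<le> a" "b' \<le> b" for a' b'
  proof (cases "a' = a")
    case True
    then show ?thesis using that r partition_row[OF D, of a b'] by (cases "b' = b") auto
  next
    case False
    then show ?thesis using that r more[of a'] partition_row[OF D, of a' b'] by auto
  qed
  moreover have "finite D" using D by (simp add: is_partition_def)
  ultimately have "is_partition (insert (a, b) D)"
    unfolding is_partition_def using partition_closed[OF D] by blast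
  then show ?l using r partition_row[OF D, of a b] by simp
qed

lemma removable_box_iff:
  assumes D: "is_partition D"
  shows "(a, b) \<in> D \<and> is_partition (D - {(a, b)}) \<longleftrightarrow> Suc b = row_len D a \<and> bead D a - 1 \<notin> beads D"
    (is "?l \<longleftrightarrow> ?r")
proof
  assume l: ?l
  then have "b < row_len D a" using partition_row[OF D] by simp
  moreover have "\<not> Suc b < row_len D a"
  proof
    assume "Suc b < row_len D a"
    then have "(a, Suc b) \<in> D - {(a, b)}" using partition_row[OF D] by simp
    then have "(a, b) \<in> D - {(a, b)}" using l partition_closed[of "D - {(a, b)}" a "Suc b" a b] by simp
    then show False by simp
  qed
  ultimately have b: "Suc b = row_len D a" by simp
  moreover have "bead D a - 1 \<notin> beads D"
  proof
    assume "bead D a - 1 \<in> beads D"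
    then have "row_len D (Suc a) = row_len D a" using bead_pred_in_beads_iff[OF D] by blast
    then have "(Suc a, b) \<in> D - {(a, b)}" using b partition_row[OF D, of "Suc a" b] by simp
    then have "(a, b) \<in> D - {(a, b)}" using l partition_closed[of "D - {(a, b)}" "Suc a" b a b] by simp
    then show False by simp
  qed
  ultimately show ?r by blast
next
  assume r: ?r
  have "(c', d') \<noteq> (a, b)" if cd: "(c, d) \<in> D - {(a, b)}" "c' \<le> c" "d' \<le> d" for c d c' d'
  proof
    assume "(c', d') = (a, b)"
    then have ac: "a \<le> c" "b \<le> d" using that by auto
    have "d < row_len D c" using cd partition_row[OF D] by simp
    show False
    proof (cases "a = c")
      case True
      then have "d = b" using r ac \<open>d < row_len D c\<close> by simp
      then show False using True cd by simp
    next
      case False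
      then have "row_len D c \<le> row_len D (Suc a)" using ac by (intro row_antimono[OF D]) simp
      then have "row_len D a \<le> row_len D (Suc a)" using r ac \<open>d < row_len D c\<close> by simp
      then have "row_len D (Suc a) = row_len D a" using row_antimono[OF D, of a "Suc a"] by simp
      then show False using r bead_pred_in_beads_iff[OF D] by blast
    qed
  qed
  moreover have "finite D" using D by (simp add: is_partition_def)
  ultimately have "is_partition (D - {(a, b)})"
    unfolding is_partition_def using partition_closed[OF D] by blast
  moreover have "(a, b) \<in> D" using r partition_row[OF D, of a b] by simp
  ultimately show ?l by blast
qed

lemma mod_eq_small_iff:
  assumes "i \<le> k"
  shows "x mod int (k + 1) = int i \<longleftrightarrow> int k + 1 dvd x - int i"
proof -
  have "x mod int (k + 1) = int i \<longleftrightarrow> x mod int (k + 1) = int i mod int (k + 1)" using assms by simp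
  then show ?thesis by (simp only: mod_eq_dvd_iff) (simp add: add.commute)
qed

text \<open>A box added to row a has content \<open>bead D a + 1\<close>, while the last box of the
  row has content \<open>bead D a\<close>. Hence the offset of 1 between this divisibility condition
  and the one in \<open>removable_eq\<close>.\<close>

lemma addable_eq:
  assumes D: "is_partition D" and i: "i \<le> k"
  shows "addable k i D = {(a, b). b = row_len D a \<and> bead D a + 1 \<notin> beads D \<and> int k + 1 dvd bead D a - int i + 1}"
proof -
  have "content k (a, row_len D a) = int i \<longleftrightarrow> int k + 1 dvd bead D a - int i + 1" for a
    unfolding content_def prod.case mod_eq_small_iff[OF i] by (simp add: bead_def algebra_simps)
  moreover have "(a, b) \<in> addable k i D \<longleftrightarrow>
      (b = row_len D a \<and> bead D a + 1 \<notin> beads D) \<and> content k (a, b) = int i" for a b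
    unfolding addable_box_iff[OF D, symmetric] by (auto simp: addable_def)
  ultimately show ?thesis by auto
qed

lemma removable_eq:
  assumes D: "is_partition D" and i: "i \<le> k"
  shows "removable k i D = {(a, b). Suc b = row_len D a \<and> bead D a - 1 \<notin> beads D \<and> int k + 1 dvd bead D a - int i}"
proof -
  have "content k (a, b) = int i \<longleftrightarrow> int k + 1 dvd bead D a - int i" if "Suc b = row_len D a" for a b
    unfolding content_def prod.case mod_eq_small_iff[OF i] bead_def that[symmetric] by (simp add: algebra_simps)
  moreover have "(a, b) \<in> removable k i D \<longleftrightarrow>
      (Suc b = row_len D a \<and> bead D a - 1 \<notin> beads D) \<and> content k (a, b) = int i" for a b
    unfolding removable_box_iff[OF D, symmetric] by (auto simp: removable_def)
  ultimately show ?thesis by auto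
qed

lemma core_closed:
  assumes D: "is_core (k + 1) D" and x: "x \<in> beads D" and y: "int k + 1 dvd x - y" "y \<le> x"
  shows "y \<in> beads D"
proof -
  have "is_partition D" using D by (simp add: is_core_def)
  then have step: "z - (int k + 1) \<in> beads D" if "z \<in> beads D" for z
    using is_core_iff[of D "k + 1"] D that by (simp add: algebra_simps)
  have iter: "x - (int k + 1) * int t \<in> beads D" for t
  proof (induction t)
    case (Suc t)
    then show ?case using step[OF Suc] by (simp add: algebra_simps)
  qed (use x in simp)
  obtain q where q: "x - y = (int k + 1) * q" using y(1) by blast
  then have "q \<ge> 0" using y(2) by (metis diff_ge_0_iff_ge zero_le_mult_iff of_nat_0_le_iff add_nonneg_pos zero_less_one not_less)
  then show ?thesis using iter[of "nat q"] q by (simp add: algebra_simps)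
qed

text \<open>In every residue class the beads of a core fill all places up to some point. If y is a
  bead and y + 1 is not, each bead x in the class of y + 1 lies below it, so x - 1 is at most y and
  hence a bead.\<close>

lemma core_no_addable_and_removable:
  assumes D: "is_core (k + 1) D"
    and y: "y \<in> beads D" "y + 1 \<notin> beads D" "int k + 1 dvd y - int i + 1"
    and x: "x \<in> beads D" "int k + 1 dvd x - int i"
  shows "x - 1 \<in> beads D"
proof -
  have e: "y - (x - 1) = (y - int i + 1) - (x - int i)" "x - (y + 1) = (x - int i) - (y - int i + 1)" by simp_all
  have d: "int k + 1 dvd y - (x - 1)" "int k + 1 dvd x - (y + 1)" unfolding e using x y by (meson dvd_diff)+
  have "\<not> y + 1 \<le> x" using core_closed[OF D x(1) d(2)] y by blast
  then show ?thesis using core_closed[OF D y(1) d(1)] by simp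
qed

section \<open>Reflections of cores as exchanges of two residue classes of beads\<close>

lemma image_aff_swap_iff:
  assumes "k \<ge> 1"
  shows "z \<in> aff_swap k i ` B \<longleftrightarrow> aff_swap k i z \<in> B"
  using aff_swap_invol[OF assms, of i] by (auto simp: image_iff intro!: bexI[of _ "aff_swap k i z"])

lemma image_if_add_iff:
  fixes z c :: int
  shows "z \<in> (\<lambda>x. if P x then x + c else x) ` B \<longleftrightarrow> z \<in> B \<and> \<not> P z \<or> z - c \<in> B \<and> P (z - c)"
    (is "?l \<longleftrightarrow> ?r")
proof
  assume ?l
  then obtain x where "x \<in> B" "z = (if P x then x + c else x)" by blast
  then show ?r by (cases "P x") auto
next
  assume ?r
  then show ?l
  proof
    assume "z \<in> B \<and> \<not> P z"
    then show ?l by (intro image_eqI[of _ _ z]) auto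
  next
    assume "z - c \<in> B \<and> P (z - c)"
    then show ?l by (intro image_eqI[of _ _ "z - c"]) auto
  qed
qed

text \<open>Adding boxes moves beads of class i - 1 up to vacant places of class i. Since no box of
  content i is removable, every bead of class i has a bead just below it, so this one-sided move is
  the full exchange of the two classes.\<close>

lemma beads_add:
  assumes k: "k \<ge> 1" and D: "is_core (k + 1) D" and i: "i \<le> k" and ne: "addable k i D \<noteq> {}"
  shows "is_partition (D \<union> addable k i D)" "beads (D \<union> addable k i D) = aff_swap k i ` beads D"
proof -
  have P: "is_partition D" using D by (simp add: is_core_def)
  let ?N = "int k + 1"
  define \<delta> where "\<delta> x = (if x + 1 \<notin> beads D \<and> ?N dvd x - int i + 1 then 1 else 0 :: nat)" for x
  define r where "r a = row_len D a + \<delta> (bead D a)" for a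
  have eq: "D \<union> addable k i D = young r"
    unfolding addable_eq[OF P i] r_def \<delta>_def young_def using partition_row[OF P] by (auto split: if_splits)
  obtain M where M: "\<And>a. a \<ge> M \<Longrightarrow> row_len D a = 0" using row_eventually_0[OF P] by blast
  have part: "is_partition (young r)"
  proof (rule partition_young)
    show "r (Suc a) \<le> r a" for a
    proof (cases "row_len D a = row_len D (Suc a)")
      case True
      \<comment> \<open>In a run of equal rows only the first can receive a box, so the row lengths
        stay decreasing.\<close>
      then have "bead D (Suc a) + 1 \<in> beads D" using bead_Suc_in_beads_iff[OF P] by blast
      then show ?thesis using True by (simp add: r_def \<delta>_def)
    next
      case False
      then have "row_len D (Suc a) < row_len D a" using row_antimono[OF P, of a "Suc a"] by simp
      then show ?thesis by (simp add: r_def \<delta>_def)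
    qed
    \<comment> \<open>Row M may receive a box, so the bound moves by one.\<close>
    show "r a = 0" if "a \<ge> Suc M" for a
    proof -
      obtain c where c: "a = Suc c" "c \<ge> M" using \<open>a \<ge> Suc M\<close> by (cases a) auto
      then have "bead D a + 1 \<in> beads D" using bead_Suc_in_beads_iff[OF P] M[of c] M[of a] by simp
      then show ?thesis using M[of a] c by (simp add: r_def \<delta>_def)
    qed
  qed
  have "bead (young r) a = (if \<delta> (bead D a) = 1 then bead D a + 1 else bead D a)" for a
    unfolding bead_def row_young r_def by (simp add: \<delta>_def)
  then have "beads (D \<union> addable k i D) = (\<lambda>x. if \<delta> x = 1 then x + 1 else x) ` beads D"
    unfolding eq beads_def by auto
  also have "\<dots> = aff_swap k i ` beads D"
  proof -
    obtain y where y: "y \<in> beads D" "y + 1 \<notin> beads D" "?N dvd y - int i + 1"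
      using ne unfolding addable_eq[OF P i] by (auto simp: beads_def)
    show ?thesis
    proof (intro Set.set_eqI)
      fix z
      have "z \<in> (\<lambda>x. if \<delta> x = 1 then x + 1 else x) ` beads D \<longleftrightarrow>
          z \<in> beads D \<and> \<delta> z \<noteq> 1 \<or> z - 1 \<in> beads D \<and> \<delta> (z - 1) = 1"
        by (rule image_if_add_iff)
      moreover have "z - 1 \<in> beads D" if "z \<in> beads D" "?N dvd z - int i"
        using core_no_addable_and_removable[OF D y that] .
      moreover have "z \<in> beads D" if "z + 1 \<in> beads D" "?N dvd z - int i + 1"
        using core_no_addable_and_removable[OF D y, of "z + 1"] that by (simp add: algebra_simps)
      ultimately show "z \<in> (\<lambda>x. if \<delta> x = 1 then x + 1 else x) ` beads D \<longleftrightarrow> z \<in> aff_swap k i ` beads D"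
        using not_both_residues(1)[OF k, of "z - int i"]
        unfolding image_aff_swap_iff[OF k] by (auto simp: aff_swap_def \<delta>_def)
    qed
  qed
  finally show "beads (D \<union> addable k i D) = aff_swap k i ` beads D" .
  show "is_partition (D \<union> addable k i D)" unfolding eq by (rule part)
qed

text \<open>No bead of class i - 1 has a vacant place just above it, so the exchange of classes only
  moves beads of class i down. If nothing is removable either, the exchange leaves the set of beads
  unchanged.\<close>

lemma beads_remove:
  assumes k: "k \<ge> 1" and D: "is_core (k + 1) D" and i: "i \<le> k" and ne: "addable k i D = {}"
  shows "is_partition (D - removable k i D)" "beads (D - removable k i D) = aff_swap k i ` beads D"
proof -
  have P: "is_partition D" using D by (simp add: is_core_def)
  let ?N = "int k + 1"
  define \<delta> where "\<delta> x = (if x - 1 \<notin> beads D \<and> ?N dvd x - int i then 1 else 0 :: nat)" for x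
  define r where "r a = row_len D a - \<delta> (bead D a)" for a
  have pos: "row_len D a > 0" if "bead D a - 1 \<notin> beads D" for a
    using that bead_pred_in_beads_iff[OF P, of a] row_antimono[OF P, of a "Suc a"] by (cases "row_len D a") auto
  have eq: "D - removable k i D = young r"
    unfolding removable_eq[OF P i] r_def \<delta>_def young_def using partition_row[OF P] by (auto split: if_splits)
  obtain M where M: "\<And>a. a \<ge> M \<Longrightarrow> row_len D a = 0" using row_eventually_0[OF P] by blast
  have part: "is_partition (young r)"
  proof (rule partition_young)
    show "r (Suc a) \<le> r a" for a
    proof (cases "row_len D a = row_len D (Suc a)")
      case True
      then have "bead D a - 1 \<in> beads D" using bead_pred_in_beads_iff[OF P] by simp
      then show ?thesis using True by (simp add: r_def \<delta>_def)
    next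
      case False
      then have "row_len D (Suc a) < row_len D a" using row_antimono[OF P, of a "Suc a"] by simp
      moreover have "\<delta> (bead D a) \<le> 1" by (simp add: \<delta>_def)
      ultimately show ?thesis unfolding r_def by linarith
    qed
    show "r a = 0" if "a \<ge> M" for a using M[OF that] by (simp add: r_def)
  qed
  have "bead (young r) a = (if \<delta> (bead D a) = 1 then bead D a + (- 1) else bead D a)" for a
    unfolding bead_def row_young r_def using pos[of a] by (auto simp: \<delta>_def of_nat_diff bead_def)
  then have "beads (D - removable k i D) = (\<lambda>x. if \<delta> x = 1 then x + (- 1) else x) ` beads D"
    unfolding eq beads_def by auto
  also have "\<dots> = aff_swap k i ` beads D"
  proof -
    have key: "x + 1 \<in> beads D" if "x \<in> beads D" "?N dvd x - int i + 1" for x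
      using ne that unfolding addable_eq[OF P i] by (auto simp: beads_def)
    show ?thesis
    proof (intro Set.set_eqI)
      fix z
      have "z \<in> (\<lambda>x. if \<delta> x = 1 then x + (- 1) else x) ` beads D \<longleftrightarrow>
          z \<in> beads D \<and> \<delta> z \<noteq> 1 \<or> z + 1 \<in> beads D \<and> \<delta> (z + 1) = 1"
        using image_if_add_iff[of z "\<lambda>x. \<delta> x = 1" "- 1"] by simp
      moreover have "z \<in> beads D" if "z - 1 \<in> beads D" "?N dvd z - int i"
        using key[of "z - 1"] that by simp
      moreover have "z + 1 - int i = z - int i + 1" by simp
      ultimately show "z \<in> (\<lambda>x. if \<delta> x = 1 then x + (- 1) else x) ` beads D \<longleftrightarrow> z \<in> aff_swap k i ` beads D"
        using not_both_residues(1)[OF k, of "z - int i"] key[of z]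
        unfolding image_aff_swap_iff[OF k] by (auto simp: aff_swap_def \<delta>_def)
    qed
  qed
  finally show "beads (D - removable k i D) = aff_swap k i ` beads D" .
  show "is_partition (D - removable k i D)" unfolding eq by (rule part)
qed

text \<open>The core condition survives because \<open>aff_swap\<close> commutes with the
  translation by k + 1.\<close>

lemma core_reflection:
  assumes k: "k \<ge> 1" and D: "is_core (k + 1) D" and i: "i \<le> k"
  shows "is_core (k + 1) (core_reflection k i D)"
    "beads (core_reflection k i D) = aff_swap k i ` beads D"
proof -
  let ?E = "core_reflection k i D"
  have E: "is_partition ?E" "beads ?E = aff_swap k i ` beads D"
    using beads_add[OF assms] beads_remove[OF assms] by (auto simp: core_reflection_def)
  have D': "x - int (k + 1) \<in> beads D" if "x \<in> beads D" for x
    using D that is_core_iff[of D "k + 1"] by (simp add: is_core_def)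
  have "x - int (k + 1) \<in> beads ?E" if x: "x \<in> beads ?E" for x
  proof -
    obtain y where y: "y \<in> beads D" "x = aff_swap k i y" using x unfolding E(2) by blast
    have "x - int (k + 1) = aff_swap k i (y - int (k + 1))"
      using aff_swap_period[of k i y "- 1"] y(2) by (simp add: algebra_simps)
    then show ?thesis unfolding E(2) using D'[OF y(1)] by blast
  qed
  then show "is_core (k + 1) ?E" using is_core_iff[OF E(1)] by simp
  show "beads ?E = aff_swap k i ` beads D" by (rule E)
qed

lemma empty_core: "is_core n {}"
  by (simp add: is_core_def is_partition_def)

lemma beads_empty: "beads {} = {..<0}"
proof -
  have "z \<in> range (\<lambda>a. - int a - 1)" if "z < 0" for z
    using that by (intro range_eqI[of _ _ "nat (- z - 1)"]) simp
  then show ?thesis by (auto simp: beads_def bead_def row_len_def)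
qed

lemma word_inverse_core:
  assumes k: "k \<ge> 1" and w: "w \<in> lists {0..k}"
  shows "is_core (k + 1) (word_inverse_core k w)" "beads (word_inverse_core k w) = wperm k w ` {..<0}"
proof -
  have "is_core (k + 1) (word_inverse_core k w) \<and> beads (word_inverse_core k w) = wperm k w ` {..<0}"
    using w
  proof (induction w rule: rev_induct)
    case (snoc i w)
    then have IH: "is_core (k + 1) (word_inverse_core k w)" "beads (word_inverse_core k w) = wperm k w ` {..<0}"
      and i: "i \<le> k" by auto
    have "word_inverse_core k (w @ [i]) = core_reflection k i (word_inverse_core k w)"
      by (simp add: word_inverse_core_def)
    then show ?case using core_reflection[OF k IH(1) i] IH(2) by (simp add: wperm_snoc image_image)
  qed (simp_all add: word_inverse_core_def empty_core beads_empty wperm_Nil)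
  then show "is_core (k + 1) (word_inverse_core k w)" "beads (word_inverse_core k w) = wperm k w ` {..<0}" by auto
qed

text \<open>Reflecting in the content of the lowest corner only removes boxes.\<close>
lemma ex_affine_perm_of_core:
  assumes k: "k \<ge> 1"
  shows "is_core (k + 1) D \<Longrightarrow> \<exists>s. affine_perm k s \<and> beads D = s ` {..<0}"
proof (induction "card D" arbitrary: D rule: less_induct)
  case less
  show ?case
  proof (cases "D = {}")
    case True
    then show ?thesis using affine_perm_id beads_empty by (intro exI[of _ id]) simp
  next
    case False
    have P: "is_partition D" using less.prems by (simp add: is_core_def)
    then have fin: "finite D" by (simp add: is_partition_def)
    define a where "a = Max (fst ` D)"
    have "a \<in> fst ` D" unfolding a_def using False fin by (intro Max_in) auto
    then obtain c where "(a, c) \<in> D" by force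
    then have pos: "row_len D a > 0" using partition_row[OF P, of a c] by simp
    have "(Suc a, 0) \<notin> D"
    proof
      assume "(Suc a, 0) \<in> D"
      then have "Suc a \<in> fst ` D" by force
      then have "Suc a \<le> a" unfolding a_def using fin by (intro Max_ge) auto
      then show False by simp
    qed
    then have last: "row_len D (Suc a) = 0" using partition_row[OF P] by simp
    define i where "i = nat (bead D a mod (int k + 1))"
    have i: "int i = bead D a mod (int k + 1)" by (simp add: i_def)
    then have ik: "i \<le> k" using pos_mod_bound[of "int k + 1" "bead D a"] by simp
    have dvd: "int k + 1 dvd bead D a - int i" unfolding i by (simp add: dvd_minus_mod)
    have gap: "bead D a - 1 \<notin> beads D" using bead_pred_in_beads_iff[OF P] last pos by simp
    have "(a, row_len D a - 1) \<in> removable k i D" unfolding removable_eq[OF P ik] using pos gap dvd by simp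
    moreover have "addable k i D = {}"
    proof (rule ccontr)
      assume "addable k i D \<noteq> {}"
      then obtain y where "y \<in> beads D" "y + 1 \<notin> beads D" "int k + 1 dvd y - int i + 1"
        unfolding addable_eq[OF P ik] by (auto simp: beads_def)
      then show False using core_no_addable_and_removable[OF less.prems, of y i "bead D a"] gap dvd
        by (simp add: beads_def)
    qed
    ultimately have "core_reflection k i D \<subset> D" 
      unfolding core_reflection_def removable_def by auto
    then have "card (core_reflection k i D) < card D" using fin by (rule psubset_card_mono[rotated])
    then obtain s where s: "affine_perm k s" "beads (core_reflection k i D) = s ` {..<0}"
      using less.hyps core_reflection(1)[OF k less.prems ik] by blast
    have "beads D = aff_swap k i ` (aff_swap k i ` beads D)" by (simp add: image_image aff_swap_invol[OF k])
    also have "\<dots> = (aff_swap k i \<circ> s) ` {..<0}"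
      using s(2) core_reflection(2)[OF k less.prems ik] by (simp add: image_comp)
    finally show ?thesis using affine_perm_swap[OF k ik s(1)] by blast
  qed
qed

section \<open>Cores inside unions of rectangles\<close>

lemma affine_perm_inj:
  assumes s: "affine_perm k s" and eq: "s i = s j"
  shows "i = j"
proof -
  have "[s i = s j] (mod (int k + 1))" using eq by (simp add: cong_def)
  then have "[i = j] (mod (int k + 1))" by (rule affine_permD[OF s])
  then obtain q where q: "j = i + (int k + 1) * q" unfolding cong_iff_lin by blast
  then have "(int k + 1) * q = 0" using eq affine_permD(1)[OF s, of i q] by simp
  then show ?thesis using q by simp
qed

lemma affine_perm_nonneg_notin:
  assumes "affine_perm k s" "0 \<le> j"
  shows "s j \<notin> s ` {..<0}"
proof
  assume "s j \<in> s ` {..<0}"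
  then obtain i where "i < 0" "s i = s j" by auto
  then show False using affine_perm_inj[OF assms(1)] assms(2) by force
qed

lemma affine_perm_surj:
  assumes s: "affine_perm k s"
  shows "\<exists>j. s j = z"
proof -
  obtain j where "int k + 1 dvd s (int j) - z" using affine_perm_residue[OF s] by blast
  then obtain q where "s (int j) - z = (int k + 1) * q" by blast
  then have "s (int j + (int k + 1) * (- q)) = z" using affine_permD(1)[OF s, of "int j" "- q"] by simp
  then show ?thesis by blast
qed

lemma window_quotient_sign:
  assumes "j \<le> k"
  shows "0 \<le> int j + (int k + 1) * q \<longleftrightarrow> 0 \<le> q"
proof
  assume h: "0 \<le> int j + (int k + 1) * q"
  show "0 \<le> q"
  proof (rule ccontr)
    assume "\<not> 0 \<le> q"
    then have "(int k + 1) * q \<le> (int k + 1) * (- 1)" by (intro mult_left_mono) auto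
    then show False using h assms by simp
  qed
qed simp

text \<open>These are the least vacant labels of the residue classes; the set of beads thus
  determines the window as a set.\<close>

lemma window_values_eq:
  assumes s: "affine_perm k s"
  shows "(\<lambda>j. s (int j)) ` {..k} = {z. z \<notin> s ` {..<0} \<and> z - (int k + 1) \<in> s ` {..<0}}"
proof (intro equalityI subsetI)
  fix z assume "z \<in> (\<lambda>j. s (int j)) ` {..k}"
  then obtain j where j: "j \<le> k" "z = s (int j)" by blast
  have "z \<notin> s ` {..<0}" unfolding j(2) by (rule affine_perm_nonneg_notin[OF s]) simp
  moreover have "z - (int k + 1) = s (int j + (int k + 1) * (- 1))" unfolding affine_permD(1)[OF s] j by simp
  then have "z - (int k + 1) \<in> s ` {..<0}" by (rule image_eqI) (use j in simp)
  ultimately show "z \<in> {z. z \<notin> s ` {..<0} \<and> z - (int k + 1) \<in> s ` {..<0}}" by blast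
next
  fix z assume "z \<in> {z. z \<notin> s ` {..<0} \<and> z - (int k + 1) \<in> s ` {..<0}}"
  then obtain i where z: "z \<notin> s ` {..<0}" and i: "i < 0" "z - (int k + 1) = s i" by auto
  have zi: "z = s (i + (int k + 1))" using affine_permD(1)[OF s, of i 1] i(2) by simp
  have "\<not> i + (int k + 1) < 0" using z zi by blast
  then obtain j where j: "i + (int k + 1) = int j" by (metis not_less zero_le_imp_eq_int)
  then have "j \<le> k" using i(1) by simp
  moreover have "z = s (int j)" using zi j by (simp only:)
  ultimately show "z \<in> (\<lambda>j. s (int j)) ` {..k}" by blast
qed

lemma increasing_affine_perm_unique:
  assumes s: "affine_perm k s" "increasing_on_window k s" and t: "affine_perm k t" "increasing_on_window k t"
    and eq: "s ` {..<0} = t ` {..<0}"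
  shows "s = t"
proof (rule affine_perm_ext[OF s(1) t(1)])
  have sorted: "sorted_wrt (<) (map (\<lambda>j. u (int j)) [0..<k + 1])" if "increasing_on_window k u" for u
    unfolding sorted_wrt_iff_nth_less
  proof (intro allI impI)
    fix i j assume ij: "i < j" "j < length (map (\<lambda>j. u (int j)) [0..<k + 1])"
    then show "map (\<lambda>j. u (int j)) [0..<k + 1] ! i < map (\<lambda>j. u (int j)) [0..<k + 1] ! j"
      using increasing_on_window_less[OF that, of i j] by (simp del: upt_Suc)
  qed
  have "set (map (\<lambda>j. s (int j)) [0..<k + 1]) = set (map (\<lambda>j. t (int j)) [0..<k + 1])"
    using window_values_eq[OF s(1)] window_values_eq[OF t(1)] eq
    by (simp add: atLeast0LessThan lessThan_Suc_atMost del: upt_Suc)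
  then have "map (\<lambda>j. s (int j)) [0..<k + 1] = map (\<lambda>j. t (int j)) [0..<k + 1]"
    using strict_sorted_equal[OF sorted[OF s(2)] sorted[OF t(2)]] by simp
  then show "s (int j) = t (int j)" if "j \<le> k" for j using that by (simp add: map_eq_conv del: upt_Suc)
qed

text \<open>The image of the negative integers is a union of rays, one below each window value.
  Sorting the window permutes the rays and keeps their union.\<close>

lemma ex_increasing_affine_perm:
  assumes s: "affine_perm k s"
  shows "\<exists>t. affine_perm k t \<and> increasing_on_window k t \<and> t ` {..<0} = s ` {..<0}"
proof -
  let ?N = "int k + 1"
  define S where "S = (\<lambda>j. s (int j)) ` {..k}"
  have inj: "inj_on (\<lambda>j. s (int j)) {..k}" using affine_perm_inj[OF s] by (force simp: inj_on_def)
  then have "card S = k + 1" "finite S" by (simp_all add: S_def card_image)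
  from ex_periodic_enumeration[OF this(2,1), of ?N] obtain t where
    t1: "\<And>i. t (i + int (k + 1)) = t i + ?N" and t2: "t ` {0..<int (k + 1)} = S"
    and t3: "\<And>i j. 0 \<le> i \<Longrightarrow> i < j \<Longrightarrow> j < int (k + 1) \<Longrightarrow> t i < t j" by auto
  have t1': "t (i + ?N) = t i + ?N" for i using t1[of i] by (simp add: add_ac)
  have per: "t (i + ?N * q) = t i + ?N * q" for i q
    using quasi_periodic_mult[of t ?N ?N i q, OF t1'] by simp
  have win: "(\<lambda>j. t (int j)) ` {..k} = S"
  proof -
    have "int ` {..k} = {0..<int (k + 1)}"
      by (auto simp: image_iff intro!: bexI[of _ "nat _"])
    then have "(\<lambda>j. t (int j)) ` {..k} = t ` {0..<int (k + 1)}" by (metis image_image)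
    then show ?thesis using t2 by simp
  qed
  have inc: "increasing_on_window k t" unfolding increasing_on_window_def using t3 by simp
  have inj_t: "inj_on (\<lambda>j. t (int j)) {..k}"
    unfolding inj_on_def using t3 by (metis atMost_iff less_irrefl linorder_neqE_nat of_nat_0_le_iff
        of_nat_less_iff less_Suc_eq_le Suc_eq_plus1)
  have "affine_perm k t"
    unfolding affine_perm_def
  proof (intro conjI allI impI)
    show "t (i + ?N * q) = t i + ?N * q" for i q by (rule per)
    fix i j assume ij: "[t i = t j] (mod ?N)"
    obtain a p where a: "a \<le> k" "i = int a + ?N * p" by (rule int_window_cases)
    obtain b q where b: "b \<le> k" "j = int b + ?N * q" by (rule int_window_cases)
    have "t (int a) \<in> S" "t (int b) \<in> S" using win a b by auto
    then obtain a' b' where ab: "a' \<le> k" "b' \<le> k" "t (int a) = s (int a')" "t (int b) = s (int b')"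
      unfolding S_def by auto
    have "[s (int a') = s (int b')] (mod ?N)" using ij unfolding a b per ab by (simp add: cong_def)
    then have "a' = b'" using affine_perm_distinct_residues[OF s] ab unfolding distinct_residues_def by blast
    then have "t (int a) = t (int b)" using ab by simp
    then have "a = b" using inj_t a b by (simp add: inj_on_def)
    then show "[i = j] (mod ?N)" unfolding a b by (simp add: cong_def)
  next
    have "(\<Sum>j \<le> k. t (int j)) = \<Sum> S" using sum.reindex[OF inj_t, of id] win by simp
    also have "\<dots> = (\<Sum>j \<le> k. s (int j))" using sum.reindex[OF inj, of id] by (simp add: S_def)
    finally show "(\<Sum>j \<le> k. t (int j)) = (\<Sum>j \<le> k. int j)" using affine_permD(3)[OF s] by simp
  qed
  moreover have "u ` {..<0} = (\<Union>x \<in> (\<lambda>j. u (int j)) ` {..k}. (\<lambda>q. x + ?N * q) ` {..<0})"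
    if u: "\<And>i q. u (i + ?N * q) = u i + ?N * q" for u
  proof (intro equalityI subsetI)
    fix z assume "z \<in> u ` {..<0}"
    then obtain i where i: "i < 0" "z = u i" by auto
    obtain a p where a: "a \<le> k" "i = int a + ?N * p" by (rule int_window_cases)
    have "p < 0" using window_quotient_sign[OF a(1), of p] i a by simp
    moreover have "z = u (int a) + ?N * p" using i a u by simp
    ultimately show "z \<in> (\<Union>x \<in> (\<lambda>j. u (int j)) ` {..k}. (\<lambda>q. x + ?N * q) ` {..<0})" using a(1) by blast
  next
    fix z assume "z \<in> (\<Union>x \<in> (\<lambda>j. u (int j)) ` {..k}. (\<lambda>q. x + ?N * q) ` {..<0})"
    then obtain a q where a: "a \<le> k" "q < 0" "z = u (int a) + ?N * q" by auto
    then have "z = u (int a + ?N * q)" using u by simp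
    moreover have "int a + ?N * q < 0" using window_quotient_sign[OF a(1), of q] a(2) by simp
    ultimately show "z \<in> u ` {..<0}" by blast
  qed
  from this[of t, OF per] this[of s, OF affine_permD(1)[OF s]] have "t ` {..<0} = s ` {..<0}"
    unfolding win S_def[symmetric] by simp
  ultimately show ?thesis using inc by blast
qed

text \<open>With an increasing window, \<open>s 0\<close> is the least vacant label, and by the next
  lemma no bead exceeds \<open>s k - (k + 1)\<close>. So \<open>s k - s 0\<close> measures the part
  of the boundary path that is neither purely vertical nor purely horizontal.\<close>

lemma below_window:
  assumes s: "affine_perm k s" "increasing_on_window k s" and z: "z < s 0"
  shows "z \<in> s ` {..<0}"
proof -
  obtain j where j: "z = s j" using affine_perm_surj[OF s(1)] by metis
  obtain a q where a: "a \<le> k" "j = int a + (int k + 1) * q" by (rule int_window_cases)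
  have "s 0 \<le> s (int a)" using increasing_on_window_less[OF s(2), of 0 a] a by (cases "a = 0") auto
  then have "(int k + 1) * q < 0" using z j affine_permD(1)[OF s(1)] a by simp
  then have "q < 0" by (simp add: mult_less_0_iff)
  then have "j < 0" using window_quotient_sign[OF a(1), of q] a by simp
  then show ?thesis using j by blast
qed

lemma bead_above_bound:
  assumes s: "affine_perm k s" "increasing_on_window k s" and z: "z \<in> s ` {..<0}"
  shows "z \<le> s (int k) - (int k + 1)"
proof -
  obtain j where j: "z = s j" "j < 0" using z by blast
  obtain a q where a: "a \<le> k" "j = int a + (int k + 1) * q" by (rule int_window_cases)
  have "s (int a) \<le> s (int k)" using increasing_on_window_less[OF s(2), of a k] a by (cases "a = k") auto
  moreover have "q \<le> - 1" using window_quotient_sign[OF a(1), of q] a j by simp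
  then have "(int k + 1) * q \<le> (int k + 1) * (- 1)" by (intro mult_left_mono) auto
  ultimately show ?thesis using j affine_permD(1)[OF s(1)] a by simp
qed

text \<open>Each rectangle has k + 1 - i rows and i columns, hence half perimeter k + 1 whatever i
  is.\<close>

lemma length_rect_parts:
  "set is \<subseteq> {1..k} \<Longrightarrow> length (rect_parts k is) + sum_list is = (k + 1) * length is"
  by (induction "is") auto

lemma rect_parts_le: "x \<in> set (rect_parts k is) \<Longrightarrow> x \<le> sum_list is"
  by (induction "is") auto

lemma sorted_wrt_replicate: "sorted_wrt (\<ge>) (replicate n (x :: nat))"
  by (induction n) auto

lemma sorted_rect_parts: "sorted_wrt (\<ge>) (rect_parts k is)"
  by (induction "is") (auto simp: sorted_wrt_append sorted_wrt_replicate dest!: rect_parts_le)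

text \<open>Only the bounding box of the enclosing shape matters here.\<close>
lemma core_spread:
  assumes s: "affine_perm k s" "increasing_on_window k s" and D: "is_partition D" "beads D = s ` {..<0}"
    and "is": "set is \<subseteq> {1..k}" "D \<subseteq> ferrers (rect_parts k is)"
  shows "s (int k) < s 0 + int (length is + 1) * (int k + 1)"
proof -
  let ?p = "rect_parts k is"
  have row0: "row_len D a = 0" if "a \<ge> length ?p" for a
  proof -
    have "(a, 0) \<notin> D" using "is"(2) that by (auto simp: ferrers_def)
    then show ?thesis using partition_row[OF D(1)] by simp
  qed
  have row_le: "row_len D a \<le> sum_list is" for a
  proof (cases "row_len D a")
    case (Suc b)
    then have "(a, b) \<in> ferrers ?p" using partition_row[OF D(1), of a b] "is"(2) by auto
    then have "a < length ?p" "b < ?p ! a" by (auto simp: ferrers_def)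
    then show ?thesis using rect_parts_le[of "?p ! a" k "is"] Suc by simp
  qed simp
  have "s (int k) - (int k + 1) \<in> beads D"
  proof -
    have "s (int k) - (int k + 1) = s (int k + (int k + 1) * (- 1))" unfolding affine_permD(1)[OF s(1)] by simp
    then show ?thesis unfolding D(2) by (rule image_eqI) simp
  qed
  then obtain a where "s (int k) - (int k + 1) = bead D a" by (auto simp: beads_def)
  then have up: "s (int k) \<le> int (sum_list is) + int k" using row_le[of a] by (simp add: bead_def)
  \<comment> \<open>Below the shape all rows are empty, so all labels less than minus its number of
    rows are beads, whereas \<open>s 0\<close> is vacant.\<close>
  have "- int (length ?p) \<le> s 0"
  proof (rule ccontr)
    assume "\<not> - int (length ?p) \<le> s 0"
    then have "bead D (nat (- s 0 - 1)) = s 0" using row0[of "nat (- s 0 - 1)"] by (simp add: bead_def)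
    then have "s 0 \<in> s ` {..<0}" using D(2) by (metis beads_def rangeI)
    then show False using affine_perm_nonneg_notin[OF s(1), of 0] by simp
  qed
  then have "s (int k) - s 0 \<le> int (length ?p + sum_list is) + int k" using up by simp
  also have "int (length ?p + sum_list is) = (int k + 1) * int (length is)"
    using length_rect_parts[OF "is"(1)] by (simp add: algebra_simps)
  finally show ?thesis by (simp add: algebra_simps)
qed

lemma card_beads_above:
  assumes D: "is_partition D"
  shows "finite {x \<in> beads D. z \<le> x}" "bead D (card {x \<in> beads D. z \<le> x}) < z"
proof -
  obtain M where M: "\<forall>a \<ge> M. row_len D a = 0" using row_eventually_0[OF D] by blast
  define A where "A = {a. z \<le> bead D a}"
  have "bead D (max M (nat (- z))) < z" using M by (simp add: bead_def)
  then have "a < max M (nat (- z))" if "a \<in> A" for a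
    using that bead_less_iff[OF D, of "max M (nat (- z))" a] by (simp add: A_def)
  then have "A \<subseteq> {..<max M (nat (- z))}" by blast
  then have fin: "finite A" by (rule finite_subset) simp
  have A: "A = {..<card A}"
  proof (rule down_closed_eq_lessThan[OF fin])
    fix b b' assume "b \<in> A" "b' \<le> b"
    then show "b' \<in> A" using bead_less_iff[OF D, of b b'] by (cases "b' = b") (auto simp: A_def)
  qed
  have im: "{x \<in> beads D. z \<le> x} = bead D ` A" by (auto simp: A_def beads_def)
  moreover have "inj_on (bead D) A" using bead_inj[OF D] by (auto simp: inj_on_def)
  ultimately have "card {x \<in> beads D. z \<le> x} = card A" by (simp add: card_image)
  moreover have "card A \<notin> A" using A by blast
  ultimately show "bead D (card {x \<in> beads D. z \<le> x}) < z" by (simp add: A_def)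
  show "finite {x \<in> beads D. z \<le> x}" unfolding im using fin by simp
qed

text \<open>From index p, the number in question, the beads run down consecutively from q - 1. Far
  down the rows are empty and the bead of row a is - a - 1; comparing the two gives p = - q.\<close>

lemma card_beads_above_full:
  assumes D: "is_partition D" and below: "\<And>z. z < q \<Longrightarrow> z \<in> beads D"
  shows "int (card {x \<in> beads D. q \<le> x}) = - q"
proof -
  define p where "p = card {x \<in> beads D. q \<le> x}"
  have p: "bead D p < q" unfolding p_def by (rule card_beads_above[OF D])
  have small: "bead D c \<ge> q" if "c < p" for c
  proof (rule ccontr)
    assume "\<not> q \<le> bead D c"
    have "{x \<in> beads D. q \<le> x} \<subseteq> bead D ` {..<c}"
    proof
      fix x assume "x \<in> {x \<in> beads D. q \<le> x}"
      then obtain a where a: "x = bead D a" "q \<le> bead D a" by (auto simp: beads_def)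
      then have "a < c" using \<open>\<not> q \<le> bead D c\<close> bead_less_iff[OF D, of c a] by simp
      then show "x \<in> bead D ` {..<c}" using a by blast
    qed
    then have "p \<le> card (bead D ` {..<c})" unfolding p_def by (intro card_mono) auto
    also have "\<dots> \<le> c" using card_image_le[of "{..<c}" "bead D"] by simp
    finally show False using that by simp
  qed
  have seq: "bead D (p + i) = q - 1 - int i" for i
  proof (induction i)
    case 0
    obtain a where a: "bead D a = q - 1" using below[of "q - 1"] by (auto simp: beads_def)
    then have "\<not> a < p" using small[of a] by auto
    then have "bead D a \<le> bead D p" using bead_less_iff[OF D, of p a] by (meson not_less)
    then show ?case using a p by simp
  next
    case (Suc i)
    obtain a where a: "bead D a = q - 1 - int i - 1" using below[of "q - 1 - int i - 1"] by (auto simp: beads_def)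
    then have "p + i < a" using bead_less_iff[OF D, of a "p + i"] Suc by simp
    then have "\<not> bead D (p + Suc i) < bead D a" using bead_less_iff[OF D, of "p + Suc i" a] by simp
    moreover have "bead D (p + Suc i) < bead D (p + i)" using bead_less_iff[OF D] by simp
    ultimately show ?case using a Suc by simp
  qed
  obtain M where M: "\<forall>a \<ge> M. row_len D a = 0" using row_eventually_0[OF D] by blast
  then have "bead D (p + M) = - int (p + M) - 1" by (simp add: bead_def)
  then show ?thesis using seq[of M] by (simp add: p_def)
qed

text \<open>Cutting the boundary path into blocks of length \<open>k + 1\<close> and pushing the beads of each
  block to its end gives the boundary of a union of rectangles containing the partition.\<close>
lemma partition_subset_rect_parts:
  fixes q :: int and k M :: nat
  defines "N \<equiv> int k + 1"
  assumes D: "is_partition D" and below: "\<And>z. z < q \<Longrightarrow> z \<in> beads D"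
    and above: "\<And>x. x \<in> beads D \<Longrightarrow> x < q + int M * N"
    and n: "\<And>t. t < M \<Longrightarrow> n t = card {x \<in> beads D. q + int t * N \<le> x \<and> x < q + int (Suc t) * N}"
    and n_le: "\<And>t. t < M \<Longrightarrow> n t \<le> k + 1"
  shows "D \<subseteq> ferrers (rect_parts k (rev (map (\<lambda>t. k + 1 - n t) [0..<M])))"
proof -
  define I where "I t = rev (map (\<lambda>t. k + 1 - n t) [0..<t])" for t
  define c where "c t = card {x \<in> beads D. q + int t * N \<le> x}" for t
  have I_Suc: "I (Suc t) = (k + 1 - n t) # I t" for t by (simp add: I_def)
  have c_Suc: "c t = n t + c (Suc t)" if "t < M" for t
  proof -
    define A where "A = {x \<in> beads D. q + int t * N \<le> x}"
    define B where "B = {x \<in> beads D. q + int t * N \<le> x \<and> x < q + int (Suc t) * N}"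
    define C where "C = {x \<in> beads D. q + int (Suc t) * N \<le> x}"
    have "int t * N \<le> int (Suc t) * N" by (intro mult_right_mono) (simp_all add: N_def)
    then have A: "A = B \<union> C" unfolding A_def B_def C_def by auto
    have "finite A" unfolding A_def by (rule card_beads_above[OF D])
    then have "finite B" "finite C" unfolding A by simp_all
    moreover have "B \<inter> C = {}" unfolding B_def C_def by auto
    ultimately have "card A = card B + card C" unfolding A by (rule card_Un_disjoint)
    then show ?thesis using n[OF that] by (simp only: c_def A_def B_def C_def)
  qed
  have c0: "int (c 0) = - q" using card_beads_above_full[OF D below] by (simp add: c_def)
  \<comment> \<open>The width of the lowest t rectangles is the number of vacancies in the lowest t
    blocks: t N places less c 0 - c t beads, where c 0 = - q.\<close>
  have sum: "int (sum_list (I t)) = int t * N + q + int (c t)" if "t \<le> M" for t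
    using that
  proof (induction t)
    case (Suc t)
    then have "int (sum_list (I (Suc t))) = N - int (n t) + (int t * N + q + int (c t))"
      using n_le[of t] by (simp add: I_Suc N_def of_nat_diff)
    then show ?case using c_Suc[of t] Suc.prems by (simp add: algebra_simps)
  qed (simp add: I_def c0)
  have row_le: "row_len D (c t) \<le> sum_list (I t)" if "t \<le> M" for t
  proof -
    have "bead D (c t) < q + int t * N" unfolding c_def by (rule card_beads_above[OF D])
    then have "int (row_len D (c t)) \<le> int (sum_list (I t))" unfolding sum[OF that] by (simp add: bead_def)
    then show ?thesis by simp
  qed
  \<comment> \<open>Induction from the bottom of the diagram upwards: c t is the first row belonging
    to the lowest t blocks.\<close>
  have main: "row_len D (c t + a) \<le> (if a < length (rect_parts k (I t)) then rect_parts k (I t) ! a else 0)"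
    if "t \<le> M" for t a
    using that
  proof (induction t arbitrary: a)
    case 0
    have "row_len D (c 0 + a) \<le> row_len D (c 0)" by (rule row_antimono[OF D]) simp
    then show ?case using row_le[of 0] by (simp add: I_def)
  next
    case (Suc t)
    have nt: "k + 1 - (k + 1 - n t) = n t" using n_le[of t] Suc.prems by simp
    have parts: "rect_parts k (I (Suc t)) = replicate (n t) (sum_list (I (Suc t))) @ rect_parts k (I t)"
      unfolding I_Suc by (simp only: rect_parts.simps nt)
    show ?case
    proof (cases "a < n t")
      case True
      have "row_len D (c (Suc t) + a) \<le> row_len D (c (Suc t))" by (rule row_antimono[OF D]) simp
      also have "\<dots> \<le> sum_list (I (Suc t))" by (rule row_le[OF Suc.prems])
      finally show ?thesis unfolding parts using True by (simp add: nth_append)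
    next
      case False
      then obtain a' where a': "a = n t + a'" by (metis le_Suc_ex not_less)
      then have e: "c (Suc t) + a = c t + a'" using c_Suc[of t] Suc.prems by simp
      show ?thesis unfolding e parts using Suc.IH[of a'] Suc.prems by (simp add: a' nth_append split: if_splits)
    qed
  qed
  have "{x \<in> beads D. q + int M * N \<le> x} = {}" using above by force
  then have "c M = 0" unfolding c_def by (simp only: card.empty)
  then have row: "row_len D a \<le> (if a < length (rect_parts k (I M)) then rect_parts k (I M) ! a else 0)" for a
    using main[of M a] by simp
  have "D \<subseteq> ferrers (rect_parts k (I M))"
  proof
    fix x assume "x \<in> D"
    then obtain a b where x: "x = (a, b)" "b < row_len D a" using partition_row[OF D] by (cases x) auto
    then show "x \<in> ferrers (rect_parts k (I M))" using row[of a] by (auto simp: ferrers_def split: if_splits)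
  qed
  then show ?thesis by (simp add: I_def)
qed

text \<open>For i = k the rectangle is a single row. Placed on top it is at least as long as every
  other row, so moving the decreasing shape down by one only enlarges it. The value k keeps the list
  of sizes decreasing.\<close>

lemma ferrers_rect_parts_pad:
  "ferrers (rect_parts k is) \<subseteq> ferrers (rect_parts k (replicate r k @ is))"
proof (induction r)
  case (Suc r)
  let ?p = "rect_parts k (replicate r k @ is)"
  have parts: "rect_parts k (replicate (Suc r) k @ is) = (k + sum_list (replicate r k @ is)) # ?p" by simp
  have "ferrers ?p \<subseteq> ferrers ((k + sum_list (replicate r k @ is)) # ?p)"
  proof
    fix x assume "x \<in> ferrers ?p"
    then obtain a b where x: "x = (a, b)" "a < length ?p" "b < ?p ! a" by (auto simp: ferrers_def)
    have "?p ! a \<le> ((k + sum_list (replicate r k @ is)) # ?p) ! a"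
    proof (cases a)
      case 0
      then have "?p ! a \<in> set ?p" using x by simp
      then show ?thesis using 0 rect_parts_le[of "?p ! a" k "replicate r k @ is"] by simp
    next
      case (Suc a')
      then show ?thesis using x sorted_wrt_nth_less[OF sorted_rect_parts, of a' a k "replicate r k @ is"] by simp
    qed
    then show "x \<in> ferrers ((k + sum_list (replicate r k @ is)) # ?p)" using x by (simp add: ferrers_def)
  qed
  then show ?case using Suc unfolding parts by blast
qed simp

text \<open>Each block ends in a bead from the class of \<open>s k\<close> and contains a vacancy
  from the class of \<open>s 0\<close>, so both sides of its rectangle are positive. Beads can be
  lowered by k + 1, so higher blocks hold fewer beads; this is the required order of the
  sizes.\<close>

lemma core_subset_rect_parts:
  assumes k: "k \<ge> 1" and s: "affine_perm k s" "increasing_on_window k s"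
    and D: "is_core (k + 1) D" "beads D = s ` {..<0}"
    and M: "int M * (int k + 1) \<le> s (int k) - s 0" "s (int k) - s 0 < int (Suc M) * (int k + 1)"
  shows "\<exists>is. length is = M \<and> set is \<subseteq> {1..k} \<and> sorted_wrt (\<ge>) is \<and> D \<subseteq> ferrers (rect_parts k is)"
proof -
  let ?N = "int k + 1"
  have P: "is_partition D" using D by (simp add: is_core_def)
  have closed: "x - ?N \<in> beads D" if "x \<in> beads D" for x
    using core_closed[OF D(1) that, of "x - ?N"] by simp
  \<comment> \<open>Chosen so that the M blocks end exactly at the largest bead,
    \<open>s k - (k + 1)\<close>. The bounds on M then place \<open>s 0\<close> in the first
    block.\<close>
  define q where "q = s (int k) - int (Suc M) * ?N + 1"
  define B where "B t = {x \<in> beads D. q + int t * ?N \<le> x \<and> x < q + int (Suc t) * ?N}" for t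
  define n where "n t = card (B t)" for t
  have fin: "finite (B t)" for t unfolding B_def
    by (rule finite_subset[of _ "{q + int t * ?N..<q + int (Suc t) * ?N}"]) auto
  have q: "q \<le> s 0" "s 0 < q + ?N" using M by (simp_all add: q_def algebra_simps)
  have n_pos: "1 \<le> n t" if "t < M" for t
  proof -
    define x where "x = q + int (Suc t) * ?N - 1"
    have "x = s (int k) - int (M - t) * ?N" using that by (simp add: x_def q_def of_nat_diff algebra_simps)
    then have "x = s (int k + ?N * (- int (M - t)))" unfolding affine_permD(1)[OF s(1)] by (simp add: algebra_simps)
    moreover have "int k + ?N * (- int (M - t)) < 0"
      using window_quotient_sign[of k k "- int (M - t)"] that by simp
    ultimately have "x \<in> beads D" unfolding D(2) by blast
    then have "x \<in> B t" by (simp add: B_def x_def algebra_simps)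
    then show ?thesis using fin[of t] unfolding n_def by (metis One_nat_def Suc_leI card_gt_0_iff empty_iff)
  qed
  have n_le: "n t \<le> k" for t
  proof -
    define x where "x = s 0 + int t * ?N"
    have "x = s (0 + ?N * int t)" unfolding x_def affine_permD(1)[OF s(1)] by (simp add: algebra_simps)
    then have "x \<notin> beads D" unfolding D(2) using affine_perm_nonneg_notin[OF s(1), of "0 + ?N * int t"] by simp
    define W where "W = {q + int t * ?N..<q + int (Suc t) * ?N}"
    have "x \<in> W" using q by (simp add: W_def x_def algebra_simps)
    moreover have "x \<notin> B t" using \<open>x \<notin> beads D\<close> unfolding B_def by blast
    moreover have "B t \<subseteq> W" unfolding B_def W_def by (intro subsetI) simp
    ultimately have "B t \<subset> W" by blast
    then have "n t < card W" unfolding n_def by (rule psubset_card_mono[rotated]) (simp add: W_def)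
    also have "card W = k + 1" by (simp add: W_def algebra_simps)
    finally show ?thesis by simp
  qed
  have n_Suc: "n (Suc t) \<le> n t" for t
  proof -
    have "x - ?N \<in> B t" if "x \<in> B (Suc t)" for x
    proof -
      have x: "x \<in> beads D" "q + int (Suc t) * ?N \<le> x" "x < q + int (Suc (Suc t)) * ?N"
        using that by (simp_all only: B_def mem_Collect_eq)
      have "int (Suc (Suc t)) * ?N = int (Suc t) * ?N + ?N" "int (Suc t) * ?N = int t * ?N + ?N"
        by (simp_all add: algebra_simps)
      then have "q + int t * ?N \<le> x - ?N" "x - ?N < q + int (Suc t) * ?N" using x by linarith+
      then show ?thesis using closed[OF x(1)] by (simp only: B_def mem_Collect_eq)
    qed
    then have "(\<lambda>x. x - ?N) ` B (Suc t) \<subseteq> B t" by blast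
    then have "card ((\<lambda>x. x - ?N) ` B (Suc t)) \<le> card (B t)" by (rule card_mono[OF fin])
    moreover have "card ((\<lambda>x. x - ?N) ` B (Suc t)) = card (B (Suc t))" by (rule card_image) (simp add: inj_on_def)
    ultimately show ?thesis by (simp add: n_def)
  qed
  then have n_anti: "n t' \<le> n t" if "t \<le> t'" for t t' using lift_Suc_antimono_le[of n] that by blast
  define J where "J = rev (map (\<lambda>t. k + 1 - n t) [0..<M])"
  have "D \<subseteq> ferrers (rect_parts k J)"
    unfolding J_def
  proof (rule partition_subset_rect_parts[OF P])
    show "z \<in> beads D" if "z < q" for z
      unfolding D(2) using that q(1) by (intro below_window[OF s]) simp
    show "x < q + int M * ?N" if "x \<in> beads D" for x
      using bead_above_bound[OF s] that unfolding D(2) by (force simp: q_def algebra_simps)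
    show "n t = card {x \<in> beads D. q + int t * ?N \<le> x \<and> x < q + int (Suc t) * ?N}" for t
      by (simp only: n_def B_def)
    show "n t \<le> k + 1" for t using n_le[of t] by simp
  qed
  moreover have "length J = M" by (simp add: J_def)
  moreover have "k + 1 - n t \<in> {1..k}" if "t < M" for t using n_pos[OF that] n_le[of t] by auto
  then have "set J \<subseteq> {1..k}" unfolding J_def by auto
  moreover have "sorted_wrt (\<ge>) J"
  proof -
    have "k + 1 - n (M - Suc i) \<ge> k + 1 - n (M - Suc j)" if "i < j" for i j
      by (intro diff_le_mono2 n_anti) (use that in simp)
    then show ?thesis by (simp add: J_def sorted_wrt_iff_nth_less rev_nth)
  qed
  ultimately show ?thesis by blast
qed

text \<open>If M full periods fit between \<open>s 0\<close> and \<open>s k\<close>, then M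
  rectangles suffice, and M < m means that at most m - 1 are used; rows of size k fill up the
  list.\<close>

lemma core_in_cores_iff:
  assumes k: "k \<ge> 1" and m: "m \<ge> 1" and s: "affine_perm k s" "increasing_on_window k s"
    and D: "is_core (k + 1) D" "beads D = s ` {..<0}"
  shows "D \<in> cores m k \<longleftrightarrow> s (int k) < s 0 + int m * (int k + 1)"
proof
  assume "D \<in> cores m k"
  then obtain "is" where "is": "length is = m - 1" "set is \<subseteq> {1..k}" "D \<subseteq> ferrers (rect_parts k is)"
    unfolding cores_def by blast
  have "is_partition D" using D by (simp add: is_core_def)
  from core_spread[OF s this D(2) "is"(2,3)] show "s (int k) < s 0 + int m * (int k + 1)"
    using "is"(1) m by (simp add: of_nat_diff)
next
  assume spread: "s (int k) < s 0 + int m * (int k + 1)"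
  let ?N = "int k + 1"
  define M where "M = nat ((s (int k) - s 0) div ?N)"
  have "s 0 < s (int k)" using increasing_on_window_less[OF s(2), of 0 k] k by simp
  then have M: "int M = (s (int k) - s 0) div ?N" by (simp add: M_def pos_imp_zdiv_nonneg_iff)
  define r where "r = (s (int k) - s 0) mod ?N"
  have "s (int k) - s 0 = ?N * int M + r" unfolding M r_def by simp
  moreover have "0 \<le> r" "r < ?N" using pos_mod_bound[of ?N] by (simp_all add: r_def)
  ultimately have M': "int M * ?N \<le> s (int k) - s 0" "s (int k) - s 0 < int (Suc M) * ?N"
    by (simp_all add: algebra_simps)
  have "int M * ?N < int m * ?N" using M'(1) spread by linarith
  then have "int M < int m" by (rule mult_right_less_imp_less) simp
  then have "M < m" by simp
  obtain "is" where "is": "length is = M" "set is \<subseteq> {1..k}" "sorted_wrt (\<ge>) is" "D \<subseteq> ferrers (rect_parts k is)"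
    using core_subset_rect_parts[OF k s D M'] by blast
  define J where "J = replicate (m - 1 - M) k @ is"
  have "length J = m - 1" using \<open>M < m\<close> "is"(1) by (simp add: J_def)
  moreover have "set J \<subseteq> {1..k}" using "is"(2) k by (auto simp: J_def)
  moreover have "sorted_wrt (\<ge>) J"
    using "is"(2,3) by (auto simp: J_def sorted_wrt_append sorted_wrt_replicate)
  moreover have "D \<subseteq> ferrers (rect_parts k J)" using "is"(4) ferrers_rect_parts_pad unfolding J_def by blast
  ultimately show "D \<in> cores m k" using D(1) unfolding cores_def by blast
qed

section \<open>The bijection between alcoves and cores\<close>

context type_A
begin

text \<open>The core does not depend on the chosen word: an alcove determines the window up to a
  constant, and the window sum fixes the constant, so all words for the alcove have the same
  permutation.\<close>

lemma core_of_alcove_alc: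
  assumes s: "affine_perm k s" "increasing_on_window k s"
  shows "is_core (k + 1) (core_of_alcove k \<alpha> (alc s))" "beads (core_of_alcove k \<alpha> (alc s)) = s ` {..<0}"
proof -
  obtain w where w: "w \<in> lists {0..k}" "wperm k w = s" using ex_wperm[OF k s] by blast
  note core = word_inverse_core[OF k w(1)]
  have "core_of_alcove k \<alpha> (alc s) = word_inverse_core k w"
    unfolding core_of_alcove_def
  proof (rule the_equality)
    show "\<exists>w' \<in> lists {0..k}. word_alcove k \<alpha> w' = alc s \<and> word_inverse_core k w' = word_inverse_core k w"
      using w word_alcove_eq by blast
    fix E assume "\<exists>w' \<in> lists {0..k}. word_alcove k \<alpha> w' = alc s \<and> word_inverse_core k w' = E"
    then obtain w' where w': "w' \<in> lists {0..k}" "word_alcove k \<alpha> w' = alc s" "word_inverse_core k w' = E" by blast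
    define t where "t = wperm k w'"
    have t: "affine_perm k t" unfolding t_def by (rule affine_perm_wperm[OF k w'(1)])
    have "alc t = alc s" using word_alcove_eq[OF w'(1)] w'(2) by (simp add: t_def)
    define d where "d = t 0 - s 0"
    have diff: "t (int j) = s (int j) + d" if "j \<le> k" for j
      using alc_inj[OF affine_perm_distinct_residues[OF t] affine_perm_distinct_residues[OF s(1)] \<open>alc t = alc s\<close> that]
      by (simp add: d_def)
    have "(\<Sum>j \<le> k. t (int j)) = (\<Sum>j \<le> k. s (int j) + d)" by (rule sum.cong) (use diff in auto)
    then have "(int k + 1) * d = 0"
      using affine_permD(3)[OF t] affine_permD(3)[OF s(1)] by (simp add: sum.distrib algebra_simps)
    then have "t = s" using diff by (intro affine_perm_ext[OF t s(1)]) auto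
    then have "beads E = beads (word_inverse_core k w)"
      using word_inverse_core(2)[OF k w'(1)] core(2) w w'(3) by (simp add: t_def)
    then show "E = word_inverse_core k w"
      using beads_inj core(1) word_inverse_core(1)[OF k w'(1)] w'(3) by (metis is_core_def)
  qed
  then show "is_core (k + 1) (core_of_alcove k \<alpha> (alc s))" "beads (core_of_alcove k \<alpha> (alc s)) = s ` {..<0}"
    using core w by simp_all
qed

text \<open>Translating the window makes its sum the required one, because the residues are those
  of \<open>0, \<dots>, k\<close>.\<close>
lemma simplex_alcove_affine_perm:
  assumes m: "m \<ge> 1" and A: "A \<in> simplex_alcoves m k \<alpha>"
  shows "\<exists>s. affine_perm k s \<and> increasing_on_window k s \<and> s (int k) < s 0 + int m * (int k + 1) \<and> A = alc s"
proof -
  let ?N = "int k + 1"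
  have A': "A \<in> alcoves k \<alpha>" "A \<subseteq> dilated_simplex m k \<alpha>" using A by (auto simp: simplex_alcoves_def)
  obtain s where s: "distinct_residues k s" "A = alc s" using ex_alc_of_alcove[OF A'(1)] by blast
  have win: "\<forall>j < k. s (int j) < s (int j + 1)" "s (int k) < s 0 + int m * ?N"
    using A'(2) unfolding s(2) alc_subset_simplex_iff[OF s(1)] by blast+
  have "(\<Sum>j \<le> k. s (int j) mod ?N) = (\<Sum>r \<in> {0..<?N}. r)"
    by (rule sum.reindex_bij_betw[OF distinct_residues_bij[OF s(1)]])
  also have "\<dots> = (\<Sum>j \<le> k. int j mod ?N)"
    using sum.reindex_bij_betw[OF distinct_residues_bij[OF affine_perm_distinct_residues[OF affine_perm_id]], of "\<lambda>r. r"] by simp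
  also have "\<dots> = (\<Sum>j \<le> k. int j)" by (rule sum.cong) auto
  finally have "(\<Sum>j \<le> k. int j) - (\<Sum>j \<le> k. s (int j)) = (\<Sum>j \<le> k. s (int j) mod ?N - s (int j))"
    by (simp add: sum_subtractf)
  moreover have "?N dvd (\<Sum>j \<le> k. s (int j) mod ?N - s (int j))"
    by (rule dvd_sum) (simp add: mod_eq_dvd_iff[symmetric])
  ultimately obtain c where c: "(\<Sum>j \<le> k. int j) - (\<Sum>j \<le> k. s (int j)) = ?N * c" by (metis dvdE)
  define t where "t i = s (i mod ?N) + ?N * (i div ?N) + c" for i
  have t: "t (int j) = s (int j) + c" if "j \<le> k" for j using that by (simp add: t_def)
  have per: "t (i + ?N * q) = t i + ?N * q" for i q
  proof -
    have "(i + ?N * q) mod ?N = i mod ?N" "(i + ?N * q) div ?N = i div ?N + q"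
      by (rule mod_mult_self2, subst div_mult_self2) simp_all
    then show ?thesis unfolding t_def by (simp only: distrib_left)
  qed
  have "affine_perm k t"
    unfolding affine_perm_def
  proof (intro conjI allI impI)
    fix i j assume ij: "[t i = t j] (mod ?N)"
    obtain a p where a: "a \<le> k" "i = int a + ?N * p" by (rule int_window_cases)
    obtain b q where b: "b \<le> k" "j = int b + ?N * q" by (rule int_window_cases)
    have "[s (int a) + c = s (int b) + c] (mod ?N)"
      using ij unfolding a(2) b(2) per t[OF a(1)] t[OF b(1)] by (simp add: cong_def)
    then have "[s (int a) = s (int b)] (mod ?N)" by (simp only: cong_add_rcancel)
    then have "a = b" using s(1) a b unfolding distinct_residues_def by blast
    then show "[i = j] (mod ?N)" unfolding a b by (simp add: cong_def)
  next
    have "(\<Sum>j \<le> k. t (int j)) = (\<Sum>j \<le> k. s (int j) + c)" by (rule sum.cong) (use t in auto)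
    then show "(\<Sum>j \<le> k. t (int j)) = (\<Sum>j \<le> k. int j)" using c by (simp add: sum.distrib algebra_simps)
  qed (rule per)
  moreover have "increasing_on_window k t"
    unfolding increasing_on_window_def
  proof (intro allI impI)
    fix j assume "j < k"
    then show "t (int j) < t (int j + 1)" using win(1) t[of j] t[of "Suc j"] by (simp add: add.commute)
  qed
  moreover have "t (int k) < t 0 + int m * ?N" using win(2) t[of k] t[of 0] by simp
  moreover have "A = alc t" unfolding s(2) by (rule alc_cong) (use t t[of 0] in simp)
  ultimately show ?thesis by blast
qed

text \<open>Both sides are parametrized by the affine permutations with increasing window and s k <
  s 0 + m (k + 1); this inequality is containment in the simplex on one side and in the rectangles
  on the other.\<close>

lemma bij_core_of_alcove:
  assumes m: "m \<ge> 1"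
  shows "bij_betw (core_of_alcove k \<alpha>) (simplex_alcoves m k \<alpha>) (cores m k)"
  unfolding bij_betw_def
proof
  show "inj_on (core_of_alcove k \<alpha>) (simplex_alcoves m k \<alpha>)"
  proof (rule inj_onI)
    fix A B assume AB: "A \<in> simplex_alcoves m k \<alpha>" "B \<in> simplex_alcoves m k \<alpha>"
      "core_of_alcove k \<alpha> A = core_of_alcove k \<alpha> B"
    obtain s where s: "affine_perm k s" "increasing_on_window k s" "A = alc s"
      using simplex_alcove_affine_perm[OF m AB(1)] by blast
    obtain t where t: "affine_perm k t" "increasing_on_window k t" "B = alc t"
      using simplex_alcove_affine_perm[OF m AB(2)] by blast
    have "s ` {..<0} = t ` {..<0}"
      using core_of_alcove_alc(2)[OF s(1,2)] core_of_alcove_alc(2)[OF t(1,2)] AB(3) s(3) t(3) by simp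
    then show "A = B" using increasing_affine_perm_unique[OF s(1,2) t(1,2)] s(3) t(3) by simp
  qed
  show "core_of_alcove k \<alpha> ` simplex_alcoves m k \<alpha> = cores m k"
  proof (intro equalityI subsetI)
    fix D assume "D \<in> core_of_alcove k \<alpha> ` simplex_alcoves m k \<alpha>"
    then obtain A where A: "A \<in> simplex_alcoves m k \<alpha>" "D = core_of_alcove k \<alpha> A" by blast
    obtain s where s: "affine_perm k s" "increasing_on_window k s" "s (int k) < s 0 + int m * (int k + 1)" "A = alc s"
      using simplex_alcove_affine_perm[OF m A(1)] by blast
    show "D \<in> cores m k"
      using core_in_cores_iff[OF k m s(1,2)] core_of_alcove_alc[OF s(1,2)] s(3,4) A(2) by simp
  next
    fix D assume D: "D \<in> cores m k"
    then have core: "is_core (k + 1) D" by (simp add: cores_def)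
    obtain u where u: "affine_perm k u" "beads D = u ` {..<0}" using ex_affine_perm_of_core[OF k core] by blast
    obtain s where s: "affine_perm k s" "increasing_on_window k s" "beads D = s ` {..<0}"
      using ex_increasing_affine_perm[OF u(1)] u(2) by metis
    have res: "distinct_residues k s" by (rule affine_perm_distinct_residues[OF s(1)])
    have "s (int k) < s 0 + int m * (int k + 1)" using core_in_cores_iff[OF k m s(1,2) core s(3)] D by blast
    then have "alc s \<subseteq> dilated_simplex m k \<alpha>"
      using s(2) unfolding alc_subset_simplex_iff[OF res] increasing_on_window_def by blast
    then have "alc s \<in> simplex_alcoves m k \<alpha>" using alc_in_alcoves[OF res] by (simp add: simplex_alcoves_def)
    moreover have "core_of_alcove k \<alpha> (alc s) = D"
      by (rule beads_inj) (use core_of_alcove_alc[OF s(1,2)] core s(3) in \<open>auto simp: is_core_def\<close>)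
    ultimately show "D \<in> core_of_alcove k \<alpha> ` simplex_alcoves m k \<alpha>" by blast
  qed
qed

lemma cyclic_sieving_cores:
  assumes m: "m \<ge> 1"
  shows "cyclic_sieving_by (k + 1) (cores m k) (W_poly m k) (core_rho m k \<alpha>)"
proof (rule cyclic_sieving_by_shift)
  show m': "m > 0" using m by simp
  show "bij_betw (core_of_alcove k \<alpha> \<circ> alc) (gapseq m (k + 1)) (cores m k)"
    by (rule bij_betw_trans[OF bij_alc[OF m'] bij_core_of_alcove[OF m]])
  fix s assume s: "s \<in> gapseq m (k + 1)"
  have "alc s \<in> simplex_alcoves m k \<alpha>" using bij_betwE[OF bij_alc[OF m']] s by blast
  then have "the_inv_into (simplex_alcoves m k \<alpha>) (core_of_alcove k \<alpha>) (core_of_alcove k \<alpha> (alc s)) = alc s"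
    by (rule the_inv_into_f_f[OF bij_betw_imp_inj_on[OF bij_core_of_alcove[OF m]]])
  then show "core_rho m k \<alpha> ((core_of_alcove k \<alpha> \<circ> alc) s) = (core_of_alcove k \<alpha> \<circ> alc) (shift (- 1) s)"
    by (simp add: core_rho_def rho_alc[OF m' s])
qed simp

end

theorem corollary6p1:
  fixes k m :: nat and \<alpha> :: "nat \<Rightarrow> 'a::real_inner"
  assumes "k \<ge> 1" and "m \<ge> 1"
  shows "cyclic_sieving_by (k + 1) (words m k) (W_poly m k) (phi m k) \<and>
    (type_A_simple_roots k \<alpha> \<longrightarrow>
       cyclic_sieving_by (k + 1) (cores m k) (W_poly m k) (core_rho m k \<alpha>) \<and>
       cyclic_sieving_by (k + 1) (simplex_alcoves m k \<alpha>) (W_poly m k) (\<lambda>A. rho m k \<alpha> ` A))"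
proof (intro conjI impI)
  have m: "m > 0" using assms by simp
  show "cyclic_sieving_by (k + 1) (words m k) (W_poly m k) (phi m k)"
    by (rule cyclic_sieving_words[OF m])
  assume "type_A_simple_roots k \<alpha>"
  then interpret type_A k \<alpha> using assms by unfold_locales
  show "cyclic_sieving_by (k + 1) (cores m k) (W_poly m k) (core_rho m k \<alpha>)"
    by (rule cyclic_sieving_cores[OF assms(2)])
  show "cyclic_sieving_by (k + 1) (simplex_alcoves m k \<alpha>) (W_poly m k) (\<lambda>A. rho m k \<alpha> ` A)"
    by (rule cyclic_sieving_simplex_alcoves[OF m])
qed

end
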